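(* Let $f\in\mathbb{R}\{x,y\}$ be a right-reduced series satisfying the injectivity condition, let $F_x(y)\in\mathbb{R}\{x,y\}$ be a primitive of $f$, and let $\xi_1<_{\mathbb{R}}\cdots<_{\mathbb{R}}\xi_n$ be the real Newton-Puiseux roots of $f$. Then the integrated contact tree $T_{\int}(f)$ is isomorphic, as a planar rooted tree, to the real contact tree $T_{\mathbb{R}}(\delta_1,\dots,\delta_n)$ of the real Newton-Puiseux roots $\delta_i=F_x(\xi_i)$ of the apparent contour in the target of the projection $\pi$, where $\pi(x,y,z)=(x,z)$ on the graph of $(x,y)\mapsto F_x(y)$.
   Context: **Newton-Puiseux series.** For $\mathbb{K}=\mathbb{R}$ or $\mathbb{C}$, $\mathbb{K}\{x\}$ and $\mathbb{K}\{x,y\}$ are the rings of convergent power series, and $\mathbb{K}\{x^{1/\mathbb{N}}\}=\{g(x^{1/n}) : g\in\mathbb{K}\{t\},\ n\geq 1 \text{ an integer}\}$. A non-zero $\gamma\in\mathbb{C}\{x^{1/\mathbb{N}}\}$ is written uniquely $\gamma=s x^{\sigma}+(\text{terms of higher exponent})$ with $s\in\mathbb{C}^*$, $\sigma\in\mathbb{Q}\cap[0,\infty)$; $\chi(\gamma):=s$ is its initial coefficient and $\nu(\gamma):=\sigma$ its valuation ($\nu(0)=\infty$). The real total order $<_{\mathbb{R}}$ on $\mathbb{R}\{x^{1/\mathbb{N}}\}$ is: $\xi<_{\mathbb{R}}\xi'$ iff $\chi(\xi'-\xi)>0$. **Roots, right-reduced series, primitives.** Let $f\in\mathbb{R}\{x,y\}$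 with $f(0,0)=0$, $f(0,y)\not\equiv0$. One has a unique factorization $f=u(x,y)\prod_{i=1}^k(y-\gamma_i)$ with $u$ a unit and $\gamma_i\in\mathbb{C}\{x^{1/\mathbb{N}}\}$, $\gamma_i(0)=0$; the $\gamma_i$ are the Newton-Puiseux roots of $f$; real roots are those in $\mathbb{R}\{x^{1/\mathbb{N}}\}$. The series $f$ is right-reduced if $f(0,0)=0$, $f(0,y)\not\equiv0$ and the real roots of $f$ are pairwise distinct. A primitive of $f$ is a series $F_x(y)\in\mathbb{R}\{x,y\}$ with $\partial_yF_x=f$. **Trees.** A tree is a topological space homeomorphic to a finite connected graph without cycles; the valency of a point $P$ is the number of connected components of $T\setminus\{P\}$; vertices are points of valency $\neq2$; edges are closures of the connected components of the complement of the set of vertices. A rooted tree has a marked point $O$ (the root) of valency $1$; $P\preceq_TQ$ iff $[O,P]\subset[O,Q]$; leaves are the $\preceq_T$-maximal points; internal vertices are the vertices that are neither leaves nor the root; $P\wedge Q$ is the greatest lower bound: $[O,P\wedge Q]=[O,P]\cap[O,Q]$. An outgoing edge at an internal vertex $P$ is an edge $[P,Q]$ not contained in $[O,P]$. A planar structure on $T$ is a choice, for each internal vertex $P$, of a total order $<_P$ on the set $\mathcal{E}^+_T(P)$ of outgoing edges at $P$; a planar tree is a rooted tree with a planar structure. It induces a total order on the leaves: $\ell_1<\ell_2$ iff $e_1<_Pe_2$, where $P=\ell_1\wedge\ell_2$ and $e_1,e_2\in\mathcal{E}_T^+(P)$ go towards $\ell_1,\ell_2$. An isomorphism of planar rooted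 trees is a homeomorphism sending root to root and preserving the total orders on the sets of outgoing edges at internal vertices. **Contact trees.** For a finite set $\mathcal{N}=\{\gamma_1,\dots,\gamma_n\}$ of Newton-Puiseux series whose pairwise differences all have positive valuation, the contact tree is obtained by taking one copy $I_i$ of $[0,\infty]$ for each $\gamma_i$ and, for $i\ne j$, gluing $[0,\nu(\gamma_j-\gamma_i)]\subset I_i$ with $[0,\nu(\gamma_j-\gamma_i)]\subset I_j$ by identifying points with equal coordinate. The root is the common point of coordinate $0$; the leaves are identified with the elements of $\mathcal{N}$ (if $\mathcal{N}$ is empty, the tree is empty). If $\mathcal{N}\subset\mathbb{R}\{x^{1/\mathbb{N}}\}$, the contact tree is denoted $T_{\mathbb{R}}(\gamma_1,\dots,\gamma_n)$ and called the real contact tree; the order $<_{\mathbb{R}}$ on its leaves is induced by a unique planar structure, the real planar structure, and real contact trees are regarded as planar trees in this way. $T_{\mathbb{R}}(f):=T_{\mathbb{R}}(\xi_1,\dots,\xi_n)$. **Injectivity condition.** For $1\le r\le n-1$ let $S_r:=F_x(\xi_{r+1})-F_x(\xi_r)\in\mathbb{R}\{x^{1/\mathbb{N}}\}$ (where $F_x(\xi)$ denotes $F$ with $y$ replaced by $\xi$; $S_r$ is non-zero and independent of the choice of primitive), and let $s_r:=\chi(S_r)$. Let $P$ be an internal vertex of $T_{\mathbb{R}}(f)$ with outgoing edges $e_1<_P\cdots<_Pe_p$ for the real planar structure. For $1\le k\le p-1$ there is a unique index $\iota(k)$ such that $\xi_{\iota(k)}\wedge\xi_{\iota(k)+1}=P$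 and $e_k$, $e_{k+1}$ are the outgoing edges at $P$ going to $\xi_{\iota(k)}$, $\xi_{\iota(k)+1}$ respectively. The discrete integration map at $P$ is ${\int}_P:\{0,1,\dots,p-1\}\to\mathbb{R}$, ${\int}_P(0)=0$, ${\int}_P(i)=s_{\iota(1)}+\cdots+s_{\iota(i)}$. The series $f$ satisfies the injectivity condition if ${\int}_P$ is injective for every internal vertex $P$ of $T_{\mathbb{R}}(f)$. **Integrated contact tree.** If $f$ satisfies the injectivity condition, define for each internal vertex $P$ of $T_{\mathbb{R}}(f)$ a total order on the outgoing edges at $P$ by $e_k<_{\int,P}e_l$ iff ${\int}_P(k-1)<{\int}_P(l-1)$. These orders form the integrated planar structure; the abstract rooted tree $T_{\mathbb{R}}(f)$ endowed with it is the integrated contact tree $T_{\int}(f)$. **Apparent contour.** For $\epsilon>0$ small enough and a suitable compact interval neighborhood $I$ of $0$, let $\mathcal{G}=\{(x,y,F_x(y)) : (x,y)\in[0,\epsilon]\times I\}\subset\mathbb{R}^3$ and $\pi:\mathcal{G}\to\mathbb{R}^2$, $\pi(x,y,z)=(x,z)$. The apparent contour in the target (discriminant curve) $\Delta$ of $\pi$ is its critical image, i.e. the image of the points with $f(x,y)=0$; its real Newton-Puiseux roots in the coordinates $(x,z)$ are $\delta_i=F_x(\xi_i)\in\mathbb{R}\{x^{1/\mathbb{N}}\}$, $i=1,\dots,n$. *)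

theory Defs
  imports
    "HOL-Analysis.Analysis"
    "HOL-Computational_Algebra.Computational_Algebra"
    "HOL-Library.Groups_Big_Fun"
begin

unbundle no vec_syntax
unbundle fps_syntax

section \<open>Puiseux series with non-negative exponents\<close>

text \<open>Series in \<open>x\<close> with exponents in \<open>\<nat>/n\<close> for some \<open>n \<ge> 1\<close>, given by their coefficient functions.
  Convergence is not part of the type; see \<open>convergent_puiseux\<close> below.\<close>

typedef (overloaded) 'a puiseux =
  "{c :: rat \<Rightarrow> 'a::zero. \<exists>n>0. \<forall>q. c q \<noteq> 0 \<longrightarrow> q * of_nat n \<in> \<nat>}"
  morphisms puiseux_coeff Abs_puiseux
  by (rule exI[of _ "\<lambda>_. 0"]) auto

setup_lifting type_definition_puiseux

lemma puiseux_eqI: "(\<And>q. puiseux_coeff a q = puiseux_coeff b q) \<Longrightarrow> a = b"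
  by (simp add: puiseux_coeff_inject[symmetric] fun_eq_iff)

text \<open>\<open>puiseux_of_fps n g\<close> is \<open>g(x\<^bsup>1/n\<^esup>)\<close>, for \<open>n \<ge> 1\<close>.\<close>

lift_definition puiseux_of_fps :: "nat \<Rightarrow> 'a::zero fps \<Rightarrow> 'a puiseux" is
  "\<lambda>n g q. if 0 < n \<and> q * of_nat n \<in> \<nat> then g $ nat \<lfloor>q * of_nat n\<rfloor> else 0"
  subgoal for n g by (rule exI[of _ "if n = 0 then 1 else n"]) auto
  done

lemma coeff_puiseux_of_fps:
  "0 < n \<Longrightarrow> puiseux_coeff (puiseux_of_fps n g) (of_nat k / of_nat n) = g $ k"
  by (simp add: puiseux_of_fps.rep_eq)

lemma coeff_puiseux_of_fps_0:
  "(\<And>k. q \<noteq> of_nat k / of_nat n) \<Longrightarrow> puiseux_coeff (puiseux_of_fps n g) q = 0"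
proof (rule ccontr)
  assume q: "\<And>k. q \<noteq> of_nat k / of_nat n" and "puiseux_coeff (puiseux_of_fps n g) q \<noteq> 0"
  hence "0 < n" "q * of_nat n \<in> \<nat>" by (auto simp: puiseux_of_fps.rep_eq split: if_splits)
  then obtain k where "q * of_nat n = of_nat k" unfolding Nats_def by blast
  with \<open>0 < n\<close> have "q = of_nat k / of_nat n" by (simp add: field_simps)
  thus False using q by blast
qed

lemma puiseux_eq_of_fpsI:
  assumes "0 < n" "\<And>k. puiseux_coeff a (of_nat k / of_nat n) = g $ k"
    "\<And>q. (\<And>k. q \<noteq> of_nat k / of_nat n) \<Longrightarrow> puiseux_coeff a q = 0"
  shows "a = puiseux_of_fps n g"
proof (rule puiseux_eqI)
  fix q show "puiseux_coeff a q = puiseux_coeff (puiseux_of_fps n g) q"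
    using assms by (cases "\<exists>k. q = of_nat k / of_nat n")
      (auto simp: coeff_puiseux_of_fps coeff_puiseux_of_fps_0)
qed

lemma puiseux_of_fps_inject: "0 < n \<Longrightarrow> puiseux_of_fps n g = puiseux_of_fps n h \<longleftrightarrow> g = h"
  by (metis coeff_puiseux_of_fps fps_ext)

lemma puiseux_of_fps_exists_multiple:
  fixes a :: "'a::zero puiseux"
  shows "\<exists>n>0. \<forall>m>0. \<exists>g. a = puiseux_of_fps (n * m) g"
proof -
  obtain n where n: "n > 0" "\<And>q. puiseux_coeff a q \<noteq> 0 \<Longrightarrow> q * of_nat n \<in> \<nat>"
    using puiseux_coeff[of a] by auto
  have "a = puiseux_of_fps (n * m) (Abs_fps (\<lambda>k. puiseux_coeff a (of_nat k / of_nat (n * m))))"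
    if "m > 0" for m
  proof (rule puiseux_eq_of_fpsI)
    fix q :: rat assume q: "\<And>k. q \<noteq> of_nat k / of_nat (n * m)"
    show "puiseux_coeff a q = 0"
    proof (rule ccontr)
      assume "puiseux_coeff a q \<noteq> 0"
      then obtain k where "q * of_nat n = of_nat k"
        using n by (auto simp: Nats_def)
      hence "q = of_nat (k * m) / of_nat (n * m)"
        using n that by (simp add: field_simps)
      thus False using q by blast
    qed
  qed (use n that in auto)
  thus ?thesis using n by blast
qed

lemma puiseux_of_fps_exists: "\<exists>n>0. \<exists>g. a = puiseux_of_fps n g"
  using puiseux_of_fps_exists_multiple[of a] by (metis mult.right_neutral zero_less_one)

lemma puiseux_of_fps_exists2: "\<exists>n>0. \<exists>g h. a = puiseux_of_fps n g \<and> b = puiseux_of_fps n h"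
  using puiseux_of_fps_exists_multiple[of a] puiseux_of_fps_exists_multiple[of b]
  by (metis mult.commute nat_0_less_mult_iff)

lemma puiseux_of_fps_exists3:
  "\<exists>n>0. \<exists>g h k. a = puiseux_of_fps n g \<and> b = puiseux_of_fps n h \<and> c = puiseux_of_fps n k"
proof -
  obtain n m l where *: "n > 0" "\<forall>m>0. \<exists>g. a = puiseux_of_fps (n * m) g"
    "m > 0" "\<forall>n>0. \<exists>g. b = puiseux_of_fps (m * n) g"
    "l > 0" "\<forall>n>0. \<exists>g. c = puiseux_of_fps (l * n) g"
    using puiseux_of_fps_exists_multiple by metis
  have pos: "m * l > 0" "n * l > 0" "n * m > 0" and
    eq: "n * (m * l) = n * m * l" "m * (n * l) = n * m * l" "l * (n * m) = n * m * l"
    using * by simp_all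
  obtain g where "a = puiseux_of_fps (n * m * l) g"
    using *(2)[rule_format, OF pos(1)] unfolding eq by blast
  moreover obtain h where "b = puiseux_of_fps (n * m * l) h"
    using *(4)[rule_format, OF pos(2)] unfolding eq by blast
  moreover obtain k where "c = puiseux_of_fps (n * m * l) k"
    using *(6)[rule_format, OF pos(3)] unfolding eq by blast
  moreover have "n * m * l > 0" using * by simp
  ultimately show ?thesis by blast
qed

lemma support_add:
  fixes c d :: "rat \<Rightarrow> 'a::monoid_add"
  assumes "\<exists>n>0. \<forall>q. c q \<noteq> 0 \<longrightarrow> q * of_nat n \<in> \<nat>" "\<exists>n>0. \<forall>q. d q \<noteq> 0 \<longrightarrow> q * of_nat n \<in> \<nat>"
    "\<And>q. e q \<noteq> 0 \<Longrightarrow> c q \<noteq> 0 \<or> d q \<noteq> 0"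
  shows "\<exists>n>0. \<forall>q. e q \<noteq> 0 \<longrightarrow> q * of_nat n \<in> \<nat>"
proof -
  obtain n m where *: "n > 0" "\<And>q. c q \<noteq> 0 \<Longrightarrow> q * of_nat n \<in> \<nat>"
    "m > 0" "\<And>q. d q \<noteq> 0 \<Longrightarrow> q * of_nat m \<in> \<nat>"
    using assms by metis
  have "q * of_nat (n * m) \<in> \<nat>" if "e q \<noteq> 0" for q
    using assms(3)[OF that]
  proof
    assume "c q \<noteq> 0"
    hence "q * of_nat n * of_nat m \<in> \<nat>" by (intro Nats_mult *) auto
    thus ?thesis by (simp add: mult_ac)
  next
    assume "d q \<noteq> 0"
    hence "q * of_nat m * of_nat n \<in> \<nat>" by (intro Nats_mult *) auto
    thus ?thesis by (simp add: mult_ac)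
  qed
  thus ?thesis using * by (intro exI[of _ "n * m"]) auto
qed

lemma Sum_any_convolution_neq_0:
  fixes c d :: "rat \<Rightarrow> 'a::semiring_0"
  assumes "Sum_any (\<lambda>r. c r * d (q - r)) \<noteq> 0"
  shows "\<exists>r. c r \<noteq> 0 \<and> d (q - r) \<noteq> 0"
proof (rule ccontr)
  assume "\<not> ?thesis"
  hence "c r * d (q - r) = 0" for r by (cases "c r = 0") auto
  thus False using assms by simp
qed

instantiation puiseux :: (comm_ring_1) comm_ring_1
begin

lift_definition zero_puiseux :: "'a puiseux" is "\<lambda>_. 0" by auto

lift_definition one_puiseux :: "'a puiseux" is "\<lambda>q. if q = 0 then 1 else 0" by auto

lift_definition uminus_puiseux :: "'a puiseux \<Rightarrow> 'a puiseux" is "\<lambda>a q. - a q" by auto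

lift_definition plus_puiseux :: "'a puiseux \<Rightarrow> 'a puiseux \<Rightarrow> 'a puiseux" is "\<lambda>a b q. a q + b q"
  subgoal for a b by (rule support_add[of a b]) auto
  done

lift_definition minus_puiseux :: "'a puiseux \<Rightarrow> 'a puiseux \<Rightarrow> 'a puiseux" is "\<lambda>a b q. a q - b q"
  subgoal for a b by (rule support_add[of a b]) auto
  done

lift_definition times_puiseux :: "'a puiseux \<Rightarrow> 'a puiseux \<Rightarrow> 'a puiseux" is
  "\<lambda>a b q. Sum_any (\<lambda>r. a r * b (q - r))"
proof -
  fix a b :: "rat \<Rightarrow> 'a"
  assume "\<exists>n>0. \<forall>q. a q \<noteq> 0 \<longrightarrow> q * of_nat n \<in> \<nat>" "\<exists>n>0. \<forall>q. b q \<noteq> 0 \<longrightarrow> q * of_nat n \<in> \<nat>"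
  then obtain n m where *: "n > 0" "\<And>q. a q \<noteq> 0 \<Longrightarrow> q * of_nat n \<in> \<nat>"
    "m > 0" "\<And>q. b q \<noteq> 0 \<Longrightarrow> q * of_nat m \<in> \<nat>"
    by metis
  have "q * of_nat (n * m) \<in> \<nat>" if nz: "Sum_any (\<lambda>r. a r * b (q - r)) \<noteq> 0" for q
  proof -
    obtain r where "a r \<noteq> 0" "b (q - r) \<noteq> 0"
      using Sum_any_convolution_neq_0[OF nz] by blast
    hence "(r * of_nat n) * of_nat m + ((q - r) * of_nat m) * of_nat n \<in> \<nat>"
      by (intro Nats_add Nats_mult *) auto
    thus ?thesis by (simp add: algebra_simps)
  qed
  thus "\<exists>n>0. \<forall>q. Sum_any (\<lambda>r. a r * b (q - r)) \<noteq> 0 \<longrightarrow> q * of_nat n \<in> \<nat>"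
    using * by (intro exI[of _ "n * m"]) auto
qed

lemma puiseux_of_fps_mult:
  fixes g h :: "'a fps"
  assumes n: "n > 0"
  shows "puiseux_of_fps n g * puiseux_of_fps n h = puiseux_of_fps n (g * h)"
proof (rule puiseux_eq_of_fpsI[OF n])
  fix k
  let ?t = "\<lambda>r. puiseux_coeff (puiseux_of_fps n g) r *
                 puiseux_coeff (puiseux_of_fps n h) (of_nat k / of_nat n - r)"
  let ?e = "\<lambda>i. of_nat i / of_nat n :: rat"
  have sub: "{r. ?t r \<noteq> 0} \<subseteq> ?e ` {0..k}"
  proof
    fix r assume "r \<in> {r. ?t r \<noteq> 0}"
    hence "puiseux_coeff (puiseux_of_fps n g) r \<noteq> 0"
      "puiseux_coeff (puiseux_of_fps n h) (?e k - r) \<noteq> 0" by auto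
    then obtain i j where ij: "r = ?e i" "?e k - r = ?e j"
      using coeff_puiseux_of_fps_0 by metis
    hence "(of_nat k :: rat) = of_nat (i + j)" using n by (simp add: field_simps)
    hence "k = i + j" by (simp only: of_nat_eq_iff)
    thus "r \<in> ?e ` {0..k}" using ij by auto
  qed
  have "puiseux_coeff (puiseux_of_fps n g * puiseux_of_fps n h) (?e k) = Sum_any ?t"
    by (simp add: times_puiseux.rep_eq)
  also have "\<dots> = sum ?t (?e ` {0..k})"
    by (rule Sum_any.expand_superset[OF _ sub]) auto
  also have "\<dots> = (\<Sum>i=0..k. ?t (?e i))"
    using n by (subst sum.reindex) (auto simp: inj_on_def)
  also have "\<dots> = (\<Sum>i=0..k. g $ i * h $ (k - i))"
  proof (rule sum.cong)
    fix i assume "i \<in> {0..k}"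
    hence "?e k - ?e i = ?e (k - i)" by (simp add: of_nat_diff diff_divide_distrib)
    thus "?t (?e i) = g $ i * h $ (k - i)" using n by (simp add: coeff_puiseux_of_fps)
  qed auto
  finally show "puiseux_coeff (puiseux_of_fps n g * puiseux_of_fps n h) (?e k) = (g * h) $ k"
    by (simp add: fps_mult_nth)
next
  fix q :: rat assume q: "\<And>k. q \<noteq> of_nat k / of_nat n"
  show "puiseux_coeff (puiseux_of_fps n g * puiseux_of_fps n h) q = 0"
  proof (rule ccontr)
    assume "\<not> ?thesis"
    then obtain r where "puiseux_coeff (puiseux_of_fps n g) r \<noteq> 0"
      "puiseux_coeff (puiseux_of_fps n h) (q - r) \<noteq> 0"
      using Sum_any_convolution_neq_0 by (force simp: times_puiseux.rep_eq)
    then obtain i j where "r = of_nat i / of_nat n" "q - r = of_nat j / of_nat n"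
      using coeff_puiseux_of_fps_0 by metis
    hence "q = of_nat (i + j) / of_nat n" using n by (simp add: field_simps)
    thus False using q by blast
  qed
qed

lemma puiseux_of_fps_add: "puiseux_of_fps n g + puiseux_of_fps n h = puiseux_of_fps n (g + h)"
  for g h :: "'a fps" by transfer auto

lemma puiseux_of_fps_diff: "puiseux_of_fps n g - puiseux_of_fps n h = puiseux_of_fps n (g - h)"
  for g h :: "'a fps" by transfer auto

lemma puiseux_of_fps_uminus: "- puiseux_of_fps n g = puiseux_of_fps n (- g)"
  for g :: "'a fps" by transfer auto

lemma puiseux_of_fps_0: "puiseux_of_fps n 0 = (0 :: 'a puiseux)"
  by transfer auto

lemma puiseux_of_fps_1:
  assumes "n > 0"
  shows "puiseux_of_fps n 1 = (1 :: 'a puiseux)"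
proof (rule sym, rule puiseux_eq_of_fpsI[OF assms])
  fix q :: rat assume "\<And>k. q \<noteq> of_nat k / of_nat n"
  from this[of 0] show "puiseux_coeff (1 :: 'a puiseux) q = 0" by (simp add: one_puiseux.rep_eq)
qed (use assms in \<open>simp add: one_puiseux.rep_eq\<close>)

instance
proof
  fix a b c :: "'a puiseux"
  obtain n g h k where n: "n > 0" and
    eq: "a = puiseux_of_fps n g" "b = puiseux_of_fps n h" "c = puiseux_of_fps n k"
    using puiseux_of_fps_exists3 by metis
  show "a * b * c = a * (b * c)" "a * b = b * a" "(a + b) * c = a * c + b * c" "1 * a = a"
    unfolding eq puiseux_of_fps_1[OF n, symmetric]
    by (simp_all add: puiseux_of_fps_mult[OF n] puiseux_of_fps_add algebra_simps)
  show "a + b + c = a + (b + c)" "a + b = b + a" "0 + a = a" "- a + a = 0" "a - b = a + - b"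
    by (transfer, simp add: add_ac)+
  show "(0 :: 'a puiseux) \<noteq> 1"
    by transfer (auto simp: fun_eq_iff)
qed

end

lemma puiseux_of_fps_power: "n > 0 \<Longrightarrow> puiseux_of_fps n g ^ k = puiseux_of_fps n (g ^ k)"
  for g :: "'a::comm_ring_1 fps"
  by (induction k) (simp_all add: puiseux_of_fps_1 puiseux_of_fps_mult)

instance puiseux :: (idom) idom
proof
  fix a b :: "'a puiseux"
  assume "a \<noteq> 0" "b \<noteq> 0"
  moreover obtain n g h where n: "n > 0" and eq: "a = puiseux_of_fps n g" "b = puiseux_of_fps n h"
    using puiseux_of_fps_exists2 by metis
  ultimately have "g \<noteq> 0" "h \<noteq> 0" by (auto simp: puiseux_of_fps_0)
  hence "g * h \<noteq> 0" by simp
  thus "a * b \<noteq> 0"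
    using n by (metis eq puiseux_of_fps_0 puiseux_of_fps_inject puiseux_of_fps_mult)
qed

text \<open>Initial coefficient \<open>\<chi>\<close> (with value \<open>0\<close> at \<open>0\<close>) and valuation \<open>\<nu>\<close>.\<close>

definition initial_coeff :: "'a::comm_ring_1 puiseux \<Rightarrow> 'a" where
  "initial_coeff a = puiseux_coeff a (LEAST q. puiseux_coeff a q \<noteq> 0)"

definition valuation :: "'a::comm_ring_1 puiseux \<Rightarrow> ereal" where
  "valuation a =
     (if a = 0 then \<infinity> else ereal (of_rat (LEAST q. puiseux_coeff a q \<noteq> 0)))"

lemma Least_puiseux_of_fps:
  fixes g :: "'a::comm_ring_1 fps"
  assumes n: "n > 0" and g: "g \<noteq> 0"
  shows "(LEAST q. puiseux_coeff (puiseux_of_fps n g) q \<noteq> 0) = of_nat (subdegree g) / of_nat n"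
proof (rule Least_equality)
  show "puiseux_coeff (puiseux_of_fps n g) (of_nat (subdegree g) / of_nat n) \<noteq> 0"
    using assms by (simp add: coeff_puiseux_of_fps)
next
  fix q assume q: "puiseux_coeff (puiseux_of_fps n g) q \<noteq> 0"
  then obtain k where k: "q = of_nat k / of_nat n" using coeff_puiseux_of_fps_0 by metis
  with q n have "g $ k \<noteq> 0" by (simp add: coeff_puiseux_of_fps)
  hence "subdegree g \<le> k" by (rule subdegree_leI)
  thus "of_nat (subdegree g) / of_nat n \<le> q" using n k by (simp add: divide_right_mono)
qed

lemma initial_coeff_puiseux_of_fps:
  "n > 0 \<Longrightarrow> initial_coeff (puiseux_of_fps n g) = g $ subdegree g"
  for g :: "'a::comm_ring_1 fps"
  by (cases "g = 0")
    (simp_all add: initial_coeff_def Least_puiseux_of_fps coeff_puiseux_of_fps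
      puiseux_of_fps_0 zero_puiseux.rep_eq)

lemma valuation_puiseux_of_fps:
  "n > 0 \<Longrightarrow> g \<noteq> 0 \<Longrightarrow> valuation (puiseux_of_fps n g) = ereal (real (subdegree g) / real n)"
  for g :: "'a::comm_ring_1 fps"
  by (metis Least_puiseux_of_fps of_rat_divide of_rat_of_nat_eq puiseux_of_fps_0
      puiseux_of_fps_inject valuation_def)

lemma initial_coeff_0_iff: "initial_coeff a = 0 \<longleftrightarrow> a = 0"
  by (metis initial_coeff_puiseux_of_fps nth_subdegree_zero_iff puiseux_of_fps_0
      puiseux_of_fps_exists puiseux_of_fps_inject)

lemma initial_coeff_uminus: "initial_coeff (- a) = - initial_coeff a"
proof -
  obtain n g where "n > 0" "a = puiseux_of_fps n g" using puiseux_of_fps_exists by metis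
  thus ?thesis by (simp add: puiseux_of_fps_uminus initial_coeff_puiseux_of_fps)
qed

lemma initial_coeff_add_pos:
  fixes a b :: "'a::linordered_idom puiseux"
  assumes "initial_coeff a > 0" "initial_coeff b > 0"
  shows "initial_coeff (a + b) > 0"
proof -
  obtain n g h where n: "n > 0" and eq: "a = puiseux_of_fps n g" "b = puiseux_of_fps n h"
    using puiseux_of_fps_exists2 by metis
  have pos: "g $ subdegree g > 0" "h $ subdegree h > 0"
    using assms n by (simp_all add: eq initial_coeff_puiseux_of_fps)
  have "(g + h) $ subdegree (g + h) > 0"
  proof (cases "subdegree g" "subdegree h" rule: linorder_cases)
    case less
    thus ?thesis using pos by (subst subdegree_add_eq1) (auto simp: nth_less_subdegree_zero)
  next
    case greater
    thus ?thesis using pos by (subst subdegree_add_eq2) (auto simp: nth_less_subdegree_zero)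
  next
    case equal
    have "subdegree (g + h) = subdegree g"
      by (rule subdegreeI) (use pos equal in \<open>auto simp: nth_less_subdegree_zero add_pos_pos\<close>)
    thus ?thesis using pos equal by (simp add: add_pos_pos)
  qed
  thus ?thesis by (simp add: eq puiseux_of_fps_add initial_coeff_puiseux_of_fps[OF n])
qed

instantiation puiseux :: (linordered_idom) linorder
begin

definition less_eq_puiseux :: "'a puiseux \<Rightarrow> 'a puiseux \<Rightarrow> bool" where
  "less_eq_puiseux a b \<longleftrightarrow> a = b \<or> 0 < initial_coeff (b - a)"

definition less_puiseux :: "'a puiseux \<Rightarrow> 'a puiseux \<Rightarrow> bool" where
  "less_puiseux a b \<longleftrightarrow> 0 < initial_coeff (b - a)"

instance
proof
  have trans: "a < c" if "a < b" "b < c" for a b c :: "'a puiseux"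
    using initial_coeff_add_pos[of "b - a" "c - b"] that by (simp add: less_puiseux_def)
  have asym: "\<not> b < a" if "a < b" for a b :: "'a puiseux"
    using that initial_coeff_uminus[of "b - a"] by (simp add: less_puiseux_def)
  fix a b c :: "'a puiseux"
  show "(a < b) = (a \<le> b \<and> \<not> b \<le> a)" "a \<le> a"
    using asym[of a b] asym[of a a] by (auto simp: less_eq_puiseux_def less_puiseux_def)
  show "a \<le> b \<Longrightarrow> b \<le> c \<Longrightarrow> a \<le> c" "a \<le> b \<Longrightarrow> b \<le> a \<Longrightarrow> a = b"
    using trans[of a b c] asym[of a b] by (auto simp: less_eq_puiseux_def less_puiseux_def)
  have "initial_coeff (b - a) > 0 \<or> initial_coeff (a - b) > 0" if "a \<noteq> b"
    using that initial_coeff_uminus[of "b - a"] initial_coeff_0_iff[of "b - a"] by auto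
  thus "a \<le> b \<or> b \<le> a"
    by (auto simp: less_eq_puiseux_def)
qed

end

text \<open>The rings \<open>\<real>{x\<^bsup>1/\<nat>\<^esup>}\<close> and \<open>\<complex>{x\<^bsup>1/\<nat>\<^esup>}\<close>, inclusion of the former in the latter, and the
  value of a real series at a real \<open>x > 0\<close>.\<close>

definition convergent_puiseux :: "'a::{banach, real_normed_field} puiseux set" where
  "convergent_puiseux = {puiseux_of_fps n g | n g. 0 < n \<and> 0 < fps_conv_radius g}"

lift_definition complex_puiseux :: "real puiseux \<Rightarrow> complex puiseux" is
  "\<lambda>a q. complex_of_real (a q)" by auto

definition eval_puiseux :: "real puiseux \<Rightarrow> real \<Rightarrow> real" where
  "eval_puiseux a x = (\<Sum>\<^sub>\<infinity>q. puiseux_coeff a q * x powr of_rat q)"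


section \<open>Series in two variables and their roots\<close>

text \<open>A series in \<open>x, y\<close> is a power series in \<open>y\<close> over the power series in \<open>x\<close>:
  the coefficient of \<open>x\<^sup>i y\<^sup>j\<close> in \<open>f\<close> is \<open>f $ j $ i\<close>.\<close>

definition convergent_fps2 :: "real fps fps set" where
  "convergent_fps2 = {f. \<exists>r>0. (\<lambda>(i, j). \<bar>f $ j $ i\<bar> * r ^ i * r ^ j) summable_on UNIV}"

definition eval_fps2 :: "real fps fps \<Rightarrow> real \<Rightarrow> real \<Rightarrow> real" where
  "eval_fps2 f x y = (\<Sum>\<^sub>\<infinity>(i, j). f $ j $ i * x ^ i * y ^ j)"

text \<open>\<open>subst_puiseux f a\<close> is \<open>f(x, a(x))\<close>. When \<open>a\<close> has positive valuation, only finitely many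
  terms contribute to each coefficient.\<close>

lift_definition subst_puiseux :: "'a::comm_ring_1 fps fps \<Rightarrow> 'a puiseux \<Rightarrow> 'a puiseux" is
  "\<lambda>f a q. Sum_any (\<lambda>(i, j). f $ j $ i * puiseux_coeff (a ^ j) (q - of_nat i))"
proof -
  fix f :: "'a fps fps" and a :: "'a puiseux"
  obtain n g where n: "n > 0" and a: "a = puiseux_of_fps n g"
    using puiseux_of_fps_exists by metis
  have "q * of_nat n \<in> \<nat>"
    if nz: "Sum_any (\<lambda>(i, j). f $ j $ i * puiseux_coeff (a ^ j) (q - of_nat i)) \<noteq> 0" for q
  proof -
    have "\<exists>i j. puiseux_coeff (a ^ j) (q - of_nat i) \<noteq> 0"
    proof (rule ccontr)
      assume "\<not> ?thesis"
      hence "(\<lambda>(i, j). f $ j $ i * puiseux_coeff (a ^ j) (q - of_nat i)) = (\<lambda>_. 0)"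
        by (auto simp: fun_eq_iff)
      thus False using nz by simp
    qed
    then obtain i j k where "q - of_nat i = of_nat k / of_nat n"
      unfolding a puiseux_of_fps_power[OF n] using coeff_puiseux_of_fps_0 by metis
    hence "q * of_nat n = of_nat (k + n * i)" using n by (simp add: field_simps)
    thus ?thesis by (metis of_nat_in_Nats)
  qed
  thus "\<exists>n>0. \<forall>q. Sum_any (\<lambda>(i, j). f $ j $ i * puiseux_coeff (a ^ j) (q - of_nat i)) \<noteq> 0 \<longrightarrow>
      q * of_nat n \<in> \<nat>"
    using n by blast
qed

text \<open>A real series in \<open>x, y\<close> as a power series in \<open>y\<close> over the complex Puiseux series in \<open>x\<close>.\<close>

definition complex_puiseux_fps :: "real fps fps \<Rightarrow> complex puiseux fps" where
  "complex_puiseux_fps f = Abs_fps (\<lambda>j. complex_puiseux (puiseux_of_fps 1 (f $ j)))"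

text \<open>\<open>\<Gamma>\<close> is the multiset of Newton-Puiseux roots of \<open>f\<close>, i.e. \<open>f = u \<Prod>\<^sub>\<gamma> (y - \<gamma>)\<close> with \<open>u\<close> a unit.
  By the Newton-Puiseux theorem and Weierstrass preparation it exists and is unique if
  \<open>f(0,y)\<close> is not identically \<open>0\<close>.\<close>

definition newton_puiseux_roots :: "real fps fps \<Rightarrow> complex puiseux multiset \<Rightarrow> bool" where
  "newton_puiseux_roots f \<Gamma> \<longleftrightarrow>
     (\<forall>\<gamma>\<in>#\<Gamma>. \<gamma> \<in> convergent_puiseux \<and> puiseux_coeff \<gamma> 0 = 0) \<and>
     (\<exists>u\<in>convergent_fps2. u $ 0 $ 0 \<noteq> 0 \<and>
        complex_puiseux_fps f = complex_puiseux_fps u * (\<Prod>\<gamma>\<in>#\<Gamma>. fps_X - fps_const \<gamma>))"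

definition real_roots :: "real fps fps \<Rightarrow> real puiseux set" where
  "real_roots f = {\<xi>. \<exists>\<Gamma>. newton_puiseux_roots f \<Gamma> \<and> complex_puiseux \<xi> \<in># \<Gamma>}"

definition right_reduced :: "real fps fps \<Rightarrow> bool" where
  "right_reduced f \<longleftrightarrow>
     f \<in> convergent_fps2 \<and> f $ 0 $ 0 = 0 \<and> (\<exists>j. f $ j $ 0 \<noteq> 0) \<and>
     (\<exists>\<Gamma>. newton_puiseux_roots f \<Gamma> \<and> (\<forall>\<xi>. count \<Gamma> (complex_puiseux \<xi>) \<le> 1))"

text \<open>\<open>fps_deriv\<close> differentiates with respect to the outer variable \<open>y\<close>.\<close>

definition primitive :: "real fps fps \<Rightarrow> real fps fps \<Rightarrow> bool" where
  "primitive f F \<longleftrightarrow> F \<in> convergent_fps2 \<and> fps_deriv F = f"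


section \<open>Planar rooted trees\<close>

definition valency :: "'p topology \<Rightarrow> 'p \<Rightarrow> nat" where
  "valency X P = card (connected_components_of (subtopology X (topspace X - {P})))"

definition vertices :: "'p topology \<Rightarrow> 'p set" where
  "vertices X = {P \<in> topspace X. valency X P \<noteq> 2}"

definition edges :: "'p topology \<Rightarrow> 'p set set" where
  "edges X =
     (\<lambda>C. X closure_of C) ` connected_components_of (subtopology X (topspace X - vertices X))"

text \<open>In a tree, the segment \<open>[P, Q]\<close> is the smallest connected set containing \<open>P\<close> and \<open>Q\<close>.\<close>

definition segment :: "'p topology \<Rightarrow> 'p \<Rightarrow> 'p \<Rightarrow> 'p set" where
  "segment X P Q = \<Inter>{C. connectedin X C \<and> P \<in> C \<and> Q \<in> C}"

text \<open>\<open>edge_less T P\<close> is the order on the set of outgoing edges at the internal vertex \<open>P\<close>.\<close>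

record 'p planar_tree =
  tree_space :: "'p topology"
  tree_root :: 'p
  edge_less :: "'p \<Rightarrow> 'p set \<Rightarrow> 'p set \<Rightarrow> bool"

definition tree_le :: "'p topology \<Rightarrow> 'p \<Rightarrow> 'p \<Rightarrow> 'p \<Rightarrow> bool" where
  "tree_le X rt P Q \<longleftrightarrow> segment X rt P \<subseteq> segment X rt Q"

definition tree_meet :: "'p topology \<Rightarrow> 'p \<Rightarrow> 'p \<Rightarrow> 'p \<Rightarrow> 'p" where
  "tree_meet X rt P Q =
     (THE R. R \<in> topspace X \<and> segment X rt R = segment X rt P \<inter> segment X rt Q)"

definition leaves :: "'p topology \<Rightarrow> 'p \<Rightarrow> 'p set" where
  "leaves X rt = {P \<in> topspace X. \<forall>Q\<in>topspace X. tree_le X rt P Q \<longrightarrow> Q = P}"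

definition internal_vertices :: "'p topology \<Rightarrow> 'p \<Rightarrow> 'p set" where
  "internal_vertices X rt = vertices X - leaves X rt - {rt}"

definition outgoing_edges :: "'p topology \<Rightarrow> 'p \<Rightarrow> 'p \<Rightarrow> 'p set set" where
  "outgoing_edges X rt P =
     {e \<in> edges X. (\<exists>Q\<in>topspace X. e = segment X P Q) \<and> \<not> e \<subseteq> segment X rt P}"

text \<open>The outgoing edge \<open>e\<close> at \<open>P\<close> goes towards the point \<open>Q\<close>.\<close>

definition goes_towards :: "'p topology \<Rightarrow> 'p \<Rightarrow> 'p set \<Rightarrow> 'p \<Rightarrow> bool" where
  "goes_towards X P e Q \<longleftrightarrow> e \<subseteq> segment X P Q"

text \<open>The \<open>k\<close>-th outgoing edge at \<open>P\<close> in increasing order, for \<open>1 \<le> k \<le> p\<close>.\<close>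

definition nth_outgoing_edge :: "'p planar_tree \<Rightarrow> 'p \<Rightarrow> nat \<Rightarrow> 'p set" where
  "nth_outgoing_edge T P k =
     (let E = outgoing_edges (tree_space T) (tree_root T) P
      in THE e. e \<in> E \<and> Suc (card {e' \<in> E. edge_less T P e' e}) = k)"

text \<open>For empty trees the condition on roots is harmless: then \<open>h\<close> has arbitrary values.\<close>

definition planar_isomorphic :: "'p planar_tree \<Rightarrow> 'q planar_tree \<Rightarrow> bool" where
  "planar_isomorphic T T' \<longleftrightarrow>
     (\<exists>h. homeomorphic_map (tree_space T) (tree_space T') h \<and>
          h (tree_root T) = tree_root T' \<and>
          (\<forall>P\<in>internal_vertices (tree_space T) (tree_root T).
           \<forall>e\<in>outgoing_edges (tree_space T) (tree_root T) P.
           \<forall>e'\<in>outgoing_edges (tree_space T) (tree_root T) P.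
             edge_less T P e e' \<longleftrightarrow> edge_less T' (h P) (h ` e) (h ` e')))"


section \<open>Contact trees\<close>

definition quotient_topology :: "'a topology \<Rightarrow> ('a \<Rightarrow> 'b) \<Rightarrow> 'b topology" where
  "quotient_topology X q =
     topology (\<lambda>U. U \<subseteq> q ` topspace X \<and> openin X {x \<in> topspace X. q x \<in> U})"

lemma openin_quotient_topology:
  "openin (quotient_topology X q) U \<longleftrightarrow>
     U \<subseteq> q ` topspace X \<and> openin X {x \<in> topspace X. q x \<in> U}"
proof -
  have "istopology (\<lambda>U. U \<subseteq> q ` topspace X \<and> openin X {x \<in> topspace X. q x \<in> U})"
    unfolding istopology_def
  proof (intro conjI allI impI)
    fix S T assume *: "S \<subseteq> q ` topspace X \<and> openin X {x \<in> topspace X. q x \<in> S}"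
      "T \<subseteq> q ` topspace X \<and> openin X {x \<in> topspace X. q x \<in> T}"
    have "{x \<in> topspace X. q x \<in> S \<inter> T} = {x \<in> topspace X. q x \<in> S} \<inter> {x \<in> topspace X. q x \<in> T}"
      by auto
    thus "openin X {x \<in> topspace X. q x \<in> S \<inter> T}" using * by auto
    show "S \<inter> T \<subseteq> q ` topspace X" using * by auto
  next
    fix K assume *: "\<forall>S\<in>K. S \<subseteq> q ` topspace X \<and> openin X {x \<in> topspace X. q x \<in> S}"
    have "{x \<in> topspace X. q x \<in> \<Union>K} = (\<Union>S\<in>K. {x \<in> topspace X. q x \<in> S})" by auto
    thus "openin X {x \<in> topspace X. q x \<in> \<Union>K}" using * by auto
    show "\<Union>K \<subseteq> q ` topspace X" using * by auto
  qed
  thus ?thesis by (simp add: quotient_topology_def)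
qed

lemma topspace_quotient_topology: "topspace (quotient_topology X q) = q ` topspace X"
proof (rule subset_antisym)
  show "topspace (quotient_topology X q) \<subseteq> q ` topspace X"
    by (metis openin_quotient_topology openin_topspace)
  have "{x \<in> topspace X. q x \<in> q ` topspace X} = topspace X" by auto
  thus "q ` topspace X \<subseteq> topspace (quotient_topology X q)"
    by (metis openin_quotient_topology openin_subset openin_topspace order_refl)
qed

lemma quotient_map_quotient_topology: "quotient_map X (quotient_topology X q) q"
  by (auto simp: quotient_map_def openin_quotient_topology topspace_quotient_topology)

text \<open>The contact tree of a finite set \<open>N\<close> with pairwise differences of positive valuation: the
  disjoint union of the intervals \<open>{\<gamma>} \<times> [0, \<infinity>]\<close>, \<open>\<gamma> \<in> N\<close>, with \<open>(\<gamma>, t)\<close> and \<open>(\<gamma>', t)\<close> glued iff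
  \<open>t \<le> \<nu>(\<gamma> - \<gamma>')\<close>. Points are equivalence classes; the root is the class of all points at height
  \<open>0\<close>, and the leaf of \<open>\<gamma>\<close> is the class of \<open>(\<gamma>, \<infinity>)\<close>.\<close>

definition contact_rel ::
  "real puiseux set \<Rightarrow> ((real puiseux \<times> ereal) \<times> (real puiseux \<times> ereal)) set" where
  "contact_rel N = {((\<gamma>, t), (\<gamma>', t')). \<gamma> \<in> N \<and> \<gamma>' \<in> N \<and> 0 \<le> t \<and> t = t' \<and> t \<le> valuation (\<gamma> - \<gamma>')}"

definition contact_point :: "real puiseux set \<Rightarrow> real puiseux \<times> ereal \<Rightarrow> (real puiseux \<times> ereal) set" where
  "contact_point N p = contact_rel N `` {p}"

definition contact_space :: "real puiseux set \<Rightarrow> (real puiseux \<times> ereal) set topology" where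
  "contact_space N =
     quotient_topology (sum_topology (\<lambda>_. top_of_set {0..\<infinity>}) N) (contact_point N)"

definition contact_root :: "real puiseux set \<Rightarrow> (real puiseux \<times> ereal) set" where
  "contact_root N = N \<times> {0}"

definition contact_leaf :: "real puiseux set \<Rightarrow> real puiseux \<Rightarrow> (real puiseux \<times> ereal) set" where
  "contact_leaf N \<gamma> = contact_point N (\<gamma>, \<infinity>)"

text \<open>The planar structure below is the only one that induces the order \<open><\<close> on the leaves:
  two outgoing edges \<open>e, e'\<close> at \<open>P\<close> are compared as leaves \<open>\<gamma>, \<gamma>'\<close> with \<open>\<gamma> \<and> \<gamma>' = P\<close> towards which
  they go.\<close>

definition real_contact_tree :: "real puiseux set \<Rightarrow> (real puiseux \<times> ereal) set planar_tree" where
  "real_contact_tree N =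
     (let X = contact_space N; rt = contact_root N; L = contact_leaf N in
      \<lparr>tree_space = X, tree_root = rt,
       edge_less = (\<lambda>P e e'.
         e \<in> outgoing_edges X rt P \<and> e' \<in> outgoing_edges X rt P \<and>
         (\<exists>\<gamma>\<in>N. \<exists>\<gamma>'\<in>N. \<gamma> < \<gamma>' \<and> tree_meet X rt (L \<gamma>) (L \<gamma>') = P \<and>
            goes_towards X P e (L \<gamma>) \<and> goes_towards X P e' (L \<gamma>')))\<rparr>)"


section \<open>Discrete integration and the integrated contact tree\<close>

text \<open>In this section \<open>\<xi> 1 < \<dots> < \<xi> n\<close> are the real roots of \<open>f\<close> and \<open>F\<close> is a primitive of \<open>f\<close>.
  The differences below do not depend on the choice of \<open>F\<close>.\<close>

definition step_coeff :: "real fps fps \<Rightarrow> (nat \<Rightarrow> real puiseux) \<Rightarrow> nat \<Rightarrow> real" where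
  "step_coeff F \<xi> r = initial_coeff (subst_puiseux F (\<xi> (Suc r)) - subst_puiseux F (\<xi> r))"

definition gap_index ::
  "nat \<Rightarrow> (nat \<Rightarrow> real puiseux) \<Rightarrow> (real puiseux \<times> ereal) set \<Rightarrow> nat \<Rightarrow> nat" where
  "gap_index n \<xi> P k =
     (let N = \<xi> ` {1..n}; T = real_contact_tree N; X = tree_space T; rt = tree_root T in
      THE r. 1 \<le> r \<and> r < n \<and>
        tree_meet X rt (contact_leaf N (\<xi> r)) (contact_leaf N (\<xi> (Suc r))) = P \<and>
        goes_towards X P (nth_outgoing_edge T P k) (contact_leaf N (\<xi> r)) \<and>
        goes_towards X P (nth_outgoing_edge T P (Suc k)) (contact_leaf N (\<xi> (Suc r))))"

definition discrete_integral ::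
  "real fps fps \<Rightarrow> nat \<Rightarrow> (nat \<Rightarrow> real puiseux) \<Rightarrow> (real puiseux \<times> ereal) set \<Rightarrow> nat \<Rightarrow> real" where
  "discrete_integral F n \<xi> P i = (\<Sum>k=1..i. step_coeff F \<xi> (gap_index n \<xi> P k))"

definition injectivity_condition :: "real fps fps \<Rightarrow> nat \<Rightarrow> (nat \<Rightarrow> real puiseux) \<Rightarrow> bool" where
  "injectivity_condition F n \<xi> \<longleftrightarrow>
     (let N = \<xi> ` {1..n}; X = contact_space N; rt = contact_root N in
      \<forall>P\<in>internal_vertices X rt.
        inj_on (discrete_integral F n \<xi> P) {..<card (outgoing_edges X rt P)})"

definition integrated_contact_tree ::
  "real fps fps \<Rightarrow> nat \<Rightarrow> (nat \<Rightarrow> real puiseux) \<Rightarrow> (real puiseux \<times> ereal) set planar_tree" where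
  "integrated_contact_tree F n \<xi> =
     (let T = real_contact_tree (\<xi> ` {1..n}) in
      T\<lparr>edge_less := (\<lambda>P e e'.
          \<exists>k\<in>{1..card (outgoing_edges (tree_space T) (tree_root T) P)}.
          \<exists>l\<in>{1..card (outgoing_edges (tree_space T) (tree_root T) P)}.
            e = nth_outgoing_edge T P k \<and> e' = nth_outgoing_edge T P l \<and>
            discrete_integral F n \<xi> P (k - 1) < discrete_integral F n \<xi> P (l - 1))\<rparr>)"


section \<open>The apparent contour\<close>

definition primitive_graph :: "real fps fps \<Rightarrow> real \<Rightarrow> real set \<Rightarrow> (real \<times> real \<times> real) set" where
  "primitive_graph F \<epsilon> I = {(x, y, eval_fps2 F x y) | x y. x \<in> {0..\<epsilon>} \<and> y \<in> I}"

definition xz_projection :: "real \<times> real \<times> real \<Rightarrow> real \<times> real" where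
  "xz_projection = (\<lambda>(x, y, z). (x, z))"

definition apparent_contour ::
  "real fps fps \<Rightarrow> real fps fps \<Rightarrow> real \<Rightarrow> real set \<Rightarrow> (real \<times> real) set" where
  "apparent_contour f F \<epsilon> I =
     xz_projection ` {(x, y, z) \<in> primitive_graph F \<epsilon> I. eval_fps2 f x y = 0}"

text \<open>The real Newton-Puiseux roots of a curve over \<open>[0, \<epsilon>]\<close>: the series whose graph is contained
  in the curve near \<open>x = 0\<close>.\<close>

definition real_roots_of_curve :: "(real \<times> real) set \<Rightarrow> real puiseux set" where
  "real_roots_of_curve \<Delta> =
     {\<delta> \<in> convergent_puiseux. \<forall>\<^sub>F x in at_right 0. (x, eval_puiseux \<delta> x) \<in> \<Delta>}"

end

theory Submission
  imports Defs
begin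

text \<open>For two consecutive real roots \<open>\<xi> < \<xi>'\<close> of \<open>f = u \<Prod>\<^sub>\<gamma> (y - \<gamma>)\<close> with \<open>\<nu>(\<xi>' - \<xi>) = \<sigma>\<close>, the
  function \<open>f(x, \<cdot>)\<close> has no zero between \<open>\<xi>(x)\<close> and \<open>\<xi>'(x)\<close>, and on a fixed proportion of this interval
  every factor \<open>y - \<gamma>(x)\<close> has exact order \<open>min \<sigma> (\<nu>(\<xi> - \<gamma>))\<close> in \<open>x\<close>. By the mean value theorem
  \<open>F\<^sub>x(\<xi>') - F\<^sub>x(\<xi>)\<close> has valuation \<open>V\<^sub>\<xi>(\<sigma>)\<close>, where
  \<open>V\<^sub>\<xi>(t) = t + \<Sum>\<^sub>\<gamma> min t (\<nu>(\<xi> - \<gamma>))\<close> is an increasing homeomorphism of \<open>[0, \<infinity>]\<close> which, by the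
  ultrametric inequality, depends only on the point of height \<open>t\<close> below \<open>\<xi>\<close>.

  If \<open>\<xi>\<^sub>i \<and> \<xi>\<^sub>j = P\<close> has height \<open>p\<close>, telescoping shows that the coefficient of \<open>F\<^sub>x(\<xi>\<^sub>j) - F\<^sub>x(\<xi>\<^sub>i)\<close> at
  the exponent \<open>V(p)\<close> is a difference of two values of the discrete integral at \<open>P\<close>: the other steps
  between \<open>\<xi>\<^sub>i\<close> and \<open>\<xi>\<^sub>j\<close> have higher valuation. By injectivity this coefficient is not \<open>0\<close>. Hence the
  maps \<open>V\<^sub>\<xi>\<close> glue to a homeomorphism of the contact trees, and the coefficient gives the order of
  \<open>\<delta>\<^sub>i\<close> and \<open>\<delta>\<^sub>j\<close>.\<close>

section \<open>Values of Puiseux series\<close>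

text \<open>Order and valuation are formal, but monotonicity of a primitive between two roots is a
  fact about real functions. So series are evaluated at small x > 0, and exponents are recovered
  from two-sided bounds by powers of x. What shapes the estimate is that a non-real root \<gamma>
  may be very close to a point between \<xi> and \<xi>'. After division by the expected power of x,
  y - \<gamma> at y = \<xi> + t (\<xi>' - \<xi>) tends to \<alpha> + t \<beta>, which has at most
  one real zero t. A range of proportions t that avoids these finitely many zeros carries the lower
  bound, and monotonicity excludes cancellation with the rest of the interval. All roots, real or
  not, enter the height function, although only the real ones are leaves. Injectivity excludes
  cancellation between different gaps: a vanishing sum of step coefficients would push the contact
  of two roots of the contour above V(p). On the topological side a point is written as a leaf and a
  height, so that vertices, edges and meets become inequalities between heights and
  valuations.\<close>

definition puiseux_abs :: "'a::{banach, real_normed_field} puiseux \<Rightarrow> real \<Rightarrow> bool" where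
  "puiseux_abs a x \<longleftrightarrow> (\<lambda>q. puiseux_coeff a q * of_real (x powr of_rat q)) abs_summable_on UNIV"

text \<open>The majorant of \<open>a\<close>. It is submultiplicative, so powers of \<open>a\<close>
  can be dominated when \<open>a\<close> is substituted into a series in two variables.\<close>

definition puiseux_norm :: "'a::{banach, real_normed_field} puiseux \<Rightarrow> real \<Rightarrow> real" where
  "puiseux_norm a x = (\<Sum>\<^sub>\<infinity>q. norm (puiseux_coeff a q) * x powr of_rat q)"

text \<open>Generalises \<open>eval_puiseux\<close> to complex coefficients, because the non-real
  roots have to be evaluated as well.\<close>

definition puiseux_value :: "'a::{banach, real_normed_field} puiseux \<Rightarrow> real \<Rightarrow> 'a" where
  "puiseux_value a x = (\<Sum>\<^sub>\<infinity>q. puiseux_coeff a q * of_real (x powr of_rat q))"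

lemma eval_puiseux_eq: "eval_puiseux a x = puiseux_value a x"
  by (simp add: eval_puiseux_def puiseux_value_def)

text \<open>The support lies in the multiples of 1/n, so a sum over all rationals is a sum over the
  naturals. Through this the analysis of a Puiseux series is that of a power series in z =
  x^(1/n).\<close>

lemma has_sum_puiseux_of_fps_iff:
  fixes \<phi> :: "rat \<Rightarrow> 'b::{comm_monoid_add, topological_space}"
  assumes n: "n > 0" and \<phi>: "\<And>q. puiseux_coeff (puiseux_of_fps n g) q = 0 \<Longrightarrow> \<phi> q = 0"
  shows "(\<phi> has_sum s) UNIV \<longleftrightarrow> ((\<lambda>k. \<phi> (of_nat k / of_nat n)) has_sum s) UNIV"
proof -
  let ?e = "\<lambda>k. of_nat k / of_nat n :: rat"
  have inj: "inj ?e" using n by (auto simp: inj_on_def)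
  have "(\<phi> has_sum s) UNIV \<longleftrightarrow> (\<phi> has_sum s) (range ?e)"
    by (rule has_sum_cong_neutral) (auto intro!: \<phi> coeff_puiseux_of_fps_0)
  thus ?thesis by (simp add: has_sum_reindex[OF inj] o_def)
qed

lemma powr_rat_nat_div:
  assumes "x > 0" "n > 0"
  shows "x powr real_of_rat (of_nat k / of_nat n) = (x powr (1 / real n)) ^ k"
  using assms by (simp add: powr_realpow[symmetric] powr_powr of_rat_divide)

lemma puiseux_abs_of_fps:
  fixes g :: "'a::{banach, real_normed_field} fps"
  assumes "n > 0" "x > 0"
  shows "puiseux_abs (puiseux_of_fps n g) x \<longleftrightarrow> summable (\<lambda>k. norm (g $ k) * (x powr (1 / real n)) ^ k)"
proof -
  have "puiseux_abs (puiseux_of_fps n g) x \<longleftrightarrow>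
    (\<lambda>k. norm (g $ k) * (x powr (1 / real n)) ^ k) summable_on UNIV"
    unfolding puiseux_abs_def summable_on_def
    by (subst has_sum_puiseux_of_fps_iff[OF assms(1)])
      (use assms in \<open>simp_all add: coeff_puiseux_of_fps powr_rat_nat_div norm_mult norm_power\<close>)
  also have "\<dots> \<longleftrightarrow> summable (\<lambda>k. norm (g $ k) * (x powr (1 / real n)) ^ k)"
    by (rule summable_on_UNIV_nonneg_real_iff) auto
  finally show ?thesis .
qed

lemma puiseux_value_of_fps:
  fixes g :: "'a::{banach, real_normed_field} fps"
  assumes n: "n > 0" "x > 0" and abs: "puiseux_abs (puiseux_of_fps n g) x"
  shows "puiseux_value (puiseux_of_fps n g) x = suminf (\<lambda>k. g $ k * of_real (x powr (1 / real n)) ^ k)"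
    "(\<lambda>k. g $ k * of_real (x powr (1 / real n)) ^ k) sums puiseux_value (puiseux_of_fps n g) x"
proof -
  have "((\<lambda>q. puiseux_coeff (puiseux_of_fps n g) q * of_real (x powr of_rat q)) has_sum
     puiseux_value (puiseux_of_fps n g) x) UNIV"
    unfolding puiseux_value_def by (rule has_sum_infsum, rule abs_summable_summable) (use abs in \<open>simp add: puiseux_abs_def\<close>)
  hence "((\<lambda>k. g $ k * of_real (x powr (1 / real n)) ^ k) has_sum puiseux_value (puiseux_of_fps n g) x) UNIV"
    by (subst (asm) has_sum_puiseux_of_fps_iff[OF n(1)])
       (use n in \<open>simp_all add: coeff_puiseux_of_fps powr_rat_nat_div\<close>)
  thus "(\<lambda>k. g $ k * of_real (x powr (1 / real n)) ^ k) sums puiseux_value (puiseux_of_fps n g) x"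
    by (rule has_sum_imp_sums)
  thus "puiseux_value (puiseux_of_fps n g) x = suminf (\<lambda>k. g $ k * of_real (x powr (1 / real n)) ^ k)"
    by (simp add: sums_iff)
qed

lemma puiseux_norm_of_fps:
  fixes g :: "'a::{banach, real_normed_field} fps"
  assumes n: "n > 0" "x > 0" and abs: "puiseux_abs (puiseux_of_fps n g) x"
  shows "puiseux_norm (puiseux_of_fps n g) x = suminf (\<lambda>k. norm (g $ k) * (x powr (1 / real n)) ^ k)"
proof -
  have "((\<lambda>q. norm (puiseux_coeff (puiseux_of_fps n g) q) * x powr of_rat q) has_sum
     puiseux_norm (puiseux_of_fps n g) x) UNIV"
    unfolding puiseux_norm_def using abs by (intro has_sum_infsum) (simp add: puiseux_abs_def norm_mult)
  hence "((\<lambda>k. norm (g $ k) * (x powr (1 / real n)) ^ k) has_sum puiseux_norm (puiseux_of_fps n g) x) UNIV"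
    by (subst (asm) has_sum_puiseux_of_fps_iff[OF n(1)])
       (use n in \<open>simp_all add: coeff_puiseux_of_fps powr_rat_nat_div\<close>)
  from has_sum_imp_sums[OF this] show ?thesis by (simp add: sums_iff)
qed

lemma
  assumes a: "puiseux_abs a x" and b: "puiseux_abs b x"
  shows puiseux_abs_diff: "puiseux_abs (a - b) x"
    and puiseux_value_diff: "puiseux_value (a - b) x = puiseux_value a x - puiseux_value b x"
proof -
  have s: "(\<lambda>q. norm (puiseux_coeff a q * of_real (x powr of_rat q)) +
     norm (puiseux_coeff b q * of_real (x powr of_rat q))) summable_on UNIV"
    using a b by (intro summable_on_add) (auto simp: puiseux_abs_def)
  show "puiseux_abs (a - b) x" unfolding puiseux_abs_def
    by (rule Infinite_Sum.abs_summable_on_comparison_test'[OF s])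
       (auto simp: minus_puiseux.rep_eq left_diff_distrib intro!: norm_triangle_ineq4)
  have h: "((\<lambda>q. puiseux_coeff a q * of_real (x powr of_rat q)) has_sum puiseux_value a x) UNIV"
    "((\<lambda>q. puiseux_coeff b q * of_real (x powr of_rat q)) has_sum puiseux_value b x) UNIV"
    using a b unfolding puiseux_value_def puiseux_abs_def
    by (blast intro: has_sum_infsum abs_summable_summable)+
  show "puiseux_value (a - b) x = puiseux_value a x - puiseux_value b x"
    using has_sum_add[OF h(1) has_sum_uminusI[OF h(2)]] unfolding puiseux_value_def[of "a - b"]
    by (intro infsumI) (simp add: minus_puiseux.rep_eq left_diff_distrib)
qed

lemma puiseux_norm_nonneg: "puiseux_norm a x \<ge> 0"
  unfolding puiseux_norm_def by (rule infsum_nonneg) auto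

text \<open>Over a common denominator this is the Cauchy product of two absolutely convergent power
  series in z = x^(1/n).\<close>

lemma
  assumes x: "x > 0" and "puiseux_abs a x" "puiseux_abs b x"
  shows puiseux_abs_mult: "puiseux_abs (a * b) x"
    and puiseux_value_mult: "puiseux_value (a * b) x = puiseux_value a x * puiseux_value b x"
    and puiseux_norm_mult: "puiseux_norm (a * b) x \<le> puiseux_norm a x * puiseux_norm b x"
proof -
  obtain n g h where n: "n > 0" and eq: "a = puiseux_of_fps n g" "b = puiseux_of_fps n h"
    using puiseux_of_fps_exists2 by metis
  define z where "z = x powr (1 / real n)"
  have z: "z \<ge> 0" by (simp add: z_def)
  let ?G = "\<lambda>k. g $ k * of_real z ^ k" and ?H = "\<lambda>k. h $ k * of_real z ^ k"
  have ng: "norm (?G k) = norm (g $ k) * z ^ k" "norm (?H k) = norm (h $ k) * z ^ k" for k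
    using z by (auto simp: norm_mult norm_power)
  have s: "summable (\<lambda>k. norm (?G k))" "summable (\<lambda>k. norm (?H k))"
    using assms n unfolding eq by (simp_all add: puiseux_abs_of_fps ng flip: z_def)
  have conv: "(\<Sum>i\<le>k. ?G i * ?H (k - i)) = (g * h) $ k * of_real z ^ k" for k
  proof -
    have "(\<Sum>i\<le>k. ?G i * ?H (k - i)) = (\<Sum>i\<le>k. g $ i * h $ (k - i) * of_real z ^ k)"
      by (intro sum.cong) (auto simp flip: power_add)
    thus ?thesis by (simp add: fps_mult_nth sum_distrib_right atLeast0AtMost)
  qed
  have sn: "summable (\<lambda>k. norm (norm (?G k)))" "summable (\<lambda>k. norm (norm (?H k)))" using s by auto
  have sp: "summable (\<lambda>k. \<Sum>i\<le>k. norm (?G i) * norm (?H (k - i)))"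
    by (rule summable_Cauchy_product[OF sn])
  have le: "norm ((g * h) $ k) * z ^ k \<le> (\<Sum>i\<le>k. norm (?G i) * norm (?H (k - i)))" for k
  proof -
    have "norm ((g * h) $ k) * z ^ k = norm ((g * h) $ k * of_real z ^ k)"
      using z by (simp add: norm_mult norm_power)
    also have "\<dots> \<le> (\<Sum>i\<le>k. norm (?G i) * norm (?H (k - i)))"
      unfolding conv[symmetric] by (rule sum_norm_le) (auto simp: norm_mult)
    finally show ?thesis .
  qed
  have sgh: "summable (\<lambda>k. norm ((g * h) $ k) * z ^ k)"
    by (rule summable_comparison_test_ev[OF _ sp]) (use le z in auto)
  thus abs: "puiseux_abs (a * b) x"
    using n x unfolding eq puiseux_of_fps_mult[OF n] by (simp add: puiseux_abs_of_fps z_def)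
  show "puiseux_value (a * b) x = puiseux_value a x * puiseux_value b x"
    using abs assms Cauchy_product[OF s] conv n x unfolding eq puiseux_of_fps_mult[OF n]
    by (simp add: puiseux_value_of_fps(1) z_def)
  have "suminf (\<lambda>k. norm ((g * h) $ k) * z ^ k) \<le> suminf (\<lambda>k. norm (g $ k) * z ^ k) * suminf (\<lambda>k. norm (h $ k) * z ^ k)"
    using suminf_le[OF le sgh sp] Cauchy_product[OF sn] by (simp add: ng)
  thus "puiseux_norm (a * b) x \<le> puiseux_norm a x * puiseux_norm b x"
    using abs assms n x unfolding eq puiseux_of_fps_mult[OF n]
    by (simp add: puiseux_norm_of_fps z_def)
qed

lemma puiseux_abs_1 [simp]: "puiseux_abs 1 x" and puiseux_value_1: "x > 0 \<Longrightarrow> puiseux_value 1 x = 1"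
  and puiseux_norm_1: "x > 0 \<Longrightarrow> puiseux_norm (1 :: 'a::{banach, real_normed_field} puiseux) x = 1"
proof -
  show "puiseux_abs 1 x"
    unfolding puiseux_abs_def by (rule finite_nonzero_values_imp_summable_on) (simp add: one_puiseux.rep_eq)
  assume x: "x > 0"
  have "puiseux_value 1 x = infsum (\<lambda>q. puiseux_coeff 1 q * of_real (x powr of_rat q)) {0::rat}"
    unfolding puiseux_value_def by (rule infsum_cong_neutral) (auto simp: one_puiseux.rep_eq)
  thus "puiseux_value 1 x = 1" using x by (simp add: one_puiseux.rep_eq)
  have "puiseux_norm (1::'a puiseux) x = infsum (\<lambda>q. norm (puiseux_coeff (1::'a puiseux) q) * (x powr of_rat q)) {0::rat}"
    unfolding puiseux_norm_def by (rule infsum_cong_neutral) (auto simp: one_puiseux.rep_eq)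
  thus "puiseux_norm (1::'a puiseux) x = 1" using x by (simp add: one_puiseux.rep_eq)
qed

lemma
  assumes x: "x > 0" and a: "puiseux_abs a x"
  shows puiseux_abs_power: "puiseux_abs (a ^ j) x"
    and puiseux_value_power: "puiseux_value (a ^ j) x = puiseux_value a x ^ j"
    and puiseux_norm_power: "puiseux_norm (a ^ j) x \<le> puiseux_norm a x ^ j"
proof -
  have "puiseux_abs (a ^ j) x \<and> puiseux_value (a ^ j) x = puiseux_value a x ^ j \<and>
    puiseux_norm (a ^ j) x \<le> puiseux_norm a x ^ j"
  proof (induction j)
    case (Suc j)
    have "puiseux_norm a x * puiseux_norm (a ^ j) x \<le> puiseux_norm a x * puiseux_norm a x ^ j"
      using Suc by (intro mult_left_mono puiseux_norm_nonneg) auto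
    thus ?case using Suc x a puiseux_abs_mult[of x a "a ^ j"] puiseux_value_mult[of x a "a ^ j"]
      puiseux_norm_mult[of x a "a ^ j"] by simp
  qed (use x in \<open>auto simp: puiseux_value_1 puiseux_norm_1\<close>)
  thus "puiseux_abs (a ^ j) x" "puiseux_value (a ^ j) x = puiseux_value a x ^ j"
    "puiseux_norm (a ^ j) x \<le> puiseux_norm a x ^ j" by auto
qed

text \<open>Exponents in the support are non-negative, so every term is non-decreasing in x >
  0.\<close>

lemma puiseux_abs_mono:
  assumes "puiseux_abs a x" "0 < y" "y \<le> x"
  shows "puiseux_abs a y"
proof -
  have "norm (puiseux_coeff a q * of_real (y powr of_rat q)) \<le> norm (puiseux_coeff a q * of_real (x powr of_rat q))" for q
  proof (cases "puiseux_coeff a q = 0")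
    case False
    obtain n g where n: "n > 0" "a = puiseux_of_fps n g" using puiseux_of_fps_exists by metis
    then obtain k where "q = of_nat k / of_nat n" using coeff_puiseux_of_fps_0[of q n g] False by blast
    hence "real_of_rat q \<ge> 0" by (simp add: of_rat_divide)
    thus ?thesis using assms by (auto simp: norm_mult intro!: mult_left_mono powr_mono2)
  qed auto
  thus ?thesis unfolding puiseux_abs_def
    by (rule Infinite_Sum.abs_summable_on_comparison_test'[OF assms(1)[unfolded puiseux_abs_def]])
qed

text \<open>A point r inside the disc of convergence of g yields absolute convergence at x = r^n,
  and conversely x yields the radius x^(1/n). This form of convergence does not mention the
  denominator n.\<close>

lemma convergent_puiseux_iff: "a \<in> convergent_puiseux \<longleftrightarrow> (\<exists>x>0. puiseux_abs a x)"
proof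
  assume "a \<in> convergent_puiseux"
  then obtain n g where n: "a = puiseux_of_fps n g" "n > 0" "fps_conv_radius g > 0"
    by (auto simp: convergent_puiseux_def)
  then obtain r where r: "0 < ereal r" "ereal r < fps_conv_radius g"
    using ereal_dense2 by blast
  have "summable (\<lambda>k. norm (g $ k * of_real r ^ k))"
    using r by (intro abs_summable_in_conv_radius) (auto simp: fps_conv_radius_def)
  moreover have "(r powr real n) powr (1 / real n) = r" using n r by (simp add: powr_powr)
  ultimately have "puiseux_abs a (r powr real n)"
    using n r by (simp add: puiseux_abs_of_fps norm_mult norm_power)
  thus "\<exists>x>0. puiseux_abs a x" using r by (intro exI[of _ "r powr real n"]) auto
next
  assume "\<exists>x>0. puiseux_abs a x"
  then obtain x where x: "x > 0" "puiseux_abs a x" by auto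
  obtain n g where n: "n > 0" "a = puiseux_of_fps n g" using puiseux_of_fps_exists by metis
  have "summable (\<lambda>k. norm (g $ k * of_real (x powr (1 / real n)) ^ k))"
    using x n by (simp add: puiseux_abs_of_fps norm_mult norm_power)
  from summable_norm_cancel[OF this]
  have "fps_conv_radius g \<ge> norm (of_real (x powr (1 / real n)) :: 'a)"
    unfolding fps_conv_radius_def by (rule conv_radius_geI)
  moreover have "0 < ereal (norm (of_real (x powr (1 / real n)) :: 'a))" using x by simp
  ultimately have "fps_conv_radius g > 0" by (rule less_le_trans[rotated])
  thus "a \<in> convergent_puiseux" using n by (auto simp: convergent_puiseux_def)
qed

lemma eventually_puiseux_abs:
  assumes "a \<in> convergent_puiseux"
  shows "\<forall>\<^sub>F x in at_right 0. 0 < x \<and> puiseux_abs a x"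
proof -
  obtain r where "r > 0" "puiseux_abs a r" using assms convergent_puiseux_iff by auto
  thus ?thesis by (intro eventually_at_rightI[of 0 r]) (auto intro: puiseux_abs_mono)
qed

lemma convergent_puiseux_diff:
  assumes "a \<in> convergent_puiseux" "b \<in> convergent_puiseux"
  shows "a - b \<in> convergent_puiseux"
    and "\<forall>\<^sub>F x in at_right 0. puiseux_value (a - b) x = puiseux_value a x - puiseux_value b x"
proof -
  have ev: "\<forall>\<^sub>F x in at_right 0. 0 < x \<and> puiseux_abs a x \<and> puiseux_abs b x"
    using eventually_puiseux_abs[OF assms(1)] eventually_puiseux_abs[OF assms(2)]
    by eventually_elim auto
  then obtain x where "0 < x" "puiseux_abs a x" "puiseux_abs b x"
    using eventually_happens'[of "at_right (0::real)"] by (metis (no_types, lifting) trivial_limit_at_right_real)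
  thus "a - b \<in> convergent_puiseux" using puiseux_abs_diff convergent_puiseux_iff by blast
  show "\<forall>\<^sub>F x in at_right 0. puiseux_value (a - b) x = puiseux_value a x - puiseux_value b x"
    using ev by eventually_elim (auto simp: puiseux_value_diff)
qed

text \<open>With \<open>z = x\<^bsup>1/n\<^esup>\<close> the limit is read off a factorisation \<open>g = z\<^sup>d h\<close> with \<open>h(0) \<noteq> 0\<close>.\<close>

lemma puiseux_value_asymp:
  assumes "a \<in> convergent_puiseux" "a \<noteq> 0"
  shows "((\<lambda>x. puiseux_value a x / of_real (x powr real_of_ereal (valuation a))) \<longlongrightarrow> initial_coeff a) (at_right 0)"
proof -
  obtain n g where a: "a = puiseux_of_fps n g" "n > 0" "fps_conv_radius g > 0"
    using assms by (auto simp: convergent_puiseux_def)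
  have g: "g \<noteq> 0" using assms a by (auto simp: puiseux_of_fps_0)
  define d h where "d = subdegree g" and "h = fps_shift d g"
  have gh: "g = h * fps_X ^ d" unfolding h_def d_def by (rule subdegree_decompose)
  have rh: "fps_conv_radius h > 0" using a by (simp add: h_def)
  have "isCont (eval_fps h) 0"
    using rh by (intro continuous_eval_fps) (auto simp: zero_ereal_def)
  moreover have lim: "((\<lambda>x. of_real (x powr (1 / real n)) :: 'a) \<longlongrightarrow> 0) (at_right 0)"
  proof -
    have "((\<lambda>x. x powr (1 / real n)) \<longlongrightarrow> 0) (at_right 0)"
      using a by (intro tendsto_zero_powrI[where b="1 / real n"]) (auto simp: eventually_at_filter)
    from tendsto_of_real[OF this] show ?thesis unfolding of_real_0 .
  qed
  ultimately have lim': "((\<lambda>x. eval_fps h (of_real (x powr (1 / real n)))) \<longlongrightarrow> h $ 0) (at_right 0)"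
    by (auto dest: isCont_tendsto_compose simp: eval_fps_at_0)
  have "h $ 0 = initial_coeff a"
    using a by (simp add: h_def initial_coeff_puiseux_of_fps d_def)
  moreover have "\<forall>\<^sub>F x in at_right 0. eval_fps h (of_real (x powr (1 / real n))) =
    puiseux_value a x / of_real (x powr real_of_ereal (valuation a))"
  proof -
    obtain r where r: "0 < ereal r" "ereal r < fps_conv_radius g"
      using ereal_dense2 a(3) by blast
    have "\<forall>\<^sub>F x in at_right 0. norm (of_real (x powr (1 / real n)) :: 'a) < r"
      using order_tendstoD(2)[OF tendsto_norm_zero[OF lim], of r] r by simp
    thus ?thesis using eventually_puiseux_abs[OF assms(1)]
    proof eventually_elim
      case (elim x)
      let ?z = "of_real (x powr (1 / real n)) :: 'a"
      have z: "ereal (norm ?z) < fps_conv_radius g" "?z \<noteq> 0" using elim r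
        by (auto intro: less_trans[of _ "ereal r"])
      have "puiseux_value a x = eval_fps g ?z"
        using elim a by (simp add: puiseux_value_of_fps eval_fps_def)
      also have "\<dots> = eval_fps h ?z * ?z ^ d"
        unfolding gh using z a by (subst eval_fps_mult) (auto simp: h_def)
      finally have *: "puiseux_value a x = eval_fps h ?z * ?z ^ d" .
      have "of_real (x powr real_of_ereal (valuation a)) = ?z ^ d"
      proof -
        have "x powr real_of_ereal (valuation a) = (x powr (1 / real n)) ^ d"
          using a g elim by (simp add: valuation_puiseux_of_fps d_def powr_realpow[symmetric] powr_powr)
        thus ?thesis by (simp only: of_real_power)
      qed
      thus ?case using * z by simp
    qed
  qed
  ultimately show ?thesis using Lim_transform_eventually[OF lim'] by simp
qed

lemma eventually_puiseux_value_nonzero: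
  assumes "a \<in> convergent_puiseux" "a \<noteq> 0"
  shows "\<forall>\<^sub>F x in at_right 0. puiseux_value a x \<noteq> 0"
proof -
  have "initial_coeff a \<noteq> 0" using assms by (simp add: initial_coeff_0_iff)
  from tendsto_imp_eventually_ne[OF puiseux_value_asymp[OF assms] this]
  show ?thesis by eventually_elim auto
qed

lemma eventually_puiseux_value_neq:
  assumes "a \<in> convergent_puiseux" "b \<in> convergent_puiseux" "a \<noteq> b"
  shows "\<forall>\<^sub>F x in at_right 0. puiseux_value a x \<noteq> puiseux_value b x"
  using eventually_puiseux_value_nonzero[OF convergent_puiseux_diff(1)[OF assms(1,2)]]
    convergent_puiseux_diff(2)[OF assms(1,2)] assms(3)
  by (auto elim: eventually_elim2)

text \<open>For small x > 0 the sign of the value of b - a is the sign of its initial coefficient,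
  so the formal order is the order of germs at 0+.\<close>

lemma eventually_puiseux_value_less:
  fixes a b :: "real puiseux"
  assumes "a \<in> convergent_puiseux" "b \<in> convergent_puiseux" "a < b"
  shows "\<forall>\<^sub>F x in at_right 0. puiseux_value a x < puiseux_value b x"
proof -
  have c: "b - a \<in> convergent_puiseux" "b - a \<noteq> 0" using convergent_puiseux_diff assms by auto
  have "initial_coeff (b - a) > 0" using assms(3) by (simp add: less_puiseux_def)
  from order_tendstoD(1)[OF puiseux_value_asymp[OF c] this] convergent_puiseux_diff(2)[OF assms(2,1)]
    eventually_puiseux_abs[OF c(1)]
  show ?thesis by eventually_elim (auto simp: zero_less_divide_iff)
qed

lemma tendsto_powr_0_at_right: "s > 0 \<Longrightarrow> ((\<lambda>x::real. x powr s) \<longlongrightarrow> 0) (at_right 0)"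
  by (intro tendsto_zero_powrI[where b = s]) (auto simp: eventually_at_filter)

lemma coeff_puiseux_of_fps_at_0: "n > 0 \<Longrightarrow> puiseux_coeff (puiseux_of_fps n g) 0 = g $ 0"
  using coeff_puiseux_of_fps[of n g 0] by simp

lemma valuation_pos_iff:
  fixes a :: "'a::comm_ring_1 puiseux"
  shows "valuation a > 0 \<longleftrightarrow> puiseux_coeff a 0 = 0"
proof -
  obtain n g where n: "n > 0" "a = puiseux_of_fps n g" using puiseux_of_fps_exists by metis
  have "puiseux_coeff a 0 = g $ 0" using n by (simp add: coeff_puiseux_of_fps_at_0)
  thus ?thesis using n
    by (cases "g = 0") (simp_all add: valuation_puiseux_of_fps puiseux_of_fps_0 valuation_def[of 0]
        zero_puiseux.rep_eq zero_less_divide_iff subdegree_eq_0_iff flip: neq0_conv)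
qed

lemma valuation_finite: "a \<noteq> 0 \<Longrightarrow> \<bar>valuation a\<bar> \<noteq> \<infinity>"
  by (simp add: valuation_def)

lemma valuation_nonneg: "valuation a \<ge> 0"
proof -
  obtain n g where n: "n > 0" "a = puiseux_of_fps n g" using puiseux_of_fps_exists by metis
  thus ?thesis by (cases "g = 0") (auto simp: valuation_puiseux_of_fps puiseux_of_fps_0 valuation_def[of 0])
qed

lemma valuation_eq_PInf_iff: "valuation a = \<infinity> \<longleftrightarrow> a = 0"
  by (simp add: valuation_def)

lemma tendsto_puiseux_value:
  assumes "a \<in> convergent_puiseux" "puiseux_coeff a 0 = 0"
  shows "(puiseux_value a \<longlongrightarrow> 0) (at_right 0)"
proof (cases "a = 0")
  case True
  thus ?thesis by (simp add: puiseux_value_def[abs_def] zero_puiseux.rep_eq)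
next
  case False
  let ?s = "real_of_ereal (valuation a)"
  have "?s > 0" using assms False valuation_pos_iff[of a] valuation_finite[of a]
    by (cases "valuation a") auto
  from tendsto_mult[OF puiseux_value_asymp[OF assms(1) False] tendsto_of_real[OF tendsto_powr_0_at_right[OF this]]]
  have "((\<lambda>x. puiseux_value a x / of_real (x powr ?s) * of_real (x powr ?s)) \<longlongrightarrow> 0) (at_right 0)"
    by simp
  thus ?thesis
    by (rule Lim_transform_eventually) (auto simp: eventually_at_filter)
qed

lemma tendsto_puiseux_norm:
  assumes "a \<in> convergent_puiseux" "puiseux_coeff a 0 = 0"
  shows "(puiseux_norm a \<longlongrightarrow> 0) (at_right 0)"
proof -
  obtain n g where n: "n > 0" "a = puiseux_of_fps n g" using puiseux_of_fps_exists by metis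
  \<comment> \<open>The norm of \<open>a\<close> is the value of the series with coefficients
    \<open>norm (g $ k)\<close>, which reduces the claim to a limit of values.\<close>
  define b where "b = puiseux_of_fps n (Abs_fps (\<lambda>k. norm (g $ k)))"
  have abs: "puiseux_abs b x \<longleftrightarrow> puiseux_abs a x" if "x > 0" for x
    using n that by (simp add: b_def puiseux_abs_of_fps)
  have val: "puiseux_norm a x = puiseux_value b x" if "x > 0" "puiseux_abs a x" for x
    using n that abs[OF that(1)] by (simp add: b_def puiseux_norm_of_fps puiseux_value_of_fps(1))
  have "puiseux_coeff a 0 = g $ 0" "puiseux_coeff b 0 = norm (g $ 0)"
    using n by (simp_all add: b_def coeff_puiseux_of_fps_at_0)
  moreover have "b \<in> convergent_puiseux" using assms(1) abs by (auto simp: convergent_puiseux_iff)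
  ultimately have "(puiseux_value b \<longlongrightarrow> 0) (at_right 0)"
    using assms(2) by (intro tendsto_puiseux_value) auto
  thus ?thesis
    by (rule Lim_transform_eventually)
      (use eventually_puiseux_abs[OF assms(1)] in eventually_elim, use val in auto)
qed

lemma has_sum_of_realI:
  "(\<phi> has_sum s) A \<Longrightarrow> ((\<lambda>x. of_real (\<phi> x) :: 'a::real_normed_div_algebra) has_sum of_real s) A"
  by (simp add: has_sum_of_real_iff)

lemma puiseux_abs_complex [simp]: "puiseux_abs (complex_puiseux a) x \<longleftrightarrow> puiseux_abs a x"
  by (simp add: puiseux_abs_def complex_puiseux.rep_eq norm_mult abs_mult)

lemma puiseux_value_complex:
  assumes "puiseux_abs a x"
  shows "puiseux_value (complex_puiseux a) x = of_real (puiseux_value a x)"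
proof -
  have "((\<lambda>q. puiseux_coeff a q * x powr of_rat q) has_sum puiseux_value a x) UNIV"
    using abs_summable_summable[OF assms[unfolded puiseux_abs_def]] has_sum_infsum
    by (simp add: puiseux_value_def)
  from has_sum_of_realI[OF this, where 'a=complex] show ?thesis
    unfolding puiseux_value_def[of "complex_puiseux a"]
    by (intro infsumI) (simp add: complex_puiseux.rep_eq)
qed

lemma complex_puiseux_convergent_iff [simp]:
  "complex_puiseux a \<in> convergent_puiseux \<longleftrightarrow> a \<in> convergent_puiseux"
  by (simp add: convergent_puiseux_iff)

lemma complex_puiseux_eq_iff [simp]: "complex_puiseux a = complex_puiseux b \<longleftrightarrow> a = b"
  by transfer (auto simp: fun_eq_iff)

section \<open>Convergent series in two variables on vertical lines\<close>

definition fps2_abs :: "real fps fps \<Rightarrow> real \<Rightarrow> bool" where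
  "fps2_abs f r \<longleftrightarrow> (\<lambda>(i, j). \<bar>f $ j $ i\<bar> * r ^ i * r ^ j) summable_on UNIV"

text \<open>The restriction to the vertical line of abscissa x, as a power series in y. Derivatives
  in y and continuity are obtained from it.\<close>

definition slice :: "real fps fps \<Rightarrow> real \<Rightarrow> real fps" where
  "slice f x = Abs_fps (\<lambda>j. \<Sum>\<^sub>\<infinity>i. f $ j $ i * x ^ i)"

lemma convergent_fps2_iff: "f \<in> convergent_fps2 \<longleftrightarrow> (\<exists>r>0. fps2_abs f r)"
  by (simp add: convergent_fps2_def fps2_abs_def)

lemma fps2_abs_mono:
  assumes "fps2_abs f r" "0 \<le> s" "s \<le> r"
  shows "fps2_abs f s"
  unfolding fps2_abs_def
proof (rule summable_on_comparison_test[OF assms(1)[unfolded fps2_abs_def]])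
  fix p :: "nat \<times> nat"
  show "(case p of (i, j) \<Rightarrow> \<bar>f $ j $ i\<bar> * s ^ i * s ^ j) \<le> (case p of (i, j) \<Rightarrow> \<bar>f $ j $ i\<bar> * r ^ i * r ^ j)"
    using assms by (auto intro!: mult_mono power_mono split: prod.splits)
  show "0 \<le> (case p of (i, j) \<Rightarrow> \<bar>f $ j $ i\<bar> * s ^ i * s ^ j)"
    using assms by (auto split: prod.splits)
qed

lemma slice_deriv: "slice (fps_deriv f) x = fps_deriv (slice f x)"
proof (rule fps_ext)
  fix j
  have "fps_deriv f $ j = fps_const (real (j + 1)) * f $ (j + 1)"
    by (simp flip: fps_of_nat fps_const_add)
  thus "slice (fps_deriv f) x $ j = fps_deriv (slice f x) $ j"
    by (simp only: slice_def fps_nth_Abs_fps fps_deriv_nth fps_mult_left_const_nth mult.assoc infsum_cmult_right')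
qed

text \<open>Absolute convergence on the bidisc of radius r allows the double series to be summed
  over the powers of x first.\<close>

lemma
  assumes f: "fps2_abs f r" and r: "r > 0" and x: "\<bar>x\<bar> \<le> r"
  shows abs_summable_slice: "Infinite_Sum.abs_summable_on (\<lambda>i. f $ j $ i * x ^ i) UNIV"
    and fps_conv_radius_slice: "fps_conv_radius (slice f x) \<ge> r"
    and eval_fps2_eq_slice: "\<bar>y\<bar> \<le> r \<Longrightarrow> eval_fps2 f x y = eval_fps (slice f x) y"
    and abs_summable_eval_fps2: "\<bar>y\<bar> \<le> r \<Longrightarrow> Infinite_Sum.abs_summable_on (\<lambda>(i, j). f $ j $ i * x ^ i * y ^ j) UNIV"
proof -
  have sum: "Infinite_Sum.abs_summable_on (\<lambda>(i, j). f $ j $ i * x ^ i * y ^ j) UNIV" if "\<bar>y\<bar> \<le> r" for y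
  proof (rule Infinite_Sum.abs_summable_on_comparison_test'[OF f[unfolded fps2_abs_def]])
    fix p :: "nat \<times> nat"
    show "norm (case p of (i, j) \<Rightarrow> f $ j $ i * x ^ i * y ^ j) \<le> (case p of (i, j) \<Rightarrow> \<bar>f $ j $ i\<bar> * r ^ i * r ^ j)"
      using r x that by (auto simp: abs_mult power_abs intro!: mult_mono power_mono split: prod.splits)
  qed
  thus "\<bar>y\<bar> \<le> r \<Longrightarrow> Infinite_Sum.abs_summable_on (\<lambda>(i, j). f $ j $ i * x ^ i * y ^ j) UNIV" .
  have swap: "Infinite_Sum.abs_summable_on (\<lambda>(j, i). f $ j $ i * x ^ i * y ^ j) (UNIV \<times> UNIV)" if "\<bar>y\<bar> \<le> r" for y
    using sum[OF that]
    by (subst summable_on_reindex_bij_witness[where T = UNIV and i = prod.swap and j = prod.swap])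
      (auto simp: case_prod_unfold)
  show abs: "Infinite_Sum.abs_summable_on (\<lambda>i. f $ j $ i * x ^ i) UNIV" for j
  proof -
    have "Infinite_Sum.abs_summable_on (\<lambda>i. f $ j $ i * x ^ i * r ^ j) UNIV"
      using Infinite_Sum.abs_summable_on_Sigma_iff[THEN iffD1, OF swap[of r]] r by auto
    thus ?thesis using r by (simp add: abs_mult summable_on_cmult_left')
  qed
  have hs: "((\<lambda>j. slice f x $ j * y ^ j) has_sum eval_fps2 f x y) UNIV" if y: "\<bar>y\<bar> \<le> r" for y
  proof -
    have "((\<lambda>(i, j). f $ j $ i * x ^ i * y ^ j) has_sum eval_fps2 f x y) UNIV"
      unfolding eval_fps2_def by (rule has_sum_infsum, rule abs_summable_summable) (rule sum[OF y])
    hence hs2: "((\<lambda>(j, i). f $ j $ i * x ^ i * y ^ j) has_sum eval_fps2 f x y) (UNIV \<times> UNIV)"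
      by (subst has_sum_reindex_bij_witness[where T = UNIV and i = prod.swap and j = prod.swap])
        (auto simp: case_prod_unfold)
    have "((\<lambda>i. f $ j $ i * x ^ i * y ^ j) has_sum slice f x $ j * y ^ j) UNIV" for j
      unfolding slice_def fps_nth_Abs_fps
      by (rule has_sum_cmult_left, rule has_sum_infsum, rule abs_summable_summable) (rule abs)
    thus ?thesis by (intro has_sum_SigmaD[OF hs2]) simp
  qed
  have sums: "(\<lambda>j. slice f x $ j * y ^ j) sums eval_fps2 f x y" if y: "\<bar>y\<bar> \<le> r" for y
    using hs[OF y] by (rule has_sum_imp_sums)
  show "\<bar>y\<bar> \<le> r \<Longrightarrow> eval_fps2 f x y = eval_fps (slice f x) y"
    using sums[of y] by (simp add: sums_iff eval_fps_def)
  have "summable (\<lambda>j. slice f x $ j * r ^ j)" using sums[of r] r by (auto simp: sums_iff)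
  from conv_radius_geI[of _ r, OF this] r show "fps_conv_radius (slice f x) \<ge> r"
    by (simp add: fps_conv_radius_def)
qed

text \<open>A non-constant monomial has degree at least 1, so shrinking the bidisc from radius r to
  s gains a factor s / r in each term. The explicit bound serves to keep a unit away from 0.\<close>

lemma eval_fps2_continuous_0:
  assumes f: "fps2_abs f r" and r: "r > 0" and s: "0 \<le> s" "s \<le> r" and xy: "\<bar>x\<bar> \<le> s" "\<bar>y\<bar> \<le> s"
  shows "\<bar>eval_fps2 f x y - f $ 0 $ 0\<bar> \<le> s / r * (\<Sum>\<^sub>\<infinity>(i, j). \<bar>f $ j $ i\<bar> * r ^ i * r ^ j)"
proof -
  let ?g = "\<lambda>(i, j). f $ j $ i * x ^ i * y ^ j" and ?d = "\<lambda>p. if p = (0::nat, 0::nat) then f $ 0 $ 0 else 0"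
  let ?h = "\<lambda>(i, j). \<bar>f $ j $ i\<bar> * r ^ i * r ^ j"
  have abs: "Infinite_Sum.abs_summable_on ?g UNIV" using abs_summable_eval_fps2[OF f r, of x y] s xy by auto
  have hg: "(?g has_sum eval_fps2 f x y) UNIV"
    unfolding eval_fps2_def by (rule has_sum_infsum, rule abs_summable_summable) (rule abs)
  have "(?d has_sum f $ 0 $ 0) {(0, 0)}" by (rule has_sum_finiteI) auto
  hence hd: "(?d has_sum f $ 0 $ 0) UNIV"
    by (rule has_sum_cong_neutral[THEN iffD1, rotated -1]) auto
  have hgd: "((\<lambda>p. ?g p - ?d p) has_sum eval_fps2 f x y - f $ 0 $ 0) UNIV"
    using has_sum_add[OF hg has_sum_uminusI[OF hd]] by simp
  have hs: "((\<lambda>p. s / r * ?h p) has_sum s / r * infsum ?h UNIV) UNIV"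
    using f unfolding fps2_abs_def by (intro has_sum_cmult_right has_sum_infsum)
  have le: "norm (?g p - ?d p) \<le> s / r * ?h p" for p
  proof (cases p)
    case (Pair i j)
    show ?thesis
    proof (cases "i = 0 \<and> j = 0")
      case True
      thus ?thesis using s r Pair by auto
    next
      case False
      then obtain m where m: "i + j = Suc m" by (metis add_is_0 not0_implies_Suc)
      have "\<bar>x\<bar> ^ i * \<bar>y\<bar> ^ j \<le> s ^ i * s ^ j" using xy s by (intro mult_mono power_mono) auto
      also have "\<dots> = s * s ^ m" by (simp flip: power_add add: m)
      also have "\<dots> \<le> s * r ^ m" using s by (intro mult_left_mono power_mono) auto
      also have "\<dots> = s / r * (r ^ i * r ^ j)" using r by (simp flip: power_add add: m)
      finally have "\<bar>f $ j $ i\<bar> * (\<bar>x\<bar> ^ i * \<bar>y\<bar> ^ j) \<le> \<bar>f $ j $ i\<bar> * (s / r * (r ^ i * r ^ j))"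
        by (rule mult_left_mono) auto
      thus ?thesis using Pair False by (auto simp: abs_mult power_abs mult_ac)
    qed
  qed
  have "\<bar>eval_fps2 f x y - f $ 0 $ 0\<bar> \<le> s / r * infsum ?h UNIV"
    using norm_infsum_le[OF hgd hs] le by simp
  thus ?thesis by simp
qed

lemma
  assumes f: "fps2_abs f r" and x: "0 < x" "x \<le> r"
  shows puiseux_abs_coeff: "puiseux_abs (puiseux_of_fps 1 (f $ j)) x"
    and puiseux_value_coeff: "puiseux_value (puiseux_of_fps 1 (f $ j)) x = slice f x $ j"
proof -
  have abs: "Infinite_Sum.abs_summable_on (\<lambda>i. f $ j $ i * x ^ i) UNIV"
    using abs_summable_slice[OF f, of x] x by auto
  hence "(\<lambda>i. \<bar>f $ j $ i\<bar> * x ^ i) summable_on UNIV" using x by (simp add: abs_mult power_abs)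
  hence "summable (\<lambda>i. \<bar>f $ j $ i\<bar> * x ^ i)" by (rule summable_on_imp_summable)
  thus *: "puiseux_abs (puiseux_of_fps 1 (f $ j)) x" using x by (simp add: puiseux_abs_of_fps)
  have "((\<lambda>i. f $ j $ i * x ^ i) has_sum slice f x $ j) UNIV"
    unfolding slice_def fps_nth_Abs_fps by (rule has_sum_infsum, rule abs_summable_summable) (rule abs)
  from has_sum_imp_sums[OF this] puiseux_value_of_fps(2)[OF _ _ *] x
  show "puiseux_value (puiseux_of_fps 1 (f $ j)) x = slice f x $ j" by (auto simp: sums_iff)
qed

text \<open>Evaluating the coefficients at x respects products, so a factorisation over Puiseux
  series becomes one of functions of y. The linear factors are attached one at a time: each has
  infinite radius of convergence, so the radius R survives.\<close>

lemma eval_fps_mult_linear_factors: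
  fixes U :: "complex puiseux fps" and \<Gamma> :: "complex puiseux multiset"
  assumes x: "x > 0" and U: "\<And>j. puiseux_abs (U $ j) x" and \<Gamma>: "\<And>\<gamma>. \<gamma> \<in># \<Gamma> \<Longrightarrow> puiseux_abs \<gamma> x"
    and R: "fps_conv_radius (Abs_fps (\<lambda>j. puiseux_value (U $ j) x)) \<ge> R" and y: "ereal (norm y) < R"
  defines "W \<equiv> U * (\<Prod>\<gamma>\<in>#\<Gamma>. fps_X - fps_const \<gamma>)"
  shows "eval_fps (Abs_fps (\<lambda>j. puiseux_value (W $ j) x)) y =
    eval_fps (Abs_fps (\<lambda>j. puiseux_value (U $ j) x)) y * (\<Prod>\<gamma>\<in>#\<Gamma>. y - puiseux_value \<gamma> x)"
proof -
  have "(\<forall>j. puiseux_abs (W $ j) x) \<and> fps_conv_radius (Abs_fps (\<lambda>j. puiseux_value (W $ j) x)) \<ge> R \<and>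
    eval_fps (Abs_fps (\<lambda>j. puiseux_value (W $ j) x)) y =
    eval_fps (Abs_fps (\<lambda>j. puiseux_value (U $ j) x)) y * (\<Prod>\<gamma>\<in>#\<Gamma>. y - puiseux_value \<gamma> x)"
    unfolding W_def using \<Gamma>
  proof (induction \<Gamma>)
    case empty
    thus ?case using U R by auto
  next
    case (add \<gamma> \<Gamma>)
    define V where "V = U * (\<Prod>\<gamma>\<in>#\<Gamma>. fps_X - fps_const \<gamma>)"
    define E where "E = Abs_fps (\<lambda>j. puiseux_value (V $ j) x)"
    have IH: "\<And>j. puiseux_abs (V $ j) x" "fps_conv_radius E \<ge> R"
      "eval_fps E y = eval_fps (Abs_fps (\<lambda>j. puiseux_value (U $ j) x)) y * (\<Prod>\<gamma>\<in>#\<Gamma>. y - puiseux_value \<gamma> x)"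
      using add unfolding V_def E_def by auto
    have \<gamma>: "puiseux_abs \<gamma> x" using add by auto
    have eq: "U * (\<Prod>\<gamma>\<in>#add_mset \<gamma> \<Gamma>. fps_X - fps_const \<gamma>) = fps_X * V - fps_const \<gamma> * V"
      by (simp add: V_def algebra_simps)
    \<comment> \<open>A coefficient of the product with one linear factor involves only two
      coefficients of \<open>V\<close>, so it is evaluated by finitely many ring operations.\<close>
    have nth: "(fps_X * V - fps_const \<gamma> * V) $ j = (if j = 0 then 0 else V $ (j - 1)) - \<gamma> * V $ j" for j
      by simp
    have abs0: "puiseux_abs (if j = 0 then 0 else V $ (j - 1)) x" for j
      using IH(1) by (auto simp: puiseux_abs_def zero_puiseux.rep_eq)
    have val: "puiseux_value ((fps_X * V - fps_const \<gamma> * V) $ j) x =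
      ((fps_X - fps_const (puiseux_value \<gamma> x)) * E) $ j" for j
      unfolding nth using abs0[of j] IH(1) \<gamma> x
      by (subst puiseux_value_diff)
         (auto simp: puiseux_abs_mult puiseux_value_mult left_diff_distrib E_def puiseux_value_def[of 0] zero_puiseux.rep_eq)
    hence E': "Abs_fps (\<lambda>j. puiseux_value ((fps_X * V - fps_const \<gamma> * V) $ j) x) =
      (fps_X - fps_const (puiseux_value \<gamma> x)) * E" by (intro fps_ext) simp
    have rad: "fps_conv_radius (fps_X - fps_const (puiseux_value \<gamma> x)) = \<infinity>"
      using fps_conv_radius_diff[of fps_X "fps_const (puiseux_value \<gamma> x)"] by simp
    have "fps_conv_radius ((fps_X - fps_const (puiseux_value \<gamma> x)) * E) \<ge> R"
      using fps_conv_radius_mult[of "fps_X - fps_const (puiseux_value \<gamma> x)" E] IH(2) by (auto simp: rad)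
    moreover have "eval_fps ((fps_X - fps_const (puiseux_value \<gamma> x)) * E) y = (y - puiseux_value \<gamma> x) * eval_fps E y"
      using y IH(2) by (subst eval_fps_mult) (auto simp: rad eval_fps_diff)
    moreover have "puiseux_abs ((fps_X * V - fps_const \<gamma> * V) $ j) x" for j
      unfolding nth using abs0 IH(1) \<gamma> x by (intro puiseux_abs_diff puiseux_abs_mult)
    ultimately show ?case unfolding eq E' by (simp add: IH(3) mult_ac)
  qed
  thus ?thesis by blast
qed

section \<open>Series in two variables at Puiseux arguments\<close>

lemma eval_fps_complex_of_real:
  assumes "ereal \<bar>y\<bar> < fps_conv_radius g"
  shows "eval_fps (Abs_fps (\<lambda>j. complex_of_real (g $ j))) (of_real y) = of_real (eval_fps g y)"
proof -
  have "(\<lambda>j. g $ j * y ^ j) sums eval_fps g y" using assms by (intro sums_eval_fps) simp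
  from sums_of_real[OF this, where 'a=complex] show ?thesis by (simp add: eval_fps_def sums_iff)
qed

lemma fps_conv_radius_complex_of_real:
  "fps_conv_radius (Abs_fps (\<lambda>j. complex_of_real (g $ j))) = fps_conv_radius g"
  by (subst (1 2) conv_radius_norm[symmetric, unfolded fps_conv_radius_def[symmetric]] fps_conv_radius_norm[symmetric]) simp

lemma complex_puiseux_fps_nth [simp]: "complex_puiseux_fps f $ j = complex_puiseux (puiseux_of_fps 1 (f $ j))"
  by (simp add: complex_puiseux_fps_def)

text \<open>The number w is the value of the unit, which is continuous and non-zero at the origin,
  hence bounded and bounded away from 0 on a small box. All powers of x are thus carried by the
  linear factors.\<close>

lemma newton_puiseux_factorization:
  assumes roots: "newton_puiseux_roots f \<Gamma>" and f: "f \<in> convergent_fps2"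
  shows "\<exists>r>0. \<exists>c>0. \<exists>C. \<forall>\<^sub>F x in at_right 0. \<forall>y. \<bar>y\<bar> \<le> r \<longrightarrow>
    (\<exists>w. c \<le> \<bar>w\<bar> \<and> \<bar>w\<bar> \<le> C \<and>
       complex_of_real (eval_fps2 f x y) = of_real w * (\<Prod>\<gamma>\<in>#\<Gamma>. of_real y - puiseux_value \<gamma> x))"
proof -
  obtain u where u: "u \<in> convergent_fps2" "u $ 0 $ 0 \<noteq> 0"
    "complex_puiseux_fps f = complex_puiseux_fps u * (\<Prod>\<gamma>\<in>#\<Gamma>. fps_X - fps_const \<gamma>)"
    using roots by (auto simp: newton_puiseux_roots_def)
  have conv: "\<gamma> \<in> convergent_puiseux" if "\<gamma> \<in># \<Gamma>" for \<gamma>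
    using roots that by (auto simp: newton_puiseux_roots_def)
  obtain r1 r2 where r12: "r1 > 0" "fps2_abs f r1" "r2 > 0" "fps2_abs u r2"
    using f u(1) by (auto simp: convergent_fps2_iff)
  define \<rho> where "\<rho> = min r1 r2"
  have \<rho>: "\<rho> > 0" "fps2_abs f \<rho>" "fps2_abs u \<rho>"
    using r12 by (auto simp: \<rho>_def intro: fps2_abs_mono)
  define K where "K = (\<Sum>\<^sub>\<infinity>(i, j). \<bar>u $ j $ i\<bar> * \<rho> ^ i * \<rho> ^ j)"
  have K: "K \<ge> 0" unfolding K_def by (rule infsum_nonneg) (use \<rho> in auto)
  \<comment> \<open>The second bound makes the oscillation of \<open>u\<close> at most half of
    \<open>\<bar>u $ 0 $ 0\<bar>\<close>, with K + 1 in place of K because K may be 0. The first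
    keeps y strictly inside the disc of radius \<rho>.\<close>
  define r where "r = min (\<rho> / 2) (\<rho> * \<bar>u $ 0 $ 0\<bar> / (2 * (K + 1)))"
  have "r \<le> \<rho> / 2" unfolding r_def by (rule min.cobounded1)
  hence r: "r > 0" "r < \<rho>" using \<rho> K u(2) by (auto simp: r_def)
  have "r \<le> \<rho> * \<bar>u $ 0 $ 0\<bar> / (2 * (K + 1))" unfolding r_def by (rule min.cobounded2)
  hence "r * (2 * (K + 1)) \<le> \<rho> * \<bar>u $ 0 $ 0\<bar>" using K by (simp add: field_simps)
  hence "2 * (r * K) \<le> \<rho> * \<bar>u $ 0 $ 0\<bar>" using r by (simp add: algebra_simps)
  hence rK: "r / \<rho> * K \<le> \<bar>u $ 0 $ 0\<bar> / 2" using \<rho> by (simp add: field_simps)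
  have "\<forall>\<^sub>F x in at_right 0. \<forall>\<gamma>\<in>set_mset \<Gamma>. puiseux_abs \<gamma> x"
    by (intro eventually_ball_finite ballI eventually_mono[OF eventually_puiseux_abs[OF conv]]) auto
  moreover have "\<forall>\<^sub>F x::real in at_right 0. x < r \<and> 0 < x" using r by (intro eventually_at_rightI[of 0 r]) auto
  ultimately have "\<forall>\<^sub>F x in at_right 0. \<forall>y. \<bar>y\<bar> \<le> r \<longrightarrow>
    (\<exists>w. \<bar>u $ 0 $ 0\<bar> / 2 \<le> \<bar>w\<bar> \<and> \<bar>w\<bar> \<le> 2 * \<bar>u $ 0 $ 0\<bar> \<and>
       complex_of_real (eval_fps2 f x y) = of_real w * (\<Prod>\<gamma>\<in>#\<Gamma>. of_real y - puiseux_value \<gamma> x))"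
  proof eventually_elim
    case (elim x)
    show ?case
    proof (intro allI impI exI conjI)
      fix y assume y: "\<bar>y\<bar> \<le> r"
      have x: "0 < x" "x \<le> \<rho>" "\<bar>x\<bar> \<le> \<rho>" "\<bar>x\<bar> \<le> r" "\<bar>y\<bar> \<le> \<rho>" using elim r y by auto
      have "\<bar>eval_fps2 u x y - u $ 0 $ 0\<bar> \<le> r / \<rho> * K"
        unfolding K_def using r x y by (intro eval_fps2_continuous_0[OF \<rho>(3,1)]) auto
      thus "\<bar>u $ 0 $ 0\<bar> / 2 \<le> \<bar>eval_fps2 u x y\<bar>" "\<bar>eval_fps2 u x y\<bar> \<le> 2 * \<bar>u $ 0 $ 0\<bar>"
        using rK by linarith+
      have y\<rho>: "ereal \<bar>y\<bar> < ereal \<rho>" using y r by simp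
      have s: "Abs_fps (\<lambda>j. puiseux_value (complex_puiseux_fps h $ j) x) = Abs_fps (\<lambda>j. of_real (slice h x $ j))"
        "\<And>j. puiseux_abs (complex_puiseux_fps h $ j) x"
        if "fps2_abs h \<rho>" for h
        using puiseux_abs_coeff[OF that x(1,2)] puiseux_value_coeff[OF that x(1,2)]
        by (auto simp: puiseux_value_complex)
      have e: "eval_fps (Abs_fps (\<lambda>j. complex_of_real (slice h x $ j))) (of_real y) = of_real (eval_fps2 h x y)"
        "fps_conv_radius (Abs_fps (\<lambda>j. complex_of_real (slice h x $ j))) \<ge> ereal \<rho>"
        if "fps2_abs h \<rho>" for h
        using fps_conv_radius_slice[OF that \<rho>(1) x(3)] eval_fps2_eq_slice[OF that \<rho>(1) x(3,5)]
          less_le_trans[OF y\<rho> fps_conv_radius_slice[OF that \<rho>(1) x(3)]]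
        by (simp_all add: fps_conv_radius_complex_of_real eval_fps_complex_of_real)
      have "of_real (eval_fps2 f x y) = eval_fps (Abs_fps (\<lambda>j. puiseux_value (complex_puiseux_fps f $ j) x)) (of_real y)"
        by (simp only: s(1)[OF \<rho>(2)] e(1)[OF \<rho>(2)])
      also have "\<dots> = eval_fps (Abs_fps (\<lambda>j. puiseux_value (complex_puiseux_fps u $ j) x)) (of_real y) *
          (\<Prod>\<gamma>\<in>#\<Gamma>. of_real y - puiseux_value \<gamma> x)"
        unfolding u(3)
        by (rule eval_fps_mult_linear_factors[where R = "ereal \<rho>"])
          (use x s(2)[OF \<rho>(3)] elim e(2)[OF \<rho>(3)] y\<rho> in \<open>auto simp only: s(1)[OF \<rho>(3)] norm_of_real\<close>)
      also have "\<dots> = of_real (eval_fps2 u x y) * (\<Prod>\<gamma>\<in>#\<Gamma>. of_real y - puiseux_value \<gamma> x)"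
        by (simp only: s(1)[OF \<rho>(3)] e(1)[OF \<rho>(3)])
      finally show "complex_of_real (eval_fps2 f x y) = of_real (eval_fps2 u x y) * (\<Prod>\<gamma>\<in>#\<Gamma>. of_real y - puiseux_value \<gamma> x)" .
    qed
  qed
  thus ?thesis using r(1) u(2) by (intro exI[of _ r] conjI exI[of _ "\<bar>u $ 0 $ 0\<bar> / 2"] exI[of _ "2 * \<bar>u $ 0 $ 0\<bar>"]) auto
qed

text \<open>One absolutely convergent family, indexed by monomials (i, j) and exponents q, is summed
  in two orders: over q first it gives F at the point (x, a(x)), over (i, j) first it gives the
  value of the substituted series.\<close>

lemma
  fixes F :: "real fps fps"
  assumes F: "fps2_abs F r" and x: "0 < x" "x \<le> r" and a: "puiseux_abs a x" "puiseux_norm a x \<le> r"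
    and a0: "puiseux_coeff a 0 = 0"
  shows puiseux_abs_subst: "puiseux_abs (subst_puiseux F a) x"
    and puiseux_value_subst: "puiseux_value (subst_puiseux F a) x = eval_fps2 F x (puiseux_value a x)"
proof -
  obtain n g where n: "n > 0" and ag: "a = puiseux_of_fps n g" using puiseux_of_fps_exists by metis
  have g0: "g $ 0 = 0" using a0 n by (simp add: ag coeff_puiseux_of_fps_at_0)
  \<comment> \<open>Since \<open>a\<close> has no constant term, a^j starts at exponent j / n or
    later; hence only finitely many (i, j) reach a given exponent q.\<close>
  have fin: "finite {p. (case p of (i, j) \<Rightarrow> F $ j $ i * puiseux_coeff (a ^ j) (q - of_nat i)) \<noteq> 0}" for q
  proof (rule finite_subset)
    let ?N = "nat \<lceil>q * of_nat n\<rceil>"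
    show "{p. (case p of (i, j) \<Rightarrow> F $ j $ i * puiseux_coeff (a ^ j) (q - of_nat i)) \<noteq> 0} \<subseteq> {..?N} \<times> {..?N}"
    proof
      fix p assume p: "p \<in> {p. (case p of (i, j) \<Rightarrow> F $ j $ i * puiseux_coeff (a ^ j) (q - of_nat i)) \<noteq> 0}"
      obtain i j where ij: "p = (i, j)" by force
      with p have "F $ j $ i * puiseux_coeff (a ^ j) (q - of_nat i) \<noteq> 0" by simp
      hence nz: "puiseux_coeff (puiseux_of_fps n (g ^ j)) (q - of_nat i) \<noteq> 0"
        by (simp add: ag puiseux_of_fps_power n)
      then obtain k where k: "q - of_nat i = of_nat k / of_nat n" using coeff_puiseux_of_fps_0 by metis
      hence "(g ^ j) $ k \<noteq> 0" using nz n by (simp add: coeff_puiseux_of_fps)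
      hence jk: "j \<le> k" using startsby_zero_power_prefix[OF g0, of j] by (meson not_le)
      have q: "q * of_nat n = of_nat (k + n * i)" using k n by (simp add: field_simps)
      have "?N = k + n * i" unfolding q by (simp only: ceiling_of_nat nat_int)
      moreover have "i \<le> n * i" using n by simp
      ultimately show "p \<in> {..?N} \<times> {..?N}" using jk ij by (simp add: trans_le_add1 trans_le_add2 del: mult_le_cancel2)
    qed
  qed auto
  define G where "G = (\<lambda>((i, j), q). F $ j $ i * puiseux_coeff (a ^ j) (q - of_nat i) * x powr of_rat q)"
  have shift: "((\<lambda>q. \<phi> (q - of_nat i)) has_sum s) UNIV \<longleftrightarrow> (\<phi> has_sum s) UNIV" for \<phi> :: "rat \<Rightarrow> real" and i s
    by (rule has_sum_reindex_bij_witness[where i = "\<lambda>q. q + of_nat i" and j = "\<lambda>q. q - of_nat i"]) auto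
  have pw: "x powr of_rat q = x ^ i * x powr of_rat (q - of_nat i)" for q i
    using x by (simp add: of_rat_diff powr_diff powr_realpow)
  have abs_j: "puiseux_abs (a ^ j) x" for j using puiseux_abs_power[OF x(1) a(1)] .
  have row: "((\<lambda>q. norm (G (p, q))) has_sum (case p of (i, j) \<Rightarrow> \<bar>F $ j $ i\<bar> * x ^ i * puiseux_norm (a ^ j) x)) UNIV" for p
  proof -
    obtain i j where p: "p = (i, j)" by force
    have "((\<lambda>q. norm (puiseux_coeff (a ^ j) q) * x powr of_rat q) has_sum puiseux_norm (a ^ j) x) UNIV"
      unfolding puiseux_norm_def using abs_j[of j] by (intro has_sum_infsum) (simp add: puiseux_abs_def abs_mult)
    note * = has_sum_cmult_right[OF shift[THEN iffD2, OF this, of i], of "\<bar>F $ j $ i\<bar> * x ^ i"]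
    have "norm (G (p, q)) = \<bar>F $ j $ i\<bar> * x ^ i * (norm (puiseux_coeff (a ^ j) (q - of_nat i)) * x powr of_rat (q - of_nat i))" for q
      unfolding G_def p prod.case pw[of q i] using x by (simp add: abs_mult)
    thus ?thesis using * by (simp add: p)
  qed
  \<comment> \<open>The norm of a^j at x is at most r^j, so the sums over q are dominated by the
    absolute series of F at radius r.\<close>
  have "(\<lambda>p. norm (G p)) summable_on (UNIV \<times> UNIV)"
  proof (rule summable_on_SigmaI)
    show "(\<lambda>(i, j). \<bar>F $ j $ i\<bar> * x ^ i * puiseux_norm (a ^ j) x) summable_on UNIV"
    proof (rule summable_on_comparison_test[OF F[unfolded fps2_abs_def]])
      fix p :: "nat \<times> nat"
      obtain i j where p: "p = (i, j)" by force
      have "puiseux_norm (a ^ j) x \<le> puiseux_norm a x ^ j" by (rule puiseux_norm_power[OF x(1) a(1)])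
      also have "\<dots> \<le> r ^ j" using a(2) puiseux_norm_nonneg by (rule power_mono)
      finally show "(case p of (i, j) \<Rightarrow> \<bar>F $ j $ i\<bar> * x ^ i * puiseux_norm (a ^ j) x)
          \<le> (case p of (i, j) \<Rightarrow> \<bar>F $ j $ i\<bar> * r ^ i * r ^ j)"
        unfolding p prod.case using x by (intro mult_mono power_mono mult_nonneg_nonneg puiseux_norm_nonneg) auto
      show "0 \<le> (case p of (i, j) \<Rightarrow> \<bar>F $ j $ i\<bar> * x ^ i * puiseux_norm (a ^ j) x)"
        unfolding p prod.case using x by (intro mult_nonneg_nonneg puiseux_norm_nonneg) auto
    qed
  qed (use row in auto)
  hence absG: "Infinite_Sum.abs_summable_on G (UNIV \<times> UNIV)" .
  hence "Infinite_Sum.abs_summable_on (\<lambda>(q, p). G (p, q)) (UNIV \<times> UNIV)"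
    by (subst summable_on_reindex_bij_witness[where T = "UNIV \<times> UNIV" and i = prod.swap and j = prod.swap])
      (auto simp: case_prod_unfold)
  note absG' = this
  \<comment> \<open>For fixed q the sum over (i, j) is finite, so the infinite sum agrees with the
    \<open>Sum_any\<close> that defines the substitution.\<close>
  have col: "infsum (\<lambda>p. G (p, q)) UNIV = puiseux_coeff (subst_puiseux F a) q * x powr of_rat q" for q
  proof -
    let ?A = "{p. (case p of (i, j) \<Rightarrow> F $ j $ i * puiseux_coeff (a ^ j) (q - of_nat i)) \<noteq> 0}"
    have "infsum (\<lambda>p. G (p, q)) UNIV = infsum (\<lambda>p. G (p, q)) ?A"
      by (rule infsum_cong_neutral) (auto simp: G_def)
    also have "\<dots> = (\<Sum>p\<in>?A. G (p, q))" using fin by simp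
    also have "\<dots> = (\<Sum>p\<in>?A. case p of (i, j) \<Rightarrow> F $ j $ i * puiseux_coeff (a ^ j) (q - of_nat i)) * x powr of_rat q"
      by (simp add: sum_distrib_right G_def case_prod_unfold)
    also have "(\<Sum>p\<in>?A. case p of (i, j) \<Rightarrow> F $ j $ i * puiseux_coeff (a ^ j) (q - of_nat i)) = puiseux_coeff (subst_puiseux F a) q"
      unfolding subst_puiseux.rep_eq by (rule Sum_any.expand_set[symmetric])
    finally show ?thesis .
  qed
  have abs_col: "norm (infsum (\<lambda>p. G (p, q)) UNIV) \<le> infsum (\<lambda>p. norm (G (p, q))) UNIV" for q
    by (rule norm_infsum_bound)
      (use Infinite_Sum.abs_summable_on_Sigma_iff[THEN iffD1, OF absG'] in auto)
  show abs: "puiseux_abs (subst_puiseux F a) x"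
    unfolding puiseux_abs_def
  proof (rule Infinite_Sum.abs_summable_on_comparison_test')
    show "(\<lambda>q. infsum (\<lambda>p. norm (G (p, q))) UNIV) summable_on UNIV"
      using Infinite_Sum.abs_summable_on_Sigma_iff[THEN iffD1, OF absG', THEN conjunct2]
      by (simp add: infsum_nonneg)
    show "norm (puiseux_coeff (subst_puiseux F a) q * of_real (x powr of_rat q)) \<le> infsum (\<lambda>p. norm (G (p, q))) UNIV" for q
      using abs_col[of q] by (simp add: col)
  qed
  have S1: "(G has_sum infsum G (UNIV \<times> UNIV)) (UNIV \<times> UNIV)"
    by (rule has_sum_infsum, rule abs_summable_summable) (rule absG)
  hence S2: "((\<lambda>(q, p). G (p, q)) has_sum infsum G (UNIV \<times> UNIV)) (UNIV \<times> UNIV)"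
    by (subst has_sum_reindex_bij_witness[where T = "UNIV \<times> UNIV" and i = prod.swap and j = prod.swap])
      (auto simp: case_prod_unfold)
  have col': "((\<lambda>p. G (p, q)) has_sum puiseux_coeff (subst_puiseux F a) q * x powr of_rat q) UNIV" for q
    unfolding col[symmetric]
    by (rule has_sum_infsum, rule abs_summable_summable)
      (use Infinite_Sum.abs_summable_on_Sigma_iff[THEN iffD1, OF absG'] in auto)
  have "((\<lambda>q. puiseux_coeff (subst_puiseux F a) q * x powr of_rat q) has_sum infsum G (UNIV \<times> UNIV)) UNIV"
    using col' by (intro has_sum_SigmaD[OF S2]) simp
  hence v1: "puiseux_value (subst_puiseux F a) x = infsum G (UNIV \<times> UNIV)"
    by (simp add: puiseux_value_def infsumI)
  have row': "((\<lambda>q. G ((i, j), q)) has_sum F $ j $ i * x ^ i * puiseux_value a x ^ j) UNIV" for i j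
  proof -
    have "((\<lambda>q. puiseux_coeff (a ^ j) q * x powr of_rat q) has_sum puiseux_value (a ^ j) x) UNIV"
      unfolding puiseux_value_def
      using has_sum_infsum[OF abs_summable_summable[OF abs_j[of j, unfolded puiseux_abs_def]]] by simp
    note * = has_sum_cmult_right[OF shift[THEN iffD2, OF this, of i], of "F $ j $ i * x ^ i"]
    have "G ((i, j), q) = F $ j $ i * x ^ i * (puiseux_coeff (a ^ j) (q - of_nat i) * x powr of_rat (q - of_nat i))" for q
      unfolding G_def prod.case pw[of q i] by simp
    thus ?thesis using * by (simp add: puiseux_value_power[OF x(1) a(1)])
  qed
  have "((\<lambda>(i, j). F $ j $ i * x ^ i * puiseux_value a x ^ j) has_sum infsum G (UNIV \<times> UNIV)) UNIV"
    using row' by (intro has_sum_SigmaD[OF S1]) auto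
  thus "puiseux_value (subst_puiseux F a) x = eval_fps2 F x (puiseux_value a x)"
    by (simp add: v1 eval_fps2_def infsumI)
qed

lemma
  assumes F: "F \<in> convergent_fps2" and a: "a \<in> convergent_puiseux" "puiseux_coeff a 0 = 0"
  shows subst_puiseux_convergent: "subst_puiseux F a \<in> convergent_puiseux"
    and eventually_puiseux_value_subst:
      "\<forall>\<^sub>F x in at_right 0. puiseux_value (subst_puiseux F a) x = eval_fps2 F x (puiseux_value a x)"
proof -
  obtain r where r: "r > 0" "fps2_abs F r" using F by (auto simp: convergent_fps2_iff)
  have "\<forall>\<^sub>F x::real in at_right 0. x < r" using r by (intro eventually_at_rightI[of 0 r]) auto
  moreover have "\<forall>\<^sub>F x in at_right 0. puiseux_norm a x < r"
    using order_tendstoD(2)[OF tendsto_puiseux_norm[OF a] r(1)] .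
  ultimately have ev: "\<forall>\<^sub>F x in at_right 0. 0 < x \<and> puiseux_abs (subst_puiseux F a) x \<and>
      puiseux_value (subst_puiseux F a) x = eval_fps2 F x (puiseux_value a x)"
    using eventually_puiseux_abs[OF a(1)]
    by eventually_elim (use puiseux_abs_subst[OF r(2)] puiseux_value_subst[OF r(2)] a(2) in auto)
  thus "\<forall>\<^sub>F x in at_right 0. puiseux_value (subst_puiseux F a) x = eval_fps2 F x (puiseux_value a x)"
    by eventually_elim auto
  from eventually_happens'[OF _ ev] show "subst_puiseux F a \<in> convergent_puiseux"
    by (auto simp: convergent_puiseux_iff)
qed

section \<open>Zero sets and apparent contours\<close>

text \<open>Turns non-reality of \<gamma> into non-vanishing of a real convergent series, whose
  values are then non-zero for all small x > 0.\<close>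

lift_definition im_puiseux :: "complex puiseux \<Rightarrow> real puiseux" is "\<lambda>a q. Im (a q)"
  by (metis zero_complex.sel(2))

lemma im_puiseux_nonzero:
  assumes "\<gamma> \<notin> range complex_puiseux"
  shows "im_puiseux \<gamma> \<noteq> 0"
proof
  assume 0: "im_puiseux \<gamma> = 0"
  obtain n g where n: "n > 0" "\<gamma> = puiseux_of_fps n g" using puiseux_of_fps_exists by metis
  have "Im (puiseux_coeff \<gamma> q) = 0" for q
    using arg_cong[OF 0, of "\<lambda>a. puiseux_coeff a q"] by (simp add: im_puiseux.rep_eq zero_puiseux.rep_eq)
  hence "puiseux_coeff \<gamma> q = puiseux_coeff (complex_puiseux (puiseux_of_fps n (Abs_fps (\<lambda>k. Re (g $ k))))) q" for q
    unfolding complex_puiseux.rep_eq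
    by (cases "\<exists>k. q = of_nat k / of_nat n")
      (auto simp: n coeff_puiseux_of_fps coeff_puiseux_of_fps_0 complex_eq_iff)
  hence "\<gamma> = complex_puiseux (puiseux_of_fps n (Abs_fps (\<lambda>k. Re (g $ k))))" by (rule puiseux_eqI)
  thus False using assms by blast
qed

lemma
  assumes "puiseux_abs \<gamma> x"
  shows puiseux_abs_im: "puiseux_abs (im_puiseux \<gamma>) x"
    and puiseux_value_im: "puiseux_value (im_puiseux \<gamma>) x = Im (puiseux_value \<gamma> x)"
proof -
  show "puiseux_abs (im_puiseux \<gamma>) x" unfolding puiseux_abs_def
    by (rule Infinite_Sum.abs_summable_on_comparison_test'[OF assms[unfolded puiseux_abs_def]])
      (auto simp: im_puiseux.rep_eq norm_mult abs_mult intro!: mult_right_mono abs_Im_le_cmod)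
  have "((\<lambda>q. puiseux_coeff \<gamma> q * of_real (x powr of_rat q)) has_sum puiseux_value \<gamma> x) UNIV"
    unfolding puiseux_value_def
    by (rule has_sum_infsum, rule abs_summable_summable) (use assms in \<open>simp add: puiseux_abs_def\<close>)
  from has_sum_Im[OF this] show "puiseux_value (im_puiseux \<gamma>) x = Im (puiseux_value \<gamma> x)"
    unfolding puiseux_value_def[of "im_puiseux \<gamma>"] by (intro infsumI) (simp add: im_puiseux.rep_eq)
qed

lemma eventually_nonreal_puiseux_value:
  assumes "\<gamma> \<in> convergent_puiseux" "\<gamma> \<notin> range complex_puiseux"
  shows "\<forall>\<^sub>F x in at_right 0. puiseux_value \<gamma> x \<notin> \<real>"
proof -
  have "im_puiseux \<gamma> \<in> convergent_puiseux"
    using assms(1) puiseux_abs_im by (auto simp: convergent_puiseux_iff)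
  from eventually_puiseux_value_nonzero[OF this im_puiseux_nonzero[OF assms(2)]]
    eventually_puiseux_abs[OF assms(1)]
  show ?thesis by eventually_elim (auto simp: puiseux_value_im complex_is_Real_iff)
qed

text \<open>The member b may depend on x. If \<open>a\<close> were not in A, its value would differ
  from those of the finitely many members of A for all small x.\<close>

lemma puiseux_mem_finiteI:
  assumes "a \<in> convergent_puiseux" "finite A" "A \<subseteq> convergent_puiseux"
    and "\<forall>\<^sub>F x in at_right 0. \<exists>b\<in>A. puiseux_value a x = puiseux_value b x"
  shows "a \<in> A"
proof (rule ccontr)
  assume "a \<notin> A"
  hence "\<forall>\<^sub>F x in at_right 0. \<forall>b\<in>A. puiseux_value a x \<noteq> puiseux_value b x"
    using assms by (intro eventually_ball_finite ballI eventually_puiseux_value_neq) auto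
  with assms(4) have "\<forall>\<^sub>F x::real in at_right 0. False" by eventually_elim auto
  thus False by simp
qed

text \<open>The factor w does not vanish, and a non-real root has non-real values for small x, so at
  a real y only factors of real roots can vanish.\<close>

lemma newton_puiseux_zero_set:
  assumes roots: "newton_puiseux_roots f \<Gamma>" and f: "f \<in> convergent_fps2"
  shows "\<exists>r>0. \<forall>\<^sub>F x in at_right 0. \<forall>y. \<bar>y\<bar> \<le> r \<longrightarrow>
    eval_fps2 f x y = 0 \<longleftrightarrow> (\<exists>\<xi>. complex_puiseux \<xi> \<in># \<Gamma> \<and> puiseux_value \<xi> x = y)"
proof -
  have conv: "\<gamma> \<in> convergent_puiseux" if "\<gamma> \<in># \<Gamma>" for \<gamma>
    using roots that by (auto simp: newton_puiseux_roots_def)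
  obtain r c C where r: "r > 0" "c > 0" and fact: "\<forall>\<^sub>F x in at_right 0. \<forall>y. \<bar>y\<bar> \<le> r \<longrightarrow>
    (\<exists>w. c \<le> \<bar>w\<bar> \<and> \<bar>w\<bar> \<le> C \<and>
       complex_of_real (eval_fps2 f x y) = of_real w * (\<Prod>\<gamma>\<in>#\<Gamma>. of_real y - puiseux_value \<gamma> x))"
    using newton_puiseux_factorization[OF assms] by blast
  have "\<forall>\<^sub>F x in at_right 0. \<forall>\<gamma>\<in>set_mset \<Gamma>. \<gamma> \<notin> range complex_puiseux \<longrightarrow> puiseux_value \<gamma> x \<notin> \<real>"
    using conv eventually_nonreal_puiseux_value by (intro eventually_ball_finite ballI) auto
  moreover have "\<forall>\<^sub>F x in at_right 0. \<forall>\<gamma>\<in>set_mset \<Gamma>. puiseux_abs \<gamma> x"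
    by (intro eventually_ball_finite ballI eventually_mono[OF eventually_puiseux_abs[OF conv]]) auto
  ultimately have "\<forall>\<^sub>F x in at_right 0. \<forall>y. \<bar>y\<bar> \<le> r \<longrightarrow>
    eval_fps2 f x y = 0 \<longleftrightarrow> (\<exists>\<xi>. complex_puiseux \<xi> \<in># \<Gamma> \<and> puiseux_value \<xi> x = y)"
    using fact
  proof eventually_elim
    case (elim x)
    show ?case
    proof (intro allI impI)
      fix y assume y: "\<bar>y\<bar> \<le> r"
      obtain w where w: "c \<le> \<bar>w\<bar>"
        "complex_of_real (eval_fps2 f x y) = of_real w * (\<Prod>\<gamma>\<in>#\<Gamma>. of_real y - puiseux_value \<gamma> x)"
        using elim y by blast
      have "w \<noteq> 0" using w(1) r(2) by auto
      have "eval_fps2 f x y = 0 \<longleftrightarrow> complex_of_real (eval_fps2 f x y) = 0" by simp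
      also have "\<dots> \<longleftrightarrow> (\<exists>\<gamma>\<in>#\<Gamma>. of_real y = puiseux_value \<gamma> x)"
        unfolding w(2) using \<open>w \<noteq> 0\<close> by (auto simp: prod_mset_zero_iff)
      also have "\<dots> \<longleftrightarrow> (\<exists>\<xi>. complex_puiseux \<xi> \<in># \<Gamma> \<and> puiseux_value \<xi> x = y)"
      proof
        assume "\<exists>\<gamma>\<in>#\<Gamma>. of_real y = puiseux_value \<gamma> x"
        then obtain \<gamma> where g: "\<gamma> \<in># \<Gamma>" "of_real y = puiseux_value \<gamma> x" by blast
        hence "puiseux_value \<gamma> x \<in> \<real>" by (metis Reals_of_real)
        then obtain \<xi> where \<xi>: "\<gamma> = complex_puiseux \<xi>" using elim g by blast
        thus "\<exists>\<xi>. complex_puiseux \<xi> \<in># \<Gamma> \<and> puiseux_value \<xi> x = y"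
          using g elim by (intro exI[of _ \<xi>]) (auto simp: puiseux_value_complex)
      next
        assume "\<exists>\<xi>. complex_puiseux \<xi> \<in># \<Gamma> \<and> puiseux_value \<xi> x = y"
        then obtain \<xi> where "complex_puiseux \<xi> \<in># \<Gamma>" "puiseux_value \<xi> x = y" by blast
        thus "\<exists>\<gamma>\<in>#\<Gamma>. of_real y = puiseux_value \<gamma> x"
          using elim by (intro bexI[of _ "complex_puiseux \<xi>"]) (auto simp: puiseux_value_complex)
      qed
      finally show "eval_fps2 f x y = 0 \<longleftrightarrow> (\<exists>\<xi>. complex_puiseux \<xi> \<in># \<Gamma> \<and> puiseux_value \<xi> x = y)" .
    qed
  qed
  thus ?thesis using r by blast
qed

lemma newton_puiseux_real_rootD:
  assumes "newton_puiseux_roots f \<Gamma>" "complex_puiseux \<xi> \<in># \<Gamma>"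
  shows "\<xi> \<in> convergent_puiseux" "puiseux_coeff \<xi> 0 = 0"
  using assms by (auto simp: newton_puiseux_roots_def complex_puiseux.rep_eq)

lemma finite_real_newton_puiseux_roots: "finite {\<xi>. complex_puiseux \<xi> \<in># \<Gamma>}"
  using finite_vimageI[of "set_mset \<Gamma>" complex_puiseux] by (simp add: inj_def vimage_def)

lemma eventually_puiseux_value_small:
  fixes a :: "real puiseux"
  assumes "a \<in> convergent_puiseux" "puiseux_coeff a 0 = 0" "r > 0"
  shows "\<forall>\<^sub>F x in at_right 0. \<bar>puiseux_value a x\<bar> \<le> r"
  using order_tendstoD(2)[OF tendsto_norm_zero[OF tendsto_puiseux_value[OF assms(1,2)]] assms(3)]
  by eventually_elim simp

text \<open>\<open>real_roots\<close> ranges over all factorisations. Any two of them describe the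
  same zero set in a box around the origin, and that zero set determines the real roots.\<close>

lemma real_roots_eq:
  assumes \<Gamma>: "newton_puiseux_roots f \<Gamma>" and f: "f \<in> convergent_fps2"
  shows "real_roots f = {\<xi>. complex_puiseux \<xi> \<in># \<Gamma>}"
proof -
  have "\<xi> \<in> {\<xi>. complex_puiseux \<xi> \<in># \<Gamma>}"
    if \<Gamma>': "newton_puiseux_roots f \<Gamma>'" "complex_puiseux \<xi> \<in># \<Gamma>'" for \<Gamma>' \<xi>
  proof (rule puiseux_mem_finiteI[OF _ finite_real_newton_puiseux_roots])
    note \<xi> = newton_puiseux_real_rootD[OF \<Gamma>']
    show "\<xi> \<in> convergent_puiseux" by fact
    show "{\<xi>. complex_puiseux \<xi> \<in># \<Gamma>} \<subseteq> convergent_puiseux"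
      using newton_puiseux_real_rootD[OF \<Gamma>] by auto
    obtain r where r: "r > 0" "\<forall>\<^sub>F x in at_right 0. \<forall>y. \<bar>y\<bar> \<le> r \<longrightarrow>
      eval_fps2 f x y = 0 \<longleftrightarrow> (\<exists>\<xi>. complex_puiseux \<xi> \<in># \<Gamma> \<and> puiseux_value \<xi> x = y)"
      using newton_puiseux_zero_set[OF \<Gamma> f] by blast
    obtain r' where r': "r' > 0" "\<forall>\<^sub>F x in at_right 0. \<forall>y. \<bar>y\<bar> \<le> r' \<longrightarrow>
      eval_fps2 f x y = 0 \<longleftrightarrow> (\<exists>\<xi>. complex_puiseux \<xi> \<in># \<Gamma>' \<and> puiseux_value \<xi> x = y)"
      using newton_puiseux_zero_set[OF \<Gamma>'(1) f] by blast
    show "\<forall>\<^sub>F x in at_right 0. \<exists>b\<in>{\<xi>. complex_puiseux \<xi> \<in># \<Gamma>}. puiseux_value \<xi> x = puiseux_value b x"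
      using r(2) r'(2) eventually_puiseux_value_small[OF \<xi> r(1)] eventually_puiseux_value_small[OF \<xi> r'(1)]
    proof eventually_elim
      case (elim x)
      hence "eval_fps2 f x (puiseux_value \<xi> x) = 0" using \<Gamma>'(2) by blast
      then obtain \<eta> where "complex_puiseux \<eta> \<in># \<Gamma>" "puiseux_value \<eta> x = puiseux_value \<xi> x"
        using elim by blast
      thus ?case by (intro bexI[of _ \<eta>]) auto
    qed
  qed
  thus ?thesis using \<Gamma> by (auto simp: real_roots_def)
qed

text \<open>Over small x the zeros of f in the strip are the values of the real roots, so the
  contour is the union of the graphs of their images under F. A convergent series whose graph lies
  in this finite union is one of these images. Only the germ at x = 0 matters, hence \<epsilon> is
  arbitrary.\<close>

lemma real_roots_of_apparent_contour:
  assumes \<Gamma>: "newton_puiseux_roots f \<Gamma>" and f: "f \<in> convergent_fps2" and F: "F \<in> convergent_fps2"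
  shows "\<exists>r>0. \<forall>a b \<epsilon>. - r \<le> a \<and> a < 0 \<and> 0 < b \<and> b \<le> r \<and> 0 < \<epsilon> \<longrightarrow>
    real_roots_of_curve (apparent_contour f F \<epsilon> {a..b}) = subst_puiseux F ` real_roots f"
proof -
  obtain r where r: "r > 0" and Z: "\<forall>\<^sub>F x in at_right 0. \<forall>y. \<bar>y\<bar> \<le> r \<longrightarrow>
      eval_fps2 f x y = 0 \<longleftrightarrow> (\<exists>\<xi>. complex_puiseux \<xi> \<in># \<Gamma> \<and> puiseux_value \<xi> x = y)"
    using newton_puiseux_zero_set[OF \<Gamma> f] by blast
  define R where "R = {\<xi>. complex_puiseux \<xi> \<in># \<Gamma>}"
  have R: "real_roots f = R" "finite R" unfolding R_def
    using real_roots_eq[OF \<Gamma> f] finite_real_newton_puiseux_roots by auto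
  have conv: "\<xi> \<in> convergent_puiseux" "puiseux_coeff \<xi> 0 = 0" if "\<xi> \<in> R" for \<xi>
    using newton_puiseux_real_rootD[OF \<Gamma>] that by (auto simp: R_def)
  have subst: "\<forall>\<^sub>F x in at_right 0. \<forall>\<xi>\<in>R. puiseux_value (subst_puiseux F \<xi>) x = eval_fps2 F x (puiseux_value \<xi> x)"
    using R(2) conv by (intro eventually_ball_finite ballI eventually_puiseux_value_subst[OF F]) auto
  have "real_roots_of_curve (apparent_contour f F \<epsilon> {a..b}) = subst_puiseux F ` real_roots f"
    if ab: "- r \<le> a \<and> a < 0 \<and> 0 < b \<and> b \<le> r \<and> 0 < \<epsilon>" for a b \<epsilon>
  proof -
    have mem: "(x, z) \<in> apparent_contour f F \<epsilon> {a..b} \<longleftrightarrow>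
      (\<exists>y\<in>{a..b}. 0 \<le> x \<and> x \<le> \<epsilon> \<and> eval_fps2 f x y = 0 \<and> z = eval_fps2 F x y)" for x z
      by (fastforce simp: apparent_contour_def primitive_graph_def xz_projection_def image_iff)
    have small: "\<forall>\<^sub>F x::real in at_right 0. 0 \<le> x \<and> x \<le> \<epsilon>"
      using ab by (intro eventually_at_rightI[of 0 \<epsilon>]) auto
    show ?thesis unfolding R(1)
    proof (intro subset_antisym subsetI)
      fix \<delta> assume "\<delta> \<in> real_roots_of_curve (apparent_contour f F \<epsilon> {a..b})"
      hence \<delta>: "\<delta> \<in> convergent_puiseux"
        "\<forall>\<^sub>F x in at_right 0. (x, puiseux_value \<delta> x) \<in> apparent_contour f F \<epsilon> {a..b}"
        by (auto simp: real_roots_of_curve_def eval_puiseux_eq)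
      show "\<delta> \<in> subst_puiseux F ` R"
      proof (rule puiseux_mem_finiteI[OF \<delta>(1)])
        show "subst_puiseux F ` R \<subseteq> convergent_puiseux"
          using conv subst_puiseux_convergent[OF F] by auto
        show "\<forall>\<^sub>F x in at_right 0. \<exists>b\<in>subst_puiseux F ` R. puiseux_value \<delta> x = puiseux_value b x"
          using \<delta>(2) Z subst
        proof eventually_elim
          case (elim x)
          then obtain y where y: "a \<le> y" "y \<le> b" "eval_fps2 f x y = 0" "puiseux_value \<delta> x = eval_fps2 F x y"
            by (auto simp: mem)
          hence "\<bar>y\<bar> \<le> r" using ab by auto
          then obtain \<xi> where "\<xi> \<in> R" "puiseux_value \<xi> x = y" using elim y(3) by (auto simp: R_def)
          thus ?case using elim y by auto
        qed
      qed (use R in auto)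
    next
      fix \<delta> assume "\<delta> \<in> subst_puiseux F ` R"
      then obtain \<xi> where \<xi>: "\<xi> \<in> R" "\<delta> = subst_puiseux F \<xi>" by blast
      \<comment> \<open>The interval around 0 may be asymmetric; the smaller of its two half-lengths
        confines the root to it.\<close>
      have "\<forall>\<^sub>F x in at_right 0. \<bar>puiseux_value \<xi> x\<bar> \<le> min (- a) b"
        using ab conv[OF \<xi>(1)] by (intro eventually_puiseux_value_small) auto
      hence "\<forall>\<^sub>F x in at_right 0. (x, puiseux_value \<delta> x) \<in> apparent_contour f F \<epsilon> {a..b}"
        using Z subst small
      proof eventually_elim
        case (elim x)
        have "puiseux_value \<xi> x \<in> {a..b}" "\<bar>puiseux_value \<xi> x\<bar> \<le> r" using elim(1) ab by auto
        moreover have "eval_fps2 f x (puiseux_value \<xi> x) = 0" using elim(2) calculation(2) \<xi>(1) by (auto simp: R_def)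
        ultimately show ?case unfolding mem using elim \<xi> by blast
      qed
      thus "\<delta> \<in> real_roots_of_curve (apparent_contour f F \<epsilon> {a..b})"
        using conv[OF \<xi>(1)] subst_puiseux_convergent[OF F] \<xi>(2) by (auto simp: real_roots_of_curve_def eval_puiseux_eq)
    qed
  qed
  thus ?thesis using r by blast
qed

section \<open>Valuations of increments of a primitive\<close>

text \<open>Rescaling by an exponent below the valuation gives the limit 0, and rescaling by the
  valuation itself gives the initial coefficient. Stated with \<le> so that the zero series, of
  infinite valuation, is covered.\<close>

lemma puiseux_value_limit:
  assumes "e \<in> convergent_puiseux" "ereal m \<le> valuation e"
  shows "\<exists>l. ((\<lambda>x. puiseux_value e x / of_real (x powr m)) \<longlongrightarrow> l) (at_right 0) \<and> (valuation e = ereal m \<longrightarrow> l \<noteq> 0)"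
proof (cases "e = 0")
  case True
  thus ?thesis
    by (intro exI[of _ 0]) (auto simp: puiseux_value_def zero_puiseux.rep_eq valuation_def)
next
  case False
  define v where "v = real_of_ereal (valuation e)"
  have v: "valuation e = ereal v" using valuation_finite[OF False] by (simp add: v_def ereal_real')
  have lim: "((\<lambda>x. puiseux_value e x / of_real (x powr v)) \<longlongrightarrow> initial_coeff e) (at_right 0)"
    unfolding v_def by (rule puiseux_value_asymp[OF assms(1) False])
  show ?thesis
  proof (cases "v = m")
    case True
    thus ?thesis using lim False by (intro exI[of _ "initial_coeff e"]) (auto simp: initial_coeff_0_iff)
  next
    case neq: False
    hence "v - m > 0" using assms(2) v by auto
    from tendsto_mult[OF lim tendsto_of_real[OF tendsto_powr_0_at_right[OF this]]]
    have "((\<lambda>x. puiseux_value e x / of_real (x powr v) * of_real (x powr (v - m))) \<longlongrightarrow> 0) (at_right 0)" by simp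
    moreover have "\<forall>\<^sub>F x in at_right 0. puiseux_value e x / of_real (x powr v) * of_real (x powr (v - m)) =
        puiseux_value e x / of_real (x powr m)"
      by (auto simp: eventually_at_filter powr_diff)
    ultimately have "((\<lambda>x. puiseux_value e x / of_real (x powr m)) \<longlongrightarrow> 0) (at_right 0)"
      by (rule Lim_transform_eventually)
    thus ?thesis using neq v by (intro exI[of _ 0]) auto
  qed
qed

text \<open>A non-zero value behaves like the initial coefficient times x^v. For v > V this
  contradicts the lower bound, for v < V the upper one.\<close>

lemma valuation_eqI_bounds:
  fixes e :: "real puiseux"
  assumes e: "e \<in> convergent_puiseux" and c: "c > 0"
    and ev: "\<forall>\<^sub>F x in at_right 0. c * x powr V \<le> \<bar>puiseux_value e x\<bar> \<and> \<bar>puiseux_value e x\<bar> \<le> C * x powr V"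
  shows "valuation e = ereal V"
proof -
  have pos: "\<forall>\<^sub>F x::real in at_right 0. 0 < x" by (auto simp: eventually_at_filter)
  have nz: "e \<noteq> 0"
  proof
    assume e0: "e = 0"
    have "\<forall>\<^sub>F x::real in at_right 0. False"
      using ev pos by eventually_elim (use c e0 in \<open>auto simp: puiseux_value_def zero_puiseux.rep_eq mult_le_0_iff\<close>)
    thus False by simp
  qed
  define v where "v = real_of_ereal (valuation e)"
  have v: "valuation e = ereal v" using valuation_finite[OF nz] by (simp add: v_def ereal_real')
  have lim: "((\<lambda>x. puiseux_value e x / (x powr v)) \<longlongrightarrow> initial_coeff e) (at_right 0)"
    using puiseux_value_asymp[OF e nz] by (simp add: v_def)
  have "\<not> v > V"
  proof
    assume "v > V"
    hence "v - V > 0" by simp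
    from tendsto_mult[OF lim tendsto_powr_0_at_right[OF this]]
    have "((\<lambda>x. puiseux_value e x / (x powr v) * (x powr (v - V))) \<longlongrightarrow> 0) (at_right 0)" by simp
    hence "((\<lambda>x. puiseux_value e x / (x powr V)) \<longlongrightarrow> 0) (at_right 0)"
      by (rule Lim_transform_eventually) (auto simp: eventually_at_filter powr_diff)
    from order_tendstoD(2)[OF tendsto_norm_zero[OF this] c] ev pos
    have "\<forall>\<^sub>F x::real in at_right 0. False"
      by eventually_elim (auto simp: field_simps)
    thus False by simp
  qed
  moreover have "\<not> v < V"
  proof
    assume "v < V"
    hence "V - v > 0" by simp
    from tendsto_mult[OF tendsto_const[of C] tendsto_powr_0_at_right[OF this]]
    have "((\<lambda>x. C * x powr (V - v)) \<longlongrightarrow> 0) (at_right 0)" by simp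
    moreover have "\<forall>\<^sub>F x in at_right 0. norm (puiseux_value e x / (x powr v)) \<le> C * x powr (V - v)"
      using ev pos by eventually_elim (auto simp: powr_diff field_simps)
    ultimately have "((\<lambda>x. puiseux_value e x / (x powr v)) \<longlongrightarrow> 0) (at_right 0)"
      by (rule Lim_null_comparison[rotated])
    from tendsto_unique[OF _ this lim] show False using nz by (auto simp: initial_coeff_0_iff)
  qed
  ultimately show ?thesis using v by simp
qed

text \<open>Applied with \<open>p = \<xi> - \<gamma>\<close> and \<open>d = \<xi>' - \<xi>\<close>, so that \<open>p + t d\<close> is \<open>y - \<gamma>\<close> at the point
  \<open>y = \<xi> + t (\<xi>' - \<xi>)\<close>.\<close>

lemma
  fixes p :: "real \<Rightarrow> complex" and d :: "real \<Rightarrow> real"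
  assumes p: "((\<lambda>x. p x / of_real (x powr m)) \<longlongrightarrow> \<alpha>) (at_right 0)"
    and d: "((\<lambda>x. d x / x powr m) \<longlongrightarrow> \<beta>) (at_right 0)"
  shows linear_factor_upper: "\<exists>C. \<forall>\<^sub>F x in at_right 0. \<forall>t\<in>{0..1}. cmod (p x + of_real (t * d x)) \<le> C * x powr m"
    and linear_factor_lower: "\<lbrakk>0 \<le> t1; t1 \<le> t2; t2 \<le> 1; \<forall>t\<in>{t1..t2}. \<alpha> + of_real (t * \<beta>) \<noteq> 0\<rbrakk> \<Longrightarrow>
      \<exists>c>0. \<forall>\<^sub>F x in at_right 0. \<forall>t\<in>{t1..t2}. c * x powr m \<le> cmod (p x + of_real (t * d x))"
proof -
  have pos: "\<forall>\<^sub>F x::real in at_right 0. 0 < x" by (auto simp: eventually_at_filter)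
  \<comment> \<open>The rescaled factor converges to the affine function \<alpha> + t \<beta>
    uniformly in t, since t is bounded by 1.\<close>
  have approx: "\<forall>\<^sub>F x in at_right 0. 0 < x \<and>
      (\<forall>t\<in>{0..1}. cmod ((p x + of_real (t * d x)) / of_real (x powr m) - (\<alpha> + of_real (t * \<beta>))) \<le> 2 * \<eta>)"
    if "\<eta> > 0" for \<eta>
    using tendstoD[OF p that] tendstoD[OF d that] pos
  proof eventually_elim
    case (elim x)
    have "cmod ((p x + of_real (t * d x)) / of_real (x powr m) - (\<alpha> + of_real (t * \<beta>))) \<le> 2 * \<eta>"
      if t: "t \<in> {0..1}" for t
    proof -
      have "(p x + of_real (t * d x)) / of_real (x powr m) - (\<alpha> + of_real (t * \<beta>)) =
        (p x / of_real (x powr m) - \<alpha>) + of_real (t * (d x / x powr m - \<beta>))"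
        by (simp add: add_divide_distrib algebra_simps)
      also have "cmod \<dots> \<le> cmod (p x / of_real (x powr m) - \<alpha>) + \<bar>t * (d x / x powr m - \<beta>)\<bar>"
        using norm_triangle_ineq[of "p x / of_real (x powr m) - \<alpha>" "of_real (t * (d x / x powr m - \<beta>))"]
        by (simp only: norm_of_real)
      also have "\<bar>t * (d x / x powr m - \<beta>)\<bar> \<le> 1 * \<bar>d x / x powr m - \<beta>\<bar>"
        unfolding abs_mult using t by (intro mult_right_mono) auto
      finally show ?thesis using elim by (auto simp: dist_norm)
    qed
    thus ?case using elim by simp
  qed
  have scale: "cmod (p x + of_real (t * d x)) = cmod ((p x + of_real (t * d x)) / of_real (x powr m)) * x powr m"
    if "x > 0" for x t using that by (simp add: norm_divide)
  show "\<exists>C. \<forall>\<^sub>F x in at_right 0. \<forall>t\<in>{0..1}. cmod (p x + of_real (t * d x)) \<le> C * x powr m"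
  proof (intro exI)
    show "\<forall>\<^sub>F x in at_right 0. \<forall>t\<in>{0..1}. cmod (p x + of_real (t * d x)) \<le> (cmod \<alpha> + \<bar>\<beta>\<bar> + 2) * x powr m"
      using approx[OF zero_less_one]
    proof eventually_elim
      case (elim x)
      show ?case
      proof
        fix t :: real assume t: "t \<in> {0..1}"
        let ?z = "(p x + of_real (t * d x)) / of_real (x powr m)"
        have "cmod ?z \<le> cmod (\<alpha> + of_real (t * \<beta>)) + 2"
          using elim t norm_triangle_sub[of ?z "\<alpha> + of_real (t * \<beta>)"] by fastforce
        also have "cmod (\<alpha> + of_real (t * \<beta>)) \<le> cmod \<alpha> + \<bar>t * \<beta>\<bar>"
          using norm_triangle_ineq[of \<alpha> "of_real (t * \<beta>)"] by (simp only: norm_of_real)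
        also have "\<bar>t * \<beta>\<bar> \<le> 1 * \<bar>\<beta>\<bar>" unfolding abs_mult using t by (intro mult_right_mono) auto
        finally show "cmod (p x + of_real (t * d x)) \<le> (cmod \<alpha> + \<bar>\<beta>\<bar> + 2) * x powr m"
          unfolding scale[OF elim[THEN conjunct1]] by (intro mult_right_mono) auto
      qed
    qed
  qed
  assume t: "0 \<le> t1" "t1 \<le> t2" "t2 \<le> 1" and nz: "\<forall>t\<in>{t1..t2}. \<alpha> + of_real (t * \<beta>) \<noteq> 0"
  have "\<exists>s\<in>{t1..t2}. \<forall>t\<in>{t1..t2}. cmod (\<alpha> + of_real (s * \<beta>)) \<le> cmod (\<alpha> + of_real (t * \<beta>))"
    using t by (intro continuous_attains_inf continuous_intros) auto
  then obtain s where s: "s \<in> {t1..t2}" "\<And>t. t \<in> {t1..t2} \<Longrightarrow> cmod (\<alpha> + of_real (s * \<beta>)) \<le> cmod (\<alpha> + of_real (t * \<beta>))"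
    by blast
  \<comment> \<open>By compactness the affine limit has a positive minimum on the range of t. Half
    of it is kept as the bound; the other half absorbs the error \<open>2 * \<eta>\<close> with
    \<open>\<eta> = c / 2\<close>.\<close>
  define c where "c = cmod (\<alpha> + of_real (s * \<beta>)) / 2"
  have c: "c > 0" using nz s(1) by (simp add: c_def)
  have "\<forall>\<^sub>F x in at_right 0. \<forall>t\<in>{t1..t2}. c * x powr m \<le> cmod (p x + of_real (t * d x))"
    using approx[OF half_gt_zero[OF c]]
  proof eventually_elim
    case (elim x)
    show ?case
    proof
      fix t :: real assume t': "t \<in> {t1..t2}"
      let ?z = "(p x + of_real (t * d x)) / of_real (x powr m)"
      have "cmod (?z - (\<alpha> + of_real (t * \<beta>))) \<le> c" using elim t' t by simp
      moreover have "cmod (\<alpha> + of_real (t * \<beta>)) \<ge> 2 * c" using s(2)[OF t'] by (simp add: c_def)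
      ultimately have "c \<le> cmod ?z"
        using norm_triangle_sub[of "\<alpha> + of_real (t * \<beta>)" ?z] by (simp add: norm_minus_commute)
      thus "c * x powr m \<le> cmod (p x + of_real (t * d x))"
        unfolding scale[OF elim[THEN conjunct1]] by (intro mult_right_mono) auto
    qed
  qed
  thus "\<exists>c>0. \<forall>\<^sub>F x in at_right 0. \<forall>t\<in>{t1..t2}. c * x powr m \<le> cmod (p x + of_real (t * d x))" using c by blast
qed

lemma prod_mset_upper:
  fixes h :: "'b \<Rightarrow> real \<Rightarrow> 't \<Rightarrow> complex"
  assumes "\<And>\<gamma>. \<gamma> \<in># \<Gamma> \<Longrightarrow> \<exists>C. \<forall>\<^sub>F x in at_right 0. \<forall>t\<in>T. cmod (h \<gamma> x t) \<le> C * x powr m \<gamma>"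
  shows "\<exists>C. \<forall>\<^sub>F x in at_right 0. \<forall>t\<in>T. cmod (\<Prod>\<gamma>\<in>#\<Gamma>. h \<gamma> x t) \<le> C * x powr (\<Sum>\<gamma>\<in>#\<Gamma>. m \<gamma>)"
  using assms
proof (induction \<Gamma>)
  case empty
  show ?case by (intro exI[of _ 1]) (auto simp: eventually_at_filter)
next
  case (add \<gamma> \<Gamma>)
  obtain C where C: "\<forall>\<^sub>F x in at_right 0. \<forall>t\<in>T. cmod (\<Prod>\<gamma>\<in>#\<Gamma>. h \<gamma> x t) \<le> C * x powr (\<Sum>\<gamma>\<in>#\<Gamma>. m \<gamma>)"
    using add by auto
  obtain C' where C': "\<forall>\<^sub>F x in at_right 0. \<forall>t\<in>T. cmod (h \<gamma> x t) \<le> C' * x powr m \<gamma>"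
    using add.prems[of \<gamma>] by auto
  have "\<forall>\<^sub>F x in at_right 0. \<forall>t\<in>T. cmod (\<Prod>\<gamma>\<in>#add_mset \<gamma> \<Gamma>. h \<gamma> x t) \<le>
      (C' * C) * x powr (\<Sum>\<gamma>\<in>#add_mset \<gamma> \<Gamma>. m \<gamma>)"
    using C C'
  proof eventually_elim
    case (elim x)
    show ?case
    proof
      fix t assume t: "t \<in> T"
      \<comment> \<open>The constants C and C' have no assumed sign; the bounds themselves are
        non-negative because they lie above a norm.\<close>
      have "cmod (h \<gamma> x t) * cmod (\<Prod>\<gamma>\<in>#\<Gamma>. h \<gamma> x t) \<le> (C' * x powr m \<gamma>) * (C * x powr (\<Sum>\<gamma>\<in>#\<Gamma>. m \<gamma>))"
        using elim t order_trans[OF norm_ge_zero] by (intro mult_mono) blast+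
      thus "cmod (\<Prod>\<gamma>\<in>#add_mset \<gamma> \<Gamma>. h \<gamma> x t) \<le> (C' * C) * x powr (\<Sum>\<gamma>\<in>#add_mset \<gamma> \<Gamma>. m \<gamma>)"
        by (simp add: norm_mult powr_add mult_ac)
    qed
  qed
  thus ?case by blast
qed

lemma prod_mset_lower:
  fixes h :: "'b \<Rightarrow> real \<Rightarrow> 't \<Rightarrow> complex"
  assumes "\<And>\<gamma>. \<gamma> \<in># \<Gamma> \<Longrightarrow> \<exists>c>0. \<forall>\<^sub>F x in at_right 0. \<forall>t\<in>T. c * x powr m \<gamma> \<le> cmod (h \<gamma> x t)"
  shows "\<exists>c>0. \<forall>\<^sub>F x in at_right 0. \<forall>t\<in>T. c * x powr (\<Sum>\<gamma>\<in>#\<Gamma>. m \<gamma>) \<le> cmod (\<Prod>\<gamma>\<in>#\<Gamma>. h \<gamma> x t)"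
  using assms
proof (induction \<Gamma>)
  case empty
  show ?case by (intro exI[of _ 1]) (auto simp: eventually_at_filter)
next
  case (add \<gamma> \<Gamma>)
  obtain c where c: "c > 0" "\<forall>\<^sub>F x in at_right 0. \<forall>t\<in>T. c * x powr (\<Sum>\<gamma>\<in>#\<Gamma>. m \<gamma>) \<le> cmod (\<Prod>\<gamma>\<in>#\<Gamma>. h \<gamma> x t)"
    using add by auto
  obtain c' where c': "c' > 0" "\<forall>\<^sub>F x in at_right 0. \<forall>t\<in>T. c' * x powr m \<gamma> \<le> cmod (h \<gamma> x t)"
    using add.prems[of \<gamma>] by auto
  have "\<forall>\<^sub>F x in at_right 0. \<forall>t\<in>T. (c' * c) * x powr (\<Sum>\<gamma>\<in>#add_mset \<gamma> \<Gamma>. m \<gamma>) \<le>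
      cmod (\<Prod>\<gamma>\<in>#add_mset \<gamma> \<Gamma>. h \<gamma> x t)"
    using c(2) c'(2)
  proof eventually_elim
    case (elim x)
    show ?case
    proof
      fix t assume t: "t \<in> T"
      have "(c' * x powr m \<gamma>) * (c * x powr (\<Sum>\<gamma>\<in>#\<Gamma>. m \<gamma>)) \<le> cmod (h \<gamma> x t) * cmod (\<Prod>\<gamma>\<in>#\<Gamma>. h \<gamma> x t)"
        using elim t c c' by (intro mult_mono) auto
      thus "(c' * c) * x powr (\<Sum>\<gamma>\<in>#add_mset \<gamma> \<Gamma>. m \<gamma>) \<le> cmod (\<Prod>\<gamma>\<in>#add_mset \<gamma> \<Gamma>. h \<gamma> x t)"
        by (simp add: norm_mult powr_add mult_ac)
    qed
  qed
  moreover have "c' * c > 0" using c c' by simp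
  ultimately show ?case by blast
qed

text \<open>B will consist of the proportions t at which the limit \<alpha> + t \<beta> of some
  linear factor vanishes.\<close>

lemma exists_interval_avoiding_finite:
  fixes B :: "real set"
  assumes "finite B"
  shows "\<exists>s t. 0 < s \<and> s < t \<and> t < 1 \<and> {s..t} \<inter> B = {}"
proof -
  have "infinite ({0<..<1} - B)" using assms by (simp add: infinite_Ioo)
  then obtain x where x: "x \<in> {0<..<1} - B" by (metis finite.emptyI ex_in_conv)
  moreover have "open ({0<..<1} - B)" using assms by (intro open_Diff finite_imp_closed) auto
  ultimately obtain e where e: "e > 0" "cball x e \<subseteq> {0<..<1} - B" using open_contains_cball by blast
  have *: "{x - e..x + e} \<subseteq> {0<..<1} - B" using e(2) by (simp add: cball_eq_atLeastAtMost)
  moreover have "x - e \<in> {0<..<1} - B" "x + e \<in> {0<..<1} - B" using e(1) by (intro subsetD[OF *]; simp)+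
  ultimately have "x - e > 0" "x + e < 1" "x - e < x + e" "{x - e..x + e} \<inter> B = {}" using e(1) by auto
  thus ?thesis by blast
qed

text \<open>Between a and b the derivative g has constant sign, so G is monotone and the increment
  over a middle piece is at most the total increment in absolute value. A lower bound for g is
  therefore required only on that piece.\<close>

lemma
  fixes G g :: "real \<Rightarrow> real"
  assumes ab: "a < b" and G: "\<And>y. a \<le> y \<Longrightarrow> y \<le> b \<Longrightarrow> (G has_real_derivative g y) (at y)"
    and g: "continuous_on {a..b} g" and nz: "\<And>y. a < y \<Longrightarrow> y < b \<Longrightarrow> g y \<noteq> 0"
  shows increment_upper: "(\<And>t. t \<in> {0..1} \<Longrightarrow> \<bar>g (a + t * (b - a))\<bar> \<le> M) \<Longrightarrow> \<bar>G b - G a\<bar> \<le> (b - a) * M"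
    and increment_lower: "\<lbrakk>0 < s; s < t; t < 1; \<And>\<tau>. \<tau> \<in> {s..t} \<Longrightarrow> M \<le> \<bar>g (a + \<tau> * (b - a))\<bar>\<rbrakk> \<Longrightarrow>
      (t - s) * (b - a) * M \<le> \<bar>G b - G a\<bar>"
proof -
  have mvt: "\<exists>z. c < z \<and> z < d \<and> G d - G c = (d - c) * g z" if "a \<le> c" "c < d" "d \<le> b" for c d
    using that G by (intro MVT2) auto
  have param: "a + (z - a) / (b - a) * (b - a) = z" for z using ab by simp
  {
    assume M: "\<And>t. t \<in> {0..1} \<Longrightarrow> \<bar>g (a + t * (b - a))\<bar> \<le> M"
    obtain z where z: "a < z" "z < b" "G b - G a = (b - a) * g z" using mvt[of a b] ab by auto
    have "\<bar>g z\<bar> \<le> M" using M[of "(z - a) / (b - a)"] z ab unfolding param by simp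
    thus "\<bar>G b - G a\<bar> \<le> (b - a) * M" using z ab by (simp add: abs_mult)
  }
  assume st: "0 < s" "s < t" "t < 1" and M: "\<And>\<tau>. \<tau> \<in> {s..t} \<Longrightarrow> M \<le> \<bar>g (a + \<tau> * (b - a))\<bar>"
  define c d where "c = a + s * (b - a)" and "d = a + t * (b - a)"
  have cd: "a < c" "c < d" "d < b"
  proof -
    show "a < c" using ab st by (simp add: c_def)
    show "c < d" using ab st by (simp add: c_def d_def)
    have "t * (b - a) < 1 * (b - a)" using ab st by (intro mult_strict_right_mono) auto
    thus "d < b" by (simp add: d_def)
  qed
  \<comment> \<open>The intermediate value theorem is applied strictly inside the interval, as g may
    vanish at its ends; in the application these are roots.\<close>
  have same: "0 < g y \<longleftrightarrow> 0 < g z" if yz: "a < y" "y < z" "z < b" for y z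
  proof (rule ccontr)
    assume "(0 < g y) \<noteq> (0 < g z)"
    moreover have "g y \<noteq> 0" "g z \<noteq> 0" using nz yz by auto
    moreover have c: "continuous_on {y..z} g" using g yz by (auto intro: continuous_on_subset)
    ultimately have "\<exists>w\<ge>y. w \<le> z \<and> g w = 0"
      using IVT'[of g y 0 z] IVT2'[of g z 0 y] yz by (cases "0 < g y") (auto simp: not_less)
    thus False using nz yz by force
  qed
  \<comment> \<open>Mean value points of the three pieces. Since g has one sign at all of them, the
    three increments of G have the same sign.\<close>
  obtain z1 where z1: "a < z1" "z1 < c" "G c - G a = (c - a) * g z1" using mvt[of a c] cd by auto
  obtain z2 where z2: "c < z2" "z2 < d" "G d - G c = (d - c) * g z2" using mvt[of c d] cd by auto
  obtain z3 where z3: "d < z3" "z3 < b" "G b - G d = (b - d) * g z3" using mvt[of d b] cd by auto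
  have "M \<le> \<bar>g z2\<bar>"
    using M[of "(z2 - a) / (b - a)"] z2 ab unfolding param by (simp add: c_def d_def pos_le_divide_eq pos_divide_le_eq)
  hence "(d - c) * M \<le> \<bar>G d - G c\<bar>" using z2 cd by (simp add: abs_mult)
  moreover have "\<bar>G d - G c\<bar> \<le> \<bar>G b - G a\<bar>"
  proof (cases "0 < g z2")
    case True
    hence "0 < g z1" "0 < g z3" using same[of z1 z2] same[of z2 z3] z1 z2 z3 cd by auto
    hence "G c - G a \<ge> 0" "G d - G c \<ge> 0" "G b - G d \<ge> 0" using z1 z2 z3 cd True by auto
    thus ?thesis by linarith
  next
    case False
    have "g z1 \<le> 0" "g z2 \<le> 0" "g z3 \<le> 0" using same[of z1 z2] same[of z2 z3] z1 z2 z3 cd False by auto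
    hence "G c - G a \<le> 0" "G d - G c \<le> 0" "G b - G d \<le> 0"
      using z1 z2 z3 cd by (auto intro: mult_nonneg_nonpos)
    thus ?thesis by linarith
  qed
  moreover have "d - c = (t - s) * (b - a)" by (simp add: c_def d_def algebra_simps)
  ultimately show "(t - s) * (b - a) * M \<le> \<bar>G b - G a\<bar>" by simp
qed

lemma sum_mset_ereal: "ereal (\<Sum>\<gamma>\<in>#\<Gamma>. m \<gamma>) = (\<Sum>\<gamma>\<in>#\<Gamma>. ereal (m \<gamma>))"
  by (induction \<Gamma>) (auto simp flip: plus_ereal.simps(1))

text \<open>The upper bound on the increment uses the whole interval between the roots and the lower
  bound only the proportions in [s, t], but both carry the same power of x. This fixes the valuation
  without computing the initial coefficient.\<close>

lemma valuation_primitive_increment: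
  assumes \<Gamma>: "newton_puiseux_roots f \<Gamma>" and f: "f \<in> convergent_fps2"
    and F: "F \<in> convergent_fps2" "fps_deriv F = f"
    and \<xi>: "complex_puiseux \<xi> \<in># \<Gamma>" "complex_puiseux \<xi>' \<in># \<Gamma>" "\<xi> < \<xi>'"
    and consecutive: "\<And>\<eta>. complex_puiseux \<eta> \<in># \<Gamma> \<Longrightarrow> \<eta> \<le> \<xi> \<or> \<xi>' \<le> \<eta>"
  shows "valuation (subst_puiseux F \<xi>' - subst_puiseux F \<xi>) = valuation (\<xi>' - \<xi>) +
    (\<Sum>\<gamma>\<in>#\<Gamma>. min (valuation (\<xi>' - \<xi>)) (valuation (complex_puiseux \<xi> - \<gamma>)))"
proof -
  note c1 = newton_puiseux_real_rootD[OF \<Gamma> \<xi>(1)] and c2 = newton_puiseux_real_rootD[OF \<Gamma> \<xi>(2)]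
  have conv: "\<gamma> \<in> convergent_puiseux" if "\<gamma> \<in># \<Gamma>" for \<gamma>
    using \<Gamma> that by (auto simp: newton_puiseux_roots_def)
  define D where "D = \<xi>' - \<xi>"
  have D: "D \<in> convergent_puiseux" "D \<noteq> 0" "initial_coeff D > 0"
    using c1 c2 \<xi>(3) convergent_puiseux_diff(1) initial_coeff_0_iff[of "0 :: real puiseux"] by (auto simp: D_def less_puiseux_def)
  define \<sigma> where "\<sigma> = real_of_ereal (valuation D)"
  have \<sigma>: "valuation D = ereal \<sigma>" using valuation_finite[OF D(2)] by (simp add: \<sigma>_def ereal_real')
  define \<delta> where "\<delta> = (\<lambda>\<gamma>. complex_puiseux \<xi> - \<gamma>)"
  \<comment> \<open>Finite even for the factor of \<xi> itself, whose contact with \<xi> is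
    infinite, because \<open>valuation D\<close> is finite.\<close>
  define m where "m = (\<lambda>\<gamma>. real_of_ereal (min (valuation D) (valuation (\<delta> \<gamma>))))"
  have m: "ereal (m \<gamma>) = min (valuation D) (valuation (\<delta> \<gamma>))" for \<gamma>
    unfolding m_def using valuation_nonneg[of "\<delta> \<gamma>"] \<sigma> by (cases "valuation (\<delta> \<gamma>)") (auto simp: min_def)
  define M where "M = (\<Sum>\<gamma>\<in>#\<Gamma>. m \<gamma>)"
  define a b where "a = puiseux_value \<xi>" and "b = puiseux_value \<xi>'"
  define d where "d = (\<lambda>x. puiseux_value D x)"
  define p where "p = (\<lambda>\<gamma> x. puiseux_value (\<delta> \<gamma>) x)"
  have pos: "\<forall>\<^sub>F x::real in at_right 0. 0 < x" by (auto simp: eventually_at_filter)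
  have \<delta>conv: "\<delta> \<gamma> \<in> convergent_puiseux" if "\<gamma> \<in># \<Gamma>" for \<gamma>
    using that conv c1 by (auto simp: \<delta>_def intro!: convergent_puiseux_diff)
  have "\<exists>\<alpha> \<beta>. ((\<lambda>x. p \<gamma> x / of_real (x powr m \<gamma>)) \<longlongrightarrow> \<alpha>) (at_right 0) \<and>
      ((\<lambda>x. d x / x powr m \<gamma>) \<longlongrightarrow> \<beta>) (at_right 0) \<and> (\<alpha> \<noteq> 0 \<or> \<beta> \<noteq> 0)" if \<gamma>: "\<gamma> \<in># \<Gamma>" for \<gamma>
  proof -
    \<comment> \<open>The minimum is attained by one of the two valuations, so at least one of the
      rescaled limits \<alpha>, \<beta> is non-zero.\<close>
    have "ereal (m \<gamma>) \<le> valuation (\<delta> \<gamma>)" "ereal (m \<gamma>) \<le> valuation D" unfolding m by auto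
    moreover have "valuation (\<delta> \<gamma>) = ereal (m \<gamma>) \<or> valuation D = ereal (m \<gamma>)" unfolding m by (auto simp: min_def)
    ultimately show ?thesis
      using puiseux_value_limit[OF \<delta>conv[OF \<gamma>], of "m \<gamma>"] puiseux_value_limit[OF D(1), of "m \<gamma>"]
      unfolding p_def d_def by (auto 0 4)
  qed
  hence "\<forall>\<gamma>\<in>set_mset \<Gamma>. \<exists>\<alpha> \<beta>. ((\<lambda>x. p \<gamma> x / of_real (x powr m \<gamma>)) \<longlongrightarrow> \<alpha>) (at_right 0) \<and>
      ((\<lambda>x. d x / x powr m \<gamma>) \<longlongrightarrow> \<beta>) (at_right 0) \<and> (\<alpha> \<noteq> 0 \<or> \<beta> \<noteq> 0)" by (rule ballI)
  from bchoice[OF this] obtain \<alpha> where "\<forall>\<gamma>\<in>set_mset \<Gamma>. \<exists>\<beta>. ((\<lambda>x. p \<gamma> x / of_real (x powr m \<gamma>)) \<longlongrightarrow> \<alpha> \<gamma>) (at_right 0) \<and>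
      ((\<lambda>x. d x / x powr m \<gamma>) \<longlongrightarrow> \<beta>) (at_right 0) \<and> (\<alpha> \<gamma> \<noteq> 0 \<or> \<beta> \<noteq> 0)" ..
  from bchoice[OF this] obtain \<beta> where *: "\<forall>\<gamma>\<in>set_mset \<Gamma>. ((\<lambda>x. p \<gamma> x / of_real (x powr m \<gamma>)) \<longlongrightarrow> \<alpha> \<gamma>) (at_right 0) \<and>
      ((\<lambda>x. d x / x powr m \<gamma>) \<longlongrightarrow> \<beta> \<gamma>) (at_right 0) \<and> (\<alpha> \<gamma> \<noteq> 0 \<or> \<beta> \<gamma> \<noteq> 0)" ..
  note \<alpha>\<beta> = *[THEN bspec, THEN conjunct1] *[THEN bspec, THEN conjunct2, THEN conjunct1]
    *[THEN bspec, THEN conjunct2, THEN conjunct2]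
  \<comment> \<open>The exceptional proportions: a non-zero affine function \<alpha> + t \<beta>
    with real \<beta> has at most one real zero.\<close>
  define B where "B = (\<Union>\<gamma>\<in>set_mset \<Gamma>. {t. \<alpha> \<gamma> + of_real (t * \<beta> \<gamma>) = 0})"
  have "finite {t. \<alpha> \<gamma> + of_real (t * \<beta> \<gamma>) = 0}" if \<gamma>: "\<gamma> \<in># \<Gamma>" for \<gamma>
  proof (rule finite_subset)
    show "{t. \<alpha> \<gamma> + of_real (t * \<beta> \<gamma>) = 0} \<subseteq> {- Re (\<alpha> \<gamma>) / \<beta> \<gamma>}"
    proof
      fix u assume "u \<in> {t. \<alpha> \<gamma> + of_real (t * \<beta> \<gamma>) = 0}"
      hence u: "\<alpha> \<gamma> = of_real (- (u * \<beta> \<gamma>))" by (simp add: add_eq_0_iff2)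
      hence "\<beta> \<gamma> \<noteq> 0" using \<alpha>\<beta>(3)[OF \<gamma>] by auto
      thus "u \<in> {- Re (\<alpha> \<gamma>) / \<beta> \<gamma>}" by (simp add: u)
    qed
  qed simp
  hence "finite B" by (simp add: B_def)
  then obtain s t where st: "0 < s" "s < t" "t < 1" "{s..t} \<inter> B = {}"
    using exists_interval_avoiding_finite by blast
  have "\<exists>C. \<forall>\<^sub>F x in at_right 0. \<forall>t\<in>{0..1}. cmod (\<Prod>\<gamma>\<in>#\<Gamma>. p \<gamma> x + of_real (t * d x)) \<le> C * x powr M"
    unfolding M_def by (rule prod_mset_upper) (rule linear_factor_upper[OF \<alpha>\<beta>(1,2)])
  then obtain C where C: "\<forall>\<^sub>F x in at_right 0. \<forall>t\<in>{0..1}. cmod (\<Prod>\<gamma>\<in>#\<Gamma>. p \<gamma> x + of_real (t * d x)) \<le> C * x powr M"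
    by blast
  have "\<exists>c>0. \<forall>\<^sub>F x in at_right 0. \<forall>t\<in>{s..t}. c * x powr M \<le> cmod (\<Prod>\<gamma>\<in>#\<Gamma>. p \<gamma> x + of_real (t * d x))"
    unfolding M_def
  proof (rule prod_mset_lower, rule linear_factor_lower)
    fix \<gamma> assume "\<gamma> \<in># \<Gamma>"
    thus "\<forall>t\<in>{s..t}. \<alpha> \<gamma> + of_real (t * \<beta> \<gamma>) \<noteq> 0" using st(4) by (auto simp: B_def)
  qed (use st \<alpha>\<beta> in auto)
  then obtain c where c: "c > 0"
    "\<forall>\<^sub>F x in at_right 0. \<forall>t\<in>{s..t}. c * x powr M \<le> cmod (\<Prod>\<gamma>\<in>#\<Gamma>. p \<gamma> x + of_real (t * d x))" by blast
  obtain r cu Cu where r: "r > 0" "cu > 0" and fact: "\<forall>\<^sub>F x in at_right 0. \<forall>y. \<bar>y\<bar> \<le> r \<longrightarrow>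
    (\<exists>w. cu \<le> \<bar>w\<bar> \<and> \<bar>w\<bar> \<le> Cu \<and>
       complex_of_real (eval_fps2 f x y) = of_real w * (\<Prod>\<gamma>\<in>#\<Gamma>. of_real y - puiseux_value \<gamma> x))"
    using newton_puiseux_factorization[OF \<Gamma> f] by blast
  obtain r' where r': "r' > 0" and Z: "\<forall>\<^sub>F x in at_right 0. \<forall>y. \<bar>y\<bar> \<le> r' \<longrightarrow>
      eval_fps2 f x y = 0 \<longleftrightarrow> (\<exists>\<xi>. complex_puiseux \<xi> \<in># \<Gamma> \<and> puiseux_value \<xi> x = y)"
    using newton_puiseux_zero_set[OF \<Gamma> f] by blast
  obtain r1 r2 where r12: "r1 > 0" "fps2_abs f r1" "r2 > 0" "fps2_abs F r2"
    using f F by (auto simp: convergent_fps2_iff)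
  define \<rho> where "\<rho> = min r1 r2"
  have \<rho>: "\<rho> > 0" "fps2_abs f \<rho>" "fps2_abs F \<rho>"
    using r12 by (auto simp: \<rho>_def intro: fps2_abs_mono)
  \<comment> \<open>A box on which the factorisation and the description of the zeros both hold,
    strictly inside the region of convergence so that F can be differentiated in y.\<close>
  define R where "R = min (min r r') (\<rho> / 2)"
  have R: "R > 0" "R \<le> r" "R \<le> r'" "R < \<rho>" using r r' \<rho> by (auto simp: R_def)
  have small: "\<forall>\<^sub>F x::real in at_right 0. x < \<rho>" using \<rho> by (intro eventually_at_rightI[of 0 \<rho>]) auto
  \<comment> \<open>Carries the formal consecutiveness of \<xi> and \<xi>' over to values, uniformly
    for the finitely many real roots; it will exclude zeros of f(x, -) between them.\<close>
  have order: "\<forall>\<^sub>F x in at_right 0. \<forall>\<eta>\<in>{\<xi>. complex_puiseux \<xi> \<in># \<Gamma>}. puiseux_value \<eta> x \<le> a x \<or> b x \<le> puiseux_value \<eta> x"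
  proof (intro eventually_ball_finite finite_real_newton_puiseux_roots ballI)
    fix \<eta> assume "\<eta> \<in> {\<xi>. complex_puiseux \<xi> \<in># \<Gamma>}"
    hence \<eta>: "complex_puiseux \<eta> \<in># \<Gamma>" by simp
    have *: "\<forall>\<^sub>F x in at_right 0. puiseux_value \<mu> x \<le> puiseux_value \<mu>' x"
      if "\<mu> \<le> \<mu>'" "\<mu> \<in> convergent_puiseux" "\<mu>' \<in> convergent_puiseux" for \<mu> \<mu>' :: "real puiseux"
    proof (cases "\<mu> = \<mu>'")
      case False
      hence "\<forall>\<^sub>F x in at_right 0. puiseux_value \<mu> x < puiseux_value \<mu>' x"
        using that by (intro eventually_puiseux_value_less) auto
      thus ?thesis by eventually_elim simp
    qed simp
    show "\<forall>\<^sub>F x in at_right 0. puiseux_value \<eta> x \<le> a x \<or> b x \<le> puiseux_value \<eta> x"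
      using consecutive[OF \<eta>]
    proof
      assume "\<eta> \<le> \<xi>"
      from *[OF this newton_puiseux_real_rootD(1)[OF \<Gamma> \<eta>] c1(1)] show ?thesis
        unfolding a_def by eventually_elim simp
    next
      assume "\<xi>' \<le> \<eta>"
      from *[OF this c2(1) newton_puiseux_real_rootD(1)[OF \<Gamma> \<eta>]] show ?thesis
        unfolding b_def by eventually_elim simp
    qed
  qed
  have less: "\<forall>\<^sub>F x in at_right 0. a x < b x"
    unfolding a_def b_def by (rule eventually_puiseux_value_less[OF c1(1) c2(1) \<xi>(3)])
  have ab: "\<forall>\<^sub>F x in at_right 0. \<bar>a x\<bar> \<le> R" "\<forall>\<^sub>F x in at_right 0. \<bar>b x\<bar> \<le> R"
    unfolding a_def b_def by (rule eventually_puiseux_value_small[OF c1 R(1)] eventually_puiseux_value_small[OF c2 R(1)])+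
  have deq: "\<forall>\<^sub>F x in at_right 0. d x = b x - a x"
    unfolding d_def D_def a_def b_def by (rule convergent_puiseux_diff(2)[OF c2(1) c1(1)])
  have peq: "\<forall>\<^sub>F x in at_right 0. \<forall>\<gamma>\<in>set_mset \<Gamma>. p \<gamma> x = of_real (a x) - puiseux_value \<gamma> x"
  proof (intro eventually_ball_finite ballI)
    fix \<gamma> assume \<gamma>: "\<gamma> \<in># \<Gamma>"
    have "\<forall>\<^sub>F x in at_right 0. puiseux_value (\<delta> \<gamma>) x = puiseux_value (complex_puiseux \<xi>) x - puiseux_value \<gamma> x"
      unfolding \<delta>_def using conv[OF \<gamma>] c1(1) by (intro convergent_puiseux_diff(2)) auto
    thus "\<forall>\<^sub>F x in at_right 0. p \<gamma> x = of_real (a x) - puiseux_value \<gamma> x"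
      using eventually_puiseux_abs[OF c1(1)] by eventually_elim (simp add: p_def a_def puiseux_value_complex)
  qed simp
  define S where "S = subst_puiseux F \<xi>' - subst_puiseux F \<xi>"
  have S: "S \<in> convergent_puiseux"
    unfolding S_def by (intro convergent_puiseux_diff subst_puiseux_convergent F c1 c2)
  have Seq: "\<forall>\<^sub>F x in at_right 0. puiseux_value S x = eval_fps2 F x (b x) - eval_fps2 F x (a x)"
    using convergent_puiseux_diff(2)[OF subst_puiseux_convergent[OF F(1) c2] subst_puiseux_convergent[OF F(1) c1]]
      eventually_puiseux_value_subst[OF F(1) c1] eventually_puiseux_value_subst[OF F(1) c2]
    unfolding S_def a_def b_def by eventually_elim simp
  have dlim: "((\<lambda>x. d x / x powr \<sigma>) \<longlongrightarrow> initial_coeff D) (at_right 0)"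
    using puiseux_value_asymp[OF D(1,2)] by (simp add: d_def \<sigma>_def)
  \<comment> \<open>The rescaled gap tends to the positive number \<open>initial_coeff D\<close>, so
    half and twice this limit bracket it for small x.\<close>
  have d1: "\<forall>\<^sub>F x in at_right 0. initial_coeff D / 2 < d x / x powr \<sigma>"
    using order_tendstoD(1)[OF dlim, of "initial_coeff D / 2"] D(3) by simp
  have d2: "\<forall>\<^sub>F x in at_right 0. d x / x powr \<sigma> < 2 * initial_coeff D"
    using order_tendstoD(2)[OF dlim, of "2 * initial_coeff D"] D(3) by simp
  have bounds: "\<forall>\<^sub>F x in at_right 0.
    (t - s) * (initial_coeff D / 2) * (cu * c) * x powr (\<sigma> + M) \<le> \<bar>puiseux_value S x\<bar> \<and>
    \<bar>puiseux_value S x\<bar> \<le> (2 * initial_coeff D) * (Cu * C) * x powr (\<sigma> + M)"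
    using pos small order less ab deq peq Seq d1 d2 C c(2) fact Z
  proof eventually_elim
    case (elim x)
    let ?g = "\<lambda>y. eval_fps2 f x y" and ?G = "\<lambda>y. eval_fps2 F x y"
    have x: "\<bar>x\<bar> \<le> \<rho>" "x > 0" using elim by auto
    have in_R: "\<bar>y\<bar> \<le> R" "\<bar>y\<bar> < \<rho>" "\<bar>y\<bar> \<le> \<rho>" if "a x \<le> y" "y \<le> b x" for y
      using that elim(5,6) R(4) by auto
    have rad: "ereal \<rho> \<le> fps_conv_radius (slice f x)" "ereal \<rho> \<le> fps_conv_radius (slice F x)"
      using fps_conv_radius_slice \<rho> x by auto
    have g: "continuous_on {a x..b x} ?g"
    proof -
      have "{a x..b x} \<subseteq> eball 0 (fps_conv_radius (slice f x))"
      proof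
        fix y assume "y \<in> {a x..b x}"
        hence "ereal \<bar>y\<bar> < ereal \<rho>" using in_R by auto
        also note rad(1)
        finally show "y \<in> eball 0 (fps_conv_radius (slice f x))" by (simp add: in_eball_iff)
      qed
      hence "continuous_on {a x..b x} (eval_fps (slice f x))"
        by (rule continuous_on_subset[OF continuous_on_eval_fps])
      thus ?thesis
        by (rule continuous_on_eq) (use in_R \<rho> x in \<open>auto simp: eval_fps2_eq_slice\<close>)
    qed
    have G: "(?G has_real_derivative ?g y) (at y)" if y: "a x \<le> y" "y \<le> b x" for y
    proof -
      have "ereal \<bar>y\<bar> < ereal \<rho>" using in_R[OF y] by simp
      also note rad(2)
      finally have "ereal (norm y) < fps_conv_radius (slice F x)" by simp
      from has_field_derivative_eval_fps[OF this, of UNIV]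
      have "(eval_fps (slice F x) has_real_derivative ?g y) (at y)"
        using in_R[OF y] \<rho> x by (simp add: eval_fps2_eq_slice F(2)[symmetric] slice_deriv)
      \<comment> \<open>\<open>eval_fps2\<close> is known to agree with the slice only inside the
        box, so the derivative is transferred through a neighbourhood of y.\<close>
      moreover have "\<forall>\<^sub>F z in nhds y. eval_fps (slice F x) z = ?G z"
      proof -
        have "\<forall>\<^sub>F z in nhds y. z \<in> {- \<rho><..<\<rho>}"
          using in_R[OF y] by (intro eventually_nhds_in_open) auto
        thus ?thesis by eventually_elim (use \<rho> x in \<open>auto simp: eval_fps2_eq_slice\<close>)
      qed
      ultimately show ?thesis using DERIV_cong_ev[OF refl _ refl, of "eval_fps (slice F x)" ?G y] by blast
    qed
    have nz: "?g y \<noteq> 0" if y: "a x < y" "y < b x" for y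
    proof
      assume "?g y = 0"
      moreover have "\<bar>y\<bar> \<le> r'" using in_R[of y] y R by auto
      ultimately obtain \<eta> where "complex_puiseux \<eta> \<in># \<Gamma>" "puiseux_value \<eta> x = y"
        using elim(15) by blast
      thus False using elim(3) y by fastforce
    qed
    have factor: "\<exists>w. cu \<le> \<bar>w\<bar> \<and> \<bar>w\<bar> \<le> Cu \<and> \<bar>?g (a x + \<tau> * (b x - a x))\<bar> =
       \<bar>w\<bar> * cmod (\<Prod>\<gamma>\<in>#\<Gamma>. p \<gamma> x + of_real (\<tau> * d x))" if \<tau>: "\<tau> \<in> {0..1}" for \<tau>
    proof -
      let ?y = "a x + \<tau> * (b x - a x)"
      have "0 \<le> \<tau> * (b x - a x)" "\<tau> * (b x - a x) \<le> 1 * (b x - a x)"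
        using \<tau> elim(4) by (auto intro!: mult_right_mono simp del: mult_1)
      hence "\<bar>?y\<bar> \<le> r" using in_R[of ?y] R(2) by auto
      then obtain w where w: "cu \<le> \<bar>w\<bar>" "\<bar>w\<bar> \<le> Cu"
        "complex_of_real (?g ?y) = of_real w * (\<Prod>\<gamma>\<in>#\<Gamma>. of_real ?y - puiseux_value \<gamma> x)"
        using elim(14) by blast
      \<comment> \<open>At this y the factor y - \<gamma>(x) is (a - \<gamma>)(x) plus the
        proportion \<tau> of the gap, which is the form estimated above.\<close>
      have "(\<Prod>\<gamma>\<in>#\<Gamma>. of_real ?y - puiseux_value \<gamma> x) = (\<Prod>\<gamma>\<in>#\<Gamma>. p \<gamma> x + of_real (\<tau> * d x))"
        using elim(7,8) by (intro arg_cong[of _ _ prod_mset] image_mset_cong) auto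
      hence "\<bar>?g ?y\<bar> = cmod (of_real w * (\<Prod>\<gamma>\<in>#\<Gamma>. p \<gamma> x + of_real (\<tau> * d x)))"
        using w(3) by (metis norm_of_real)
      thus ?thesis using w by (intro exI[of _ w]) (simp add: norm_mult)
    qed
    have D1: "initial_coeff D / 2 * x powr \<sigma> \<le> b x - a x" "b x - a x \<le> 2 * initial_coeff D * x powr \<sigma>"
      using elim(7,10,11) x by (auto simp: field_simps)
    have "\<bar>?G (b x) - ?G (a x)\<bar> \<le> (b x - a x) * (Cu * (C * x powr M))"
    proof (rule increment_upper[OF elim(4) G g nz])
      fix \<tau> :: real assume \<tau>: "\<tau> \<in> {0..1}"
      obtain w where w: "\<bar>w\<bar> \<le> Cu" "\<bar>?g (a x + \<tau> * (b x - a x))\<bar> = \<bar>w\<bar> * cmod (\<Prod>\<gamma>\<in>#\<Gamma>. p \<gamma> x + of_real (\<tau> * d x))"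
        using factor[OF \<tau>] by blast
      show "\<bar>?g (a x + \<tau> * (b x - a x))\<bar> \<le> Cu * (C * x powr M)"
        unfolding w(2) using elim(12) \<tau> w(1) by (intro mult_mono) auto
    qed
    also have "\<dots> \<le> (2 * initial_coeff D * x powr \<sigma>) * (Cu * (C * x powr M))"
    proof (rule mult_right_mono[OF D1(2)])
      obtain w where w: "\<bar>w\<bar> \<le> Cu" using factor[of 0] by auto
      have "0 \<le> C * x powr M" using order_trans[OF norm_ge_zero elim(12)[rule_format, of 0]] by simp
      thus "0 \<le> Cu * (C * x powr M)" using order_trans[OF abs_ge_zero w] by simp
    qed
    finally have up: "\<bar>?G (b x) - ?G (a x)\<bar> \<le> (2 * initial_coeff D * x powr \<sigma>) * (Cu * (C * x powr M))" .
    have "(t - s) * (initial_coeff D / 2 * x powr \<sigma>) * (cu * (c * x powr M)) \<le> (t - s) * (b x - a x) * (cu * (c * x powr M))"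
      using D1(1) st r(2) c(1) by (intro mult_right_mono mult_left_mono) auto
    also have "\<dots> \<le> \<bar>?G (b x) - ?G (a x)\<bar>"
    proof (rule increment_lower[OF elim(4) G g nz st(1-3)])
      fix \<tau> assume \<tau>: "\<tau> \<in> {s..t}"
      hence "\<tau> \<in> {0..1}" using st by auto
      then obtain w where w: "cu \<le> \<bar>w\<bar>" "\<bar>?g (a x + \<tau> * (b x - a x))\<bar> = \<bar>w\<bar> * cmod (\<Prod>\<gamma>\<in>#\<Gamma>. p \<gamma> x + of_real (\<tau> * d x))"
        using factor by blast
      show "cu * (c * x powr M) \<le> \<bar>?g (a x + \<tau> * (b x - a x))\<bar>"
        unfolding w(2) using elim(13) \<tau> w(1) r(2) c(1) by (intro mult_mono) auto
    qed
    finally have lo: "(t - s) * (initial_coeff D / 2 * x powr \<sigma>) * (cu * (c * x powr M)) \<le> \<bar>?G (b x) - ?G (a x)\<bar>" .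
    show ?case using up lo unfolding elim(9) powr_add by (simp add: mult_ac)
  qed
  have "(t - s) * (initial_coeff D / 2) * (cu * c) > 0" using st D(3) r(2) c(1) by simp
  from valuation_eqI_bounds[OF S this bounds]
  have "valuation S = ereal \<sigma> + ereal M" by simp
  also have "ereal M = (\<Sum>\<gamma>\<in>#\<Gamma>. min (valuation D) (valuation (\<delta> \<gamma>)))"
    unfolding M_def sum_mset_ereal m ..
  finally show ?thesis using \<sigma> by (simp add: S_def D_def \<delta>_def)
qed

section \<open>The contact tree\<close>

text \<open>Describing the valuation by its lower bounds reduces symmetry and the ultrametric
  inequality to statements about single coefficients, with the zero series included.\<close>

lemma valuation_ge_iff:
  fixes a :: "'a::comm_ring_1 puiseux"
  shows "t \<le> valuation a \<longleftrightarrow> (\<forall>q. puiseux_coeff a q \<noteq> 0 \<longrightarrow> t \<le> ereal (of_rat q))"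
proof -
  obtain n g where n: "n > 0" "a = puiseux_of_fps n g" using puiseux_of_fps_exists by metis
  show ?thesis
  proof (cases "g = 0")
    case True
    hence "a = 0" by (simp add: n puiseux_of_fps_0)
    thus ?thesis by (simp add: valuation_def zero_puiseux.rep_eq)
  next
    case False
    have v: "valuation a = ereal (real (subdegree g) / real n)"
      using False n by (simp add: valuation_puiseux_of_fps)
    have "valuation a \<le> ereal (of_rat q)" if q: "puiseux_coeff a q \<noteq> 0" for q
    proof -
      obtain k where k: "q = of_nat k / of_nat n" using q coeff_puiseux_of_fps_0 unfolding n by metis
      hence "g $ k \<noteq> 0" using q n by (simp add: coeff_puiseux_of_fps)
      hence "subdegree g \<le> k" by (rule subdegree_leI)
      thus ?thesis using n(1) by (simp add: v k of_rat_divide divide_right_mono)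
    qed
    moreover have "puiseux_coeff a (of_nat (subdegree g) / of_nat n) \<noteq> 0"
      using False n by (simp add: coeff_puiseux_of_fps)
    ultimately show ?thesis
      by (auto intro: order_trans simp: v of_rat_divide
          dest!: spec[of _ "of_nat (subdegree g) / of_nat n"])
  qed
qed

lemma valuation_0 [simp]: "valuation 0 = \<infinity>"
  by (simp add: valuation_def)

lemma valuation_minus_commute: "valuation (a - b) = valuation (b - a)"
  for a b :: "'a::comm_ring_1 puiseux"
proof -
  have "t \<le> valuation (a - b) \<longleftrightarrow> t \<le> valuation (b - a)" for t
    unfolding valuation_ge_iff minus_puiseux.rep_eq right_minus_eq by (simp add: eq_commute)
  from this[of "valuation (a - b)"] this[of "valuation (b - a)"] show ?thesis by simp
qed

lemma valuation_ultrametric: "min (valuation (a - b)) (valuation (b - c)) \<le> valuation (a - c)"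
  for a b c :: "'a::comm_ring_1 puiseux"
  unfolding valuation_ge_iff[of _ "a - c"]
proof (intro allI impI)
  fix q assume "puiseux_coeff (a - c) q \<noteq> 0"
  hence "puiseux_coeff (a - b) q \<noteq> 0 \<or> puiseux_coeff (b - c) q \<noteq> 0"
    by (auto simp: minus_puiseux.rep_eq)
  thus "min (valuation (a - b)) (valuation (b - c)) \<le> ereal (of_rat q)"
    using valuation_ge_iff[of "valuation (a - b)" "a - b"] valuation_ge_iff[of "valuation (b - c)" "b - c"]
    by (auto simp: min_le_iff_disj)
qed

text \<open>All exponents of e lie above the leading exponent of d, so the leading term of d
  survives in the sum.\<close>

lemma initial_coeff_add_dominant:
  fixes d e :: "'a::comm_ring_1 puiseux"
  assumes "valuation d < valuation e"
  shows "initial_coeff (d + e) = initial_coeff d" "valuation (d + e) = valuation d"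
proof -
  obtain n g h where n: "n > 0" and eq: "d = puiseux_of_fps n g" "e = puiseux_of_fps n h"
    using puiseux_of_fps_exists2 by metis
  have g: "g \<noteq> 0" using assms by (auto simp: eq puiseux_of_fps_0 valuation_def[of 0])
  have "subdegree (g + h) = subdegree g \<and> (g + h) $ subdegree g = g $ subdegree g"
  proof (cases "h = 0")
    case False
    hence "subdegree g < subdegree h"
      using assms g n by (simp add: eq valuation_puiseux_of_fps divide_less_cancel)
    thus ?thesis using g by (simp add: subdegree_add_eq1 nth_less_subdegree_zero)
  qed simp
  moreover have "g + h \<noteq> 0" using calculation g by (metis fps_zero_nth nth_subdegree_zero_iff)
  ultimately show "initial_coeff (d + e) = initial_coeff d" "valuation (d + e) = valuation d"
    using n g by (simp_all add: eq puiseux_of_fps_add initial_coeff_puiseux_of_fps valuation_puiseux_of_fps)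
qed

text \<open>Changing a and b only beyond the exponent where they separate leaves the leading term of
  b - a alone. Hence two outgoing edges may be compared through any leaves above them.\<close>

lemma less_puiseux_cong:
  fixes a b a' b' :: "'a::linordered_idom puiseux"
  assumes "valuation (a - b) < valuation (a - a')" "valuation (a - b) < valuation (b - b')"
  shows "a' < b' \<longleftrightarrow> a < b"
proof -
  have 1: "valuation ((b - a) + (a - a')) = valuation (b - a)"
    "initial_coeff ((b - a) + (a - a')) = initial_coeff (b - a)"
    using assms(1) by (simp_all only: initial_coeff_add_dominant valuation_minus_commute[of b a])
  have "initial_coeff (((b - a) + (a - a')) + (b' - b)) = initial_coeff (b - a)"
    using assms(2) 1
    by (simp only: initial_coeff_add_dominant valuation_minus_commute[of b a] valuation_minus_commute[of b' b])
  thus ?thesis by (simp add: less_puiseux_def)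
qed

text \<open>The complement of each member is the union of the other open members, so a connected set
  that meets a member stays inside it.\<close>

lemma connected_components_of_open_partition:
  assumes "\<Union>\<C> = topspace Y" and "\<And>C. C \<in> \<C> \<Longrightarrow> C \<noteq> {}"
    and conn: "\<And>C. C \<in> \<C> \<Longrightarrow> connectedin Y C" and opn: "\<And>C. C \<in> \<C> \<Longrightarrow> openin Y C"
    and disj: "\<And>C C'. C \<in> \<C> \<Longrightarrow> C' \<in> \<C> \<Longrightarrow> C \<inter> C' \<noteq> {} \<Longrightarrow> C = C'"
  shows "connected_components_of Y = \<C>"
proof -
  have comp: "connected_component_of_set Y x = C" if C: "C \<in> \<C>" "x \<in> C" for C x
  proof (rule connected_component_of_unique)
    fix D assume D: "x \<in> D \<and> connectedin Y D"
    have o: "openin Y C" "openin Y (\<Union>(\<C> - {C}))" using opn C by auto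
    have int: "C \<inter> \<Union>(\<C> - {C}) = {}" using disj C by blast
    have cover: "D \<subseteq> C \<union> \<Union>(\<C> - {C})"
      using D connectedin_subset_topspace[of Y D] assms(1) by auto
    have "\<Union>(\<C> - {C}) \<inter> D = {}"
      using connectedinD[OF conjunct2[OF D] o cover] int C(2) D by blast
    thus "D \<subseteq> C" using cover by blast
  qed (use C conn in auto)
  show ?thesis
  proof (rule set_eqI)
    fix C show "C \<in> connected_components_of Y \<longleftrightarrow> C \<in> \<C>"
    proof
      assume "C \<in> connected_components_of Y"
      then obtain x where x: "x \<in> topspace Y" "C = connected_component_of_set Y x"
        by (auto simp: connected_components_of_def)
      then obtain C' where "C' \<in> \<C>" "x \<in> C'" using assms(1) by blast
      thus "C \<in> \<C>" using comp x by auto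
    next
      assume C: "C \<in> \<C>"
      then obtain x where "x \<in> C" using assms(2) by blast
      thus "C \<in> connected_components_of Y"
        unfolding connected_components_of_def using comp[OF C] C assms(1) by (intro image_eqI[of _ _ x]) auto
    qed
  qed
qed

section \<open>The contact tree in coordinates: a leaf and a height\<close>

locale contact_set =
  fixes N :: "real puiseux set"
  assumes finite_N: "finite N"
    and valuation_pos: "\<And>\<gamma> \<gamma>'. \<gamma> \<in> N \<Longrightarrow> \<gamma>' \<in> N \<Longrightarrow> 0 < valuation (\<gamma> - \<gamma>')"
begin

abbreviation v :: "real puiseux \<Rightarrow> real puiseux \<Rightarrow> ereal" where "v \<gamma> \<gamma>' \<equiv> valuation (\<gamma> - \<gamma>')"

abbreviation X where "X \<equiv> contact_space N"

abbreviation rt where "rt \<equiv> contact_root N"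

text \<open>Redundant coordinates: the path to the leaf \<gamma> is parametrised by height, and
  \<open>pt_eq_iff\<close> says when two paths share a point.\<close>

definition pt :: "real puiseux \<Rightarrow> ereal \<Rightarrow> (real puiseux \<times> ereal) set" where
  "pt \<gamma> t = contact_point N (\<gamma>, t)"

definition arc :: "real puiseux \<Rightarrow> ereal \<Rightarrow> ereal \<Rightarrow> (real puiseux \<times> ereal) set set" where
  "arc \<gamma> a b = pt \<gamma> ` {a..b}"

lemma v_self: "v \<gamma> \<gamma> = \<infinity>" by simp

lemma v_commute: "v \<gamma> \<gamma>' = v \<gamma>' \<gamma>" by (rule valuation_minus_commute)

lemma v_ultra: "t \<le> v \<gamma> \<gamma>' \<Longrightarrow> t \<le> v \<gamma>' \<gamma>'' \<Longrightarrow> t \<le> v \<gamma> \<gamma>''"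
  using valuation_ultrametric[of \<gamma> \<gamma>' \<gamma>''] by (meson min.bounded_iff order_trans)

lemma v_ultra_less: "t < v \<gamma> \<gamma>' \<Longrightarrow> t < v \<gamma>' \<gamma>'' \<Longrightarrow> t < v \<gamma> \<gamma>''"
  using valuation_ultrametric[of \<gamma> \<gamma>' \<gamma>''] by (meson min_less_iff_conj less_le_trans)

lemma pt_eq: "\<gamma> \<in> N \<Longrightarrow> 0 \<le> t \<Longrightarrow> pt \<gamma> t = {(\<gamma>', t) | \<gamma>'. \<gamma>' \<in> N \<and> t \<le> v \<gamma> \<gamma>'}"
  by (auto simp: pt_def contact_point_def contact_rel_def)

lemma pt_eq_iff:
  assumes "\<gamma> \<in> N" "\<gamma>' \<in> N" "0 \<le> t" "0 \<le> t'"
  shows "pt \<gamma> t = pt \<gamma>' t' \<longleftrightarrow> t = t' \<and> t \<le> v \<gamma> \<gamma>'"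
proof
  assume eq: "pt \<gamma> t = pt \<gamma>' t'"
  have "(\<gamma>', t') \<in> pt \<gamma>' t'" using assms by (simp add: pt_eq)
  thus "t = t' \<and> t \<le> v \<gamma> \<gamma>'" using assms by (simp add: eq[symmetric] pt_eq)
next
  assume "t = t' \<and> t \<le> v \<gamma> \<gamma>'"
  thus "pt \<gamma> t = pt \<gamma>' t'"
    using assms v_ultra[of t \<gamma> \<gamma>'] v_ultra[of t \<gamma>' \<gamma>] v_commute[of \<gamma> \<gamma>'] by (auto simp: pt_eq)
qed

lemma topspace_X: "topspace X = {pt \<gamma> t | \<gamma> t. \<gamma> \<in> N \<and> 0 \<le> t}"
  by (force simp: contact_space_def topspace_quotient_topology pt_def image_iff)

lemma pt_in_X: "\<gamma> \<in> N \<Longrightarrow> 0 \<le> t \<Longrightarrow> pt \<gamma> t \<in> topspace X"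
  by (auto simp: topspace_X)

lemma openin_X_iff:
  "openin X U \<longleftrightarrow> U \<subseteq> topspace X \<and>
     (\<forall>\<gamma>\<in>N. openin (top_of_set {0..\<infinity>}) {t \<in> {0..\<infinity>}. pt \<gamma> t \<in> U})"
proof -
  have "{t. (\<gamma>, t) \<in> {x \<in> Sigma N (\<lambda>_. {0..\<infinity>}). contact_point N x \<in> U}} = {t \<in> {0..\<infinity>}. pt \<gamma> t \<in> U}"
    if "\<gamma> \<in> N" for \<gamma> using that by (auto simp: pt_def)
  thus ?thesis
    unfolding contact_space_def openin_quotient_topology topspace_quotient_topology openin_sum_topology
    by (auto simp: o_def)
qed

lemma openin_XI:
  assumes "U \<subseteq> topspace X" "\<And>\<gamma>. \<gamma> \<in> N \<Longrightarrow> \<exists>V. open V \<and> (\<forall>t\<ge>0. pt \<gamma> t \<in> U \<longleftrightarrow> t \<in> V)"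
  shows "openin X U"
  unfolding openin_X_iff
proof (intro conjI assms ballI)
  fix \<gamma> assume "\<gamma> \<in> N"
  then obtain V where V: "open V" "\<forall>t\<ge>0. pt \<gamma> t \<in> U \<longleftrightarrow> t \<in> V" using assms(2) by blast
  have "{t \<in> {0..\<infinity>}. pt \<gamma> t \<in> U} = {0..\<infinity>} \<inter> V" using V(2) by auto
  thus "openin (top_of_set {0..\<infinity>}) {t \<in> {0..\<infinity>}. pt \<gamma> t \<in> U}"
    using V(1) by (auto simp: openin_open)
qed

lemma continuous_map_pt: "\<gamma> \<in> N \<Longrightarrow> continuous_map (top_of_set {0..\<infinity>}) X (pt \<gamma>)"
  unfolding continuous_map_def using openin_X_iff by (auto simp: pt_in_X)

lemma connectedin_pt_image:
  assumes "\<gamma> \<in> N" "connected S" "S \<subseteq> {0..}"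
  shows "connectedin X (pt \<gamma> ` S)"
proof (rule connectedin_continuous_map_image[OF continuous_map_pt[OF assms(1)]])
  show "connectedin (top_of_set {0..\<infinity>}) S"
    using assms by (auto simp: connectedin_subtopology)
qed

lemma connectedin_arc: "\<gamma> \<in> N \<Longrightarrow> 0 \<le> a \<Longrightarrow> connectedin X (arc \<gamma> a b)"
  unfolding arc_def by (intro connectedin_pt_image) auto

lemma pt_mem_arc:
  assumes "\<gamma> \<in> N" "\<gamma>' \<in> N" "0 \<le> a" "0 \<le> s"
  shows "pt \<gamma>' s \<in> arc \<gamma> a b \<longleftrightarrow> a \<le> s \<and> s \<le> b \<and> s \<le> v \<gamma> \<gamma>'"
proof
  assume "pt \<gamma>' s \<in> arc \<gamma> a b"
  then obtain t where "t \<in> {a..b}" "pt \<gamma>' s = pt \<gamma> t" by (auto simp: arc_def)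
  thus "a \<le> s \<and> s \<le> b \<and> s \<le> v \<gamma> \<gamma>'"
    using pt_eq_iff[of \<gamma>' \<gamma> s t] assms v_commute[of \<gamma> \<gamma>'] by auto
next
  assume *: "a \<le> s \<and> s \<le> b \<and> s \<le> v \<gamma> \<gamma>'"
  hence "pt \<gamma>' s = pt \<gamma> s" using assms v_commute[of \<gamma> \<gamma>'] by (auto simp: pt_eq_iff)
  thus "pt \<gamma>' s \<in> arc \<gamma> a b" using * by (auto simp: arc_def)
qed

lemma arc_subset_X: "\<gamma> \<in> N \<Longrightarrow> 0 \<le> a \<Longrightarrow> arc \<gamma> a b \<subseteq> topspace X"
  by (auto simp: arc_def pt_in_X)

lemma arc_cong:
  assumes "\<gamma> \<in> N" "\<gamma>' \<in> N" "0 \<le> a" "b \<le> v \<gamma> \<gamma>'"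
  shows "arc \<gamma> a b = arc \<gamma>' a b"
  unfolding arc_def
proof (rule image_cong)
  fix s assume s: "s \<in> {a..b}"
  have "0 \<le> s" "s \<le> v \<gamma> \<gamma>'" using s assms by (auto intro: order_trans)
  thus "pt \<gamma> s = pt \<gamma>' s" using assms by (simp add: pt_eq_iff)
qed simp

text \<open>The components of the complement of \<open>pt \<gamma> t\<close> are \<open>down \<gamma> t\<close>, which contains the root, and the
  sets \<open>up \<gamma>' t\<close> for the leaves \<open>\<gamma>'\<close> above the point.\<close>

definition up :: "real puiseux \<Rightarrow> ereal \<Rightarrow> (real puiseux \<times> ereal) set set" where
  "up \<gamma> t = {pt \<gamma>' s | \<gamma>' s. \<gamma>' \<in> N \<and> t < s \<and> t < v \<gamma> \<gamma>'}"

definition down :: "real puiseux \<Rightarrow> ereal \<Rightarrow> (real puiseux \<times> ereal) set set" where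
  "down \<gamma> t = {pt \<gamma>' s | \<gamma>' s. \<gamma>' \<in> N \<and> 0 \<le> s \<and> (s < t \<or> v \<gamma> \<gamma>' < t)}"

lemma pt_mem_up:
  assumes "\<gamma> \<in> N" "\<gamma>' \<in> N" "0 \<le> t" "0 \<le> s"
  shows "pt \<gamma>' s \<in> up \<gamma> t \<longleftrightarrow> t < s \<and> t < v \<gamma> \<gamma>'"
proof
  assume "pt \<gamma>' s \<in> up \<gamma> t"
  then obtain \<gamma>'' u where u: "\<gamma>'' \<in> N" "t < u" "t < v \<gamma> \<gamma>''" "pt \<gamma>' s = pt \<gamma>'' u" by (auto simp: up_def)
  have "0 \<le> u" using u(2) assms by (meson less_imp_le order_trans)
  hence "s = u" "s \<le> v \<gamma>' \<gamma>''" using u assms by (auto simp: pt_eq_iff)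
  thus "t < s \<and> t < v \<gamma> \<gamma>'"
    using u v_ultra_less[of t \<gamma> \<gamma>'' \<gamma>'] v_commute[of \<gamma>' \<gamma>''] by auto
qed (use assms in \<open>auto simp: up_def\<close>)

lemma pt_mem_down:
  assumes "\<gamma> \<in> N" "\<gamma>' \<in> N" "0 \<le> t" "0 \<le> s"
  shows "pt \<gamma>' s \<in> down \<gamma> t \<longleftrightarrow> s < t \<or> v \<gamma> \<gamma>' < t"
proof
  assume "pt \<gamma>' s \<in> down \<gamma> t"
  then obtain \<gamma>'' u where u: "\<gamma>'' \<in> N" "0 \<le> u" "u < t \<or> v \<gamma> \<gamma>'' < t" "pt \<gamma>' s = pt \<gamma>'' u" by (auto simp: down_def)
  hence *: "s = u" "s \<le> v \<gamma>' \<gamma>''" using u assms by (auto simp: pt_eq_iff)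
  show "s < t \<or> v \<gamma> \<gamma>' < t"
  proof (rule ccontr)
    assume "\<not> ?thesis"
    hence "t \<le> s" "t \<le> v \<gamma> \<gamma>'" by auto
    moreover from this have "t \<le> v \<gamma> \<gamma>''" using *(2) v_ultra[of t \<gamma> \<gamma>' \<gamma>''] by auto
    ultimately show False using u(3) * by auto
  qed
qed (use assms in \<open>auto simp: down_def\<close>)

lemma up_subset_X: "0 \<le> t \<Longrightarrow> up \<gamma> t \<subseteq> topspace X"
  unfolding up_def topspace_X by (blast intro: less_imp_le le_less_trans)

lemma down_subset_X: "down \<gamma> t \<subseteq> topspace X"
  by (auto simp: down_def topspace_X)

lemma openin_up:
  assumes "\<gamma> \<in> N" "0 \<le> t"
  shows "openin X (up \<gamma> t)"
proof (rule openin_XI)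
  fix \<gamma>' assume "\<gamma>' \<in> N"
  thus "\<exists>V. open V \<and> (\<forall>s\<ge>0. pt \<gamma>' s \<in> up \<gamma> t \<longleftrightarrow> s \<in> V)"
    using assms by (intro exI[of _ "if t < v \<gamma> \<gamma>' then {t<..} else {}"]) (auto simp: pt_mem_up)
qed (use up_subset_X assms in auto)

lemma openin_down:
  assumes "\<gamma> \<in> N" "0 \<le> t"
  shows "openin X (down \<gamma> t)"
proof (rule openin_XI)
  fix \<gamma>' assume "\<gamma>' \<in> N"
  thus "\<exists>V. open V \<and> (\<forall>s\<ge>0. pt \<gamma>' s \<in> down \<gamma> t \<longleftrightarrow> s \<in> V)"
    using assms by (intro exI[of _ "if v \<gamma> \<gamma>' < t then UNIV else {..<t}"]) (auto simp: pt_mem_down)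
qed (use down_subset_X in auto)

text \<open>Another point either lies below the given one or on a path that branches off earlier,
  which is \<open>down\<close>, or it is reached by passing through the given point and going
  higher.\<close>

lemma complement_pt:
  assumes "\<gamma> \<in> N" "0 \<le> t"
  shows "topspace X - {pt \<gamma> t} = down \<gamma> t \<union> (\<Union>\<gamma>'\<in>{\<gamma>'\<in>N. t \<le> v \<gamma> \<gamma>'}. up \<gamma>' t)"
    and "down \<gamma> t \<inter> (\<Union>\<gamma>'\<in>{\<gamma>'\<in>N. t \<le> v \<gamma> \<gamma>'}. up \<gamma>' t) = {}"
proof -
  have up: "pt \<gamma>'' s \<in> (\<Union>\<gamma>'\<in>{\<gamma>'\<in>N. t \<le> v \<gamma> \<gamma>'}. up \<gamma>' t) \<longleftrightarrow> t < s \<and> t \<le> v \<gamma> \<gamma>''"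
    if "\<gamma>'' \<in> N" "0 \<le> s" for \<gamma>'' s
  proof
    assume "pt \<gamma>'' s \<in> (\<Union>\<gamma>'\<in>{\<gamma>'\<in>N. t \<le> v \<gamma> \<gamma>'}. up \<gamma>' t)"
    then obtain \<gamma>' where "\<gamma>' \<in> N" "t \<le> v \<gamma> \<gamma>'" "pt \<gamma>'' s \<in> up \<gamma>' t" by blast
    thus "t < s \<and> t \<le> v \<gamma> \<gamma>''"
      using that assms v_ultra[of t \<gamma> \<gamma>' \<gamma>''] by (auto simp: pt_mem_up)
  next
    assume "t < s \<and> t \<le> v \<gamma> \<gamma>''"
    thus "pt \<gamma>'' s \<in> (\<Union>\<gamma>'\<in>{\<gamma>'\<in>N. t \<le> v \<gamma> \<gamma>'}. up \<gamma>' t)"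
      using that assms by (intro UN_I[of \<gamma>'']) (auto simp: pt_mem_up)
  qed
  have sub: "(\<Union>\<gamma>'\<in>{\<gamma>'\<in>N. t \<le> v \<gamma> \<gamma>'}. up \<gamma>' t) \<subseteq> topspace X" "down \<gamma> t \<subseteq> topspace X"
    using up_subset_X[OF assms(2)] down_subset_X by auto
  have mem: "pt \<gamma>'' s \<in> topspace X - {pt \<gamma> t} \<longleftrightarrow>
      pt \<gamma>'' s \<in> down \<gamma> t \<union> (\<Union>\<gamma>'\<in>{\<gamma>'\<in>N. t \<le> v \<gamma> \<gamma>'}. up \<gamma>' t)" if "\<gamma>'' \<in> N" "0 \<le> s" for \<gamma>'' s
    using that assms up[OF that] pt_in_X[OF that] v_commute[of \<gamma> \<gamma>'']
    by (auto simp: pt_eq_iff pt_mem_down)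
  show "topspace X - {pt \<gamma> t} = down \<gamma> t \<union> (\<Union>\<gamma>'\<in>{\<gamma>'\<in>N. t \<le> v \<gamma> \<gamma>'}. up \<gamma>' t)"
  proof (rule set_eqI)
    fix P show "P \<in> topspace X - {pt \<gamma> t} \<longleftrightarrow> P \<in> down \<gamma> t \<union> (\<Union>\<gamma>'\<in>{\<gamma>'\<in>N. t \<le> v \<gamma> \<gamma>'}. up \<gamma>' t)"
    proof (cases "P \<in> topspace X")
      case True
      then obtain \<gamma>'' s where "P = pt \<gamma>'' s" "\<gamma>'' \<in> N" "0 \<le> s" unfolding topspace_X by blast
      thus ?thesis using mem[of \<gamma>'' s] by simp
    qed (use sub in blast)
  qed
  show "down \<gamma> t \<inter> (\<Union>\<gamma>'\<in>{\<gamma>'\<in>N. t \<le> v \<gamma> \<gamma>'}. up \<gamma>' t) = {}"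
  proof (rule ccontr)
    assume "\<not> ?thesis"
    then obtain P where P: "P \<in> down \<gamma> t" "P \<in> (\<Union>\<gamma>'\<in>{\<gamma>'\<in>N. t \<le> v \<gamma> \<gamma>'}. up \<gamma>' t)" by blast
    hence "P \<in> topspace X" using sub by blast
    then obtain \<gamma>'' s where "P = pt \<gamma>'' s" "\<gamma>'' \<in> N" "0 \<le> s" unfolding topspace_X by blast
    thus False using P up[of \<gamma>'' s] assms by (auto simp: pt_mem_down)
  qed
qed

text \<open>Removing an intermediate point puts the two ends into disjoint open sets,
  \<open>down\<close> and the union of the sets \<open>up\<close>. So every connected set containing
  both ends contains the whole arc.\<close>

lemma segment_eq_arc:
  assumes "\<gamma> \<in> N" "0 \<le> a" "a \<le> b"
  shows "segment X (pt \<gamma> a) (pt \<gamma> b) = arc \<gamma> a b"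
proof (rule subset_antisym)
  have "pt \<gamma> a \<in> arc \<gamma> a b" "pt \<gamma> b \<in> arc \<gamma> a b" using assms by (auto simp: arc_def)
  thus "segment X (pt \<gamma> a) (pt \<gamma> b) \<subseteq> arc \<gamma> a b"
    unfolding segment_def using connectedin_arc[of \<gamma> a b] assms by blast
  show "arc \<gamma> a b \<subseteq> segment X (pt \<gamma> a) (pt \<gamma> b)"
    unfolding segment_def
  proof (intro Inter_greatest subsetI)
    fix C P assume C: "C \<in> {C. connectedin X C \<and> pt \<gamma> a \<in> C \<and> pt \<gamma> b \<in> C}" and P: "P \<in> arc \<gamma> a b"
    then obtain s where s: "P = pt \<gamma> s" "a \<le> s" "s \<le> b" by (auto simp: arc_def)
    show "P \<in> C"
    proof (rule ccontr)
      assume nP: "P \<notin> C"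
      hence ne: "s \<noteq> a" "s \<noteq> b" using C s by auto
      have s0: "0 \<le> s" "0 \<le> b" using s assms by auto
      let ?U = "\<Union>\<gamma>'\<in>{\<gamma>'\<in>N. s \<le> v \<gamma> \<gamma>'}. up \<gamma>' s"
      note cp = complement_pt[OF assms(1) s0(1)]
      have sub: "C \<subseteq> down \<gamma> s \<union> ?U" using C nP s cp(1) connectedin_subset_topspace[of X C] by blast
      have opn: "openin X (down \<gamma> s)" "openin X ?U" using openin_down openin_up assms s0 by auto
      have a: "pt \<gamma> a \<in> down \<gamma> s" using assms s ne s0 by (auto simp: pt_mem_down)
      have "pt \<gamma> b \<in> up \<gamma> s" using assms s ne s0 by (subst pt_mem_up) auto
      hence b: "pt \<gamma> b \<in> ?U" using assms by auto
      have C': "connectedin X C" "pt \<gamma> a \<in> C" "pt \<gamma> b \<in> C" using C by auto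
      show False using connectedinD[OF C'(1) opn sub] cp(2) a b C'(2,3) by blast
    qed
  qed
qed

lemma root_eq: "\<gamma> \<in> N \<Longrightarrow> rt = pt \<gamma> 0"
  using valuation_pos by (auto simp: contact_root_def pt_eq intro: less_imp_le)

lemma leaf_eq: "contact_leaf N \<gamma> = pt \<gamma> \<infinity>"
  by (simp add: contact_leaf_def pt_def)

lemma segment_root: "\<gamma> \<in> N \<Longrightarrow> 0 \<le> t \<Longrightarrow> segment X rt (pt \<gamma> t) = arc \<gamma> 0 t"
  using segment_eq_arc[of \<gamma> 0 t] root_eq by simp

lemma arc_eq_arcD:
  assumes "\<gamma> \<in> N" "\<gamma>' \<in> N" "0 \<le> a" "a \<le> b" "0 \<le> a'" "a' \<le> b'" "arc \<gamma> a b = arc \<gamma>' a' b'"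
  shows "pt \<gamma> b = pt \<gamma>' b'"
proof -
  have b: "0 \<le> b" "0 \<le> b'" using assms by auto
  have "pt \<gamma> b \<in> arc \<gamma>' a' b'" "pt \<gamma>' b' \<in> arc \<gamma> a b"
    using assms by (metis atLeastAtMost_iff arc_def imageI order_refl)+
  hence "b \<le> b'" "b' \<le> b" "b' \<le> v \<gamma> \<gamma>'"
    using assms(1-6) b by (simp_all only: pt_mem_arc)
  thus ?thesis using assms(1,2) b by (simp add: pt_eq_iff)
qed

text \<open>The two paths from the root coincide exactly up to the contact of the series; an arc
  determines its upper end, which gives uniqueness.\<close>

lemma tree_meet_leaves:
  assumes "\<gamma> \<in> N" "\<gamma>' \<in> N"
  shows "tree_meet X rt (contact_leaf N \<gamma>) (contact_leaf N \<gamma>') = pt \<gamma> (v \<gamma> \<gamma>')"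
proof -
  have v0: "0 \<le> v \<gamma> \<gamma>'" using valuation_pos[OF assms] by simp
  have int: "segment X rt (contact_leaf N \<gamma>) \<inter> segment X rt (contact_leaf N \<gamma>') = arc \<gamma> 0 (v \<gamma> \<gamma>')"
  proof (rule set_eqI)
    fix P
    have "P \<in> arc \<gamma> 0 \<infinity> \<and> P \<in> arc \<gamma>' 0 \<infinity> \<longleftrightarrow> P \<in> arc \<gamma> 0 (v \<gamma> \<gamma>')" if PX: "P \<in> topspace X"
    proof -
      obtain \<gamma>'' s where P: "P = pt \<gamma>'' s" "\<gamma>'' \<in> N" "0 \<le> s" using PX unfolding topspace_X by blast
      show ?thesis unfolding P(1)
        using assms P(2,3) v_ultra[of s \<gamma> \<gamma>'' \<gamma>'] v_ultra[of s \<gamma>' \<gamma> \<gamma>''] v_commute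
        by (auto simp: pt_mem_arc)
    qed
    thus "P \<in> segment X rt (contact_leaf N \<gamma>) \<inter> segment X rt (contact_leaf N \<gamma>') \<longleftrightarrow> P \<in> arc \<gamma> 0 (v \<gamma> \<gamma>')"
      using assms arc_subset_X[of _ 0] by (auto simp: leaf_eq segment_root)
  qed
  show ?thesis unfolding tree_meet_def int
  proof (rule the_equality)
    fix R assume R: "R \<in> topspace X \<and> segment X rt R = arc \<gamma> 0 (v \<gamma> \<gamma>')"
    then obtain \<gamma>'' s where P: "R = pt \<gamma>'' s" "\<gamma>'' \<in> N" "0 \<le> s" unfolding topspace_X by blast
    hence "arc \<gamma>'' 0 s = arc \<gamma> 0 (v \<gamma> \<gamma>')" using R segment_root by auto
    thus "R = pt \<gamma> (v \<gamma> \<gamma>')" using arc_eq_arcD[of \<gamma>'' \<gamma> 0 s 0] P assms v0 by auto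
  qed (use assms v0 pt_in_X segment_root in auto)
qed

text \<open>Above height t the path of each leaf in question still meets the path of \<gamma> at the
  height of their contact, so the set is a union of connected pieces through the leaf
  \<gamma>.\<close>

lemma connectedin_up:
  assumes "\<gamma> \<in> N" "0 \<le> t" "t < \<infinity>"
  shows "connectedin X (up \<gamma> t)"
proof -
  let ?A = "\<lambda>\<gamma>'. pt \<gamma>' ` {t<..} \<union> pt \<gamma> ` {t<..}"
  have eq: "up \<gamma> t = \<Union>(?A ` {\<gamma>'\<in>N. t < v \<gamma> \<gamma>'})"
    using assms by (fastforce simp: up_def)
  have c: "connectedin X (pt \<gamma>' ` {t<..})" if "\<gamma>' \<in> N" for \<gamma>'
    using that assms by (intro connectedin_pt_image) (auto intro: less_imp_le le_less_trans)
  show ?thesis unfolding eq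
  proof (rule connectedin_Union)
    fix S assume "S \<in> ?A ` {\<gamma>'\<in>N. t < v \<gamma> \<gamma>'}"
    then obtain \<gamma>' where \<gamma>': "\<gamma>' \<in> N" "t < v \<gamma> \<gamma>'" "S = ?A \<gamma>'" by blast
    have "0 \<le> v \<gamma> \<gamma>'" using valuation_pos \<gamma>' assms by (simp add: less_imp_le)
    hence "pt \<gamma>' (v \<gamma> \<gamma>') = pt \<gamma> (v \<gamma> \<gamma>')" using \<gamma>' assms v_commute[of \<gamma> \<gamma>'] by (auto simp: pt_eq_iff)
    hence "pt \<gamma>' ` {t<..} \<inter> pt \<gamma> ` {t<..} \<noteq> {}" using \<gamma>'(2) by (metis IntI empty_iff greaterThan_iff imageI)
    thus "connectedin X S" unfolding \<gamma>'(3) using c \<gamma>' assms by (intro connectedin_Un) auto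
  next
    have "pt \<gamma> \<infinity> \<in> \<Inter>(?A ` {\<gamma>'\<in>N. t < v \<gamma> \<gamma>'})" using assms by auto
    thus "\<Inter>(?A ` {\<gamma>'\<in>N. t < v \<gamma> \<gamma>'}) \<noteq> {}" by blast
  qed
qed

text \<open>Every point is joined to the root inside the set, since going down along a path keeps
  the defining condition.\<close>

lemma connectedin_down:
  assumes "\<gamma> \<in> N" "0 < t"
  shows "connectedin X (down \<gamma> t)"
proof -
  let ?A = "{arc \<gamma>' 0 s | \<gamma>' s. \<gamma>' \<in> N \<and> 0 \<le> s \<and> (s < t \<or> v \<gamma> \<gamma>' < t)}"
  have sub: "arc \<gamma>' 0 s \<subseteq> down \<gamma> t" if "\<gamma>' \<in> N" "0 \<le> s" "s < t \<or> v \<gamma> \<gamma>' < t" for \<gamma>' s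
    using that assms by (auto simp: arc_def pt_mem_down)
  have "down \<gamma> t = \<Union>?A"
  proof
    show "down \<gamma> t \<subseteq> \<Union>?A"
    proof
      fix P assume "P \<in> down \<gamma> t"
      then obtain \<gamma>' s where P: "P = pt \<gamma>' s" "\<gamma>' \<in> N" "0 \<le> s" "s < t \<or> v \<gamma> \<gamma>' < t"
        unfolding down_def by blast
      have "P \<in> arc \<gamma>' 0 s" using P(1,3) by (simp add: arc_def)
      thus "P \<in> \<Union>?A" using P(2-4) by blast
    qed
    show "\<Union>?A \<subseteq> down \<gamma> t" using sub by blast
  qed
  moreover have "connectedin X (\<Union>?A)"
  proof (rule connectedin_Union)
    show "connectedin X S" if "S \<in> ?A" for S using that connectedin_arc by auto
    have "rt \<in> \<Inter>?A" using root_eq by (auto simp: arc_def)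
    thus "\<Inter>?A \<noteq> {}" by blast
  qed
  ultimately show ?thesis by simp
qed

text \<open>The side conditions remove empty sets: there is no \<open>down\<close> at the root and
  no \<open>up\<close> at a leaf. Two sets \<open>up\<close> that meet coincide by the ultrametric
  inequality.\<close>

lemma components_complement_pt:
  assumes "\<gamma> \<in> N" "0 \<le> t"
  shows "connected_components_of (subtopology X (topspace X - {pt \<gamma> t})) =
    {C. C = down \<gamma> t \<and> 0 < t} \<union> {up \<gamma>' t | \<gamma>'. \<gamma>' \<in> N \<and> t \<le> v \<gamma> \<gamma>' \<and> t < \<infinity>}" (is "_ = ?C")
proof (rule connected_components_of_open_partition)
  let ?Y = "subtopology X (topspace X - {pt \<gamma> t})"
  note cp = complement_pt[OF assms]
  have d0: "down \<gamma> t = {}" if "\<not> 0 < t"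
  proof -
    have "t = 0" using that assms by auto
    thus ?thesis using assms valuation_pos by (fastforce simp: down_def dest: less_imp_le)
  qed
  have u_inf: "up \<gamma>' t = {}" if "\<not> t < \<infinity>" for \<gamma>' using that by (auto simp: up_def)
  have un: "\<Union>?C = topspace X - {pt \<gamma> t}"
    unfolding cp(1) using d0 u_inf by (cases "0 < t"; cases "t < \<infinity>") auto
  thus "\<Union>?C = topspace ?Y" by auto
  fix C assume C: "C \<in> ?C"
  have sub: "C \<subseteq> topspace X - {pt \<gamma> t}" using C un by blast
  show "C \<noteq> {}"
  proof (cases "C = down \<gamma> t \<and> 0 < t")
    case True
    thus ?thesis using pt_mem_down[of \<gamma> \<gamma> t 0] assms by auto
  next
    case False
    then obtain \<gamma>' where "C = up \<gamma>' t" "\<gamma>' \<in> N" "t < \<infinity>" using C by blast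
    moreover from this have "pt \<gamma>' \<infinity> \<in> up \<gamma>' t" using assms by (subst pt_mem_up) auto
    ultimately show ?thesis by blast
  qed
  show "connectedin ?Y C"
    using C sub connectedin_down connectedin_up assms unfolding connectedin_subtopology by auto
  have "openin X C" using C openin_up openin_down assms by auto
  thus "openin ?Y C" using sub by (auto simp: openin_subtopology)
  fix C' assume C': "C' \<in> ?C" and int: "C \<inter> C' \<noteq> {}"
  have *: "C = up \<gamma>' t \<and> C' = up \<gamma>'' t \<Longrightarrow> \<gamma>' \<in> N \<Longrightarrow> \<gamma>'' \<in> N \<Longrightarrow> C \<inter> C' \<noteq> {} \<Longrightarrow> C = C'" for \<gamma>' \<gamma>'' C C'
  proof -
    assume h: "C = up \<gamma>' t \<and> C' = up \<gamma>'' t" "\<gamma>' \<in> N" "\<gamma>'' \<in> N" "C \<inter> C' \<noteq> {}"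
    then obtain P where P: "P \<in> up \<gamma>' t" "P \<in> up \<gamma>'' t" by blast
    then obtain \<delta> s where \<delta>: "P = pt \<delta> s" "\<delta> \<in> N" "0 \<le> s"
      using up_subset_X[OF assms(2)] unfolding topspace_X by blast
    hence l: "t < v \<gamma>' \<delta>" "t < v \<gamma>'' \<delta>" using P h assms by (auto simp: pt_mem_up)
    hence "t < v \<gamma>' \<gamma>''" using v_ultra_less v_commute by metis
    hence "t < v \<gamma>' \<mu> \<longleftrightarrow> t < v \<gamma>'' \<mu>" for \<mu> using v_ultra_less v_commute by metis
    thus "C = C'" using h(1) by (simp add: up_def)
  qed
  have **: "down \<gamma> t \<inter> up \<gamma>' t = {}" if "\<gamma>' \<in> N" "t \<le> v \<gamma> \<gamma>'" for \<gamma>' using cp(2) that by blast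
  show "C = C'" using C C' int * ** by blast
qed

text \<open>The heights of the vertices on the path to \<gamma>: 0 for the root, the infinite value
  of \<open>v \<gamma> \<gamma>\<close> for the leaf, and the branchings with the other
  leaves.\<close>

definition crit :: "real puiseux \<Rightarrow> ereal set" where "crit \<gamma> = insert 0 (v \<gamma> ` N)"

lemma finite_crit: "finite (crit \<gamma>)" using finite_N by (simp add: crit_def)

lemma crit_nonneg: "\<gamma> \<in> N \<Longrightarrow> t \<in> crit \<gamma> \<Longrightarrow> 0 \<le> t"
  using valuation_pos by (auto simp: crit_def less_imp_le)

lemma infinity_in_crit: "\<gamma> \<in> N \<Longrightarrow> \<infinity> \<in> crit \<gamma>"
  unfolding crit_def using v_self[of \<gamma>] by (intro insertI2 image_eqI[of _ _ \<gamma>]) auto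

lemma v_in_crit: "\<gamma>' \<in> N \<Longrightarrow> v \<gamma> \<gamma>' \<in> crit \<gamma>" by (simp add: crit_def)

text \<open>A leaf \<delta> that leaves \<gamma> before \<gamma>' does also leaves \<gamma>' at that
  height. At the height where \<gamma> and \<gamma>' separate, \<gamma> itself is the leaf that
  branches off from \<gamma>'.\<close>

lemma crit_mono:
  assumes "\<gamma> \<in> N" "\<gamma>' \<in> N" "t \<in> crit \<gamma>" "t \<le> v \<gamma> \<gamma>'"
  shows "t \<in> crit \<gamma>'"
proof (cases "t = 0")
  case False
  then obtain \<delta> where \<delta>: "\<delta> \<in> N" "t = v \<gamma> \<delta>" using assms by (auto simp: crit_def)
  have le: "t \<le> v \<gamma>' \<delta>" using v_ultra[of t \<gamma>' \<gamma> \<delta>] assms \<delta> v_commute[of \<gamma> \<gamma>'] by auto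
  show ?thesis
  proof (cases "t = v \<gamma>' \<delta>")
    case False
    have "\<not> t < v \<gamma> \<gamma>'"
      using False le v_ultra_less[of t \<gamma> \<gamma>' \<delta>] \<delta>(2) by (metis le_less less_irrefl)
    hence "t = v \<gamma>' \<gamma>" using assms v_commute[of \<gamma> \<gamma>'] by auto
    thus ?thesis using v_in_crit[OF assms(1)] by simp
  qed (use v_in_crit \<delta> in auto)
qed (simp add: crit_def)

text \<open>Counting components: one at the root and at a leaf, at least three at a branching
  (downwards and towards two separating leaves), and exactly two elsewhere.\<close>

lemma vertex_iff:
  assumes "\<gamma> \<in> N" "0 \<le> t"
  shows "pt \<gamma> t \<in> vertices X \<longleftrightarrow> t \<in> crit \<gamma>"
proof -
  let ?C = "{C. C = down \<gamma> t \<and> 0 < t} \<union> {up \<gamma>' t | \<gamma>'. \<gamma>' \<in> N \<and> t \<le> v \<gamma> \<gamma>' \<and> t < \<infinity>}"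
  have val: "valency X (pt \<gamma> t) = card ?C"
    by (simp add: valency_def components_complement_pt[OF assms])
  have fin: "finite ?C"
  proof (rule finite_subset)
    show "?C \<subseteq> insert (down \<gamma> t) ((\<lambda>\<gamma>'. up \<gamma>' t) ` N)" by auto
  qed (use finite_N in auto)
  have up_eq: "up \<gamma>' t = up \<gamma> t" if "t < v \<gamma> \<gamma>'" for \<gamma>'
  proof -
    have "t < v \<gamma>' \<mu> \<longleftrightarrow> t < v \<gamma> \<mu>" for \<mu> using v_ultra_less v_commute that by metis
    thus ?thesis by (simp add: up_def)
  qed
  have up_top: "pt \<gamma>' \<infinity> \<in> up \<gamma>'' t \<longleftrightarrow> t < \<infinity> \<and> t < v \<gamma>'' \<gamma>'" if "\<gamma>' \<in> N" "\<gamma>'' \<in> N" for \<gamma>' \<gamma>''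
    using that assms by (subst pt_mem_up) auto
  have down_top: "pt \<gamma>' \<infinity> \<notin> down \<gamma> t" if "\<gamma>' \<in> N" "t \<le> v \<gamma> \<gamma>'" for \<gamma>'
    using that assms by (subst pt_mem_down) auto
  have "valency X (pt \<gamma> t) = 2 \<longleftrightarrow> t \<notin> crit \<gamma>"
  proof (cases "t = 0 \<or> t = \<infinity>")
    case True
    have "card ?C = 1"
    proof (cases "t = 0")
      case True
      have "up \<gamma>' t = up \<gamma> t \<and> t \<le> v \<gamma> \<gamma>'" if "\<gamma>' \<in> N" for \<gamma>'
        using up_eq[of \<gamma>'] valuation_pos[OF assms(1) that] True by (simp add: less_imp_le)
      moreover have "t < \<infinity>" "\<not> 0 < t" using True by simp_all
      ultimately have "?C = {up \<gamma> t}" using assms(1) by blast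
      thus ?thesis by simp
    next
      case False
      hence "?C = {down \<gamma> t}" using True by auto
      thus ?thesis by simp
    qed
    thus ?thesis unfolding val using True infinity_in_crit[OF assms(1)] by (auto simp: crit_def)
  next
    case False
    hence t: "0 < t" "t < \<infinity>" using assms by auto
    have upX: "down \<gamma> t \<noteq> up \<gamma>' t" if "\<gamma>' \<in> N" "t \<le> v \<gamma> \<gamma>'" for \<gamma>'
      using down_top[OF that] up_top[OF that(1) that(1)] t by auto
    show ?thesis
    proof (cases "\<exists>\<gamma>'\<in>N. v \<gamma> \<gamma>' = t")
      case True
      then obtain \<gamma>' where \<gamma>': "\<gamma>' \<in> N" "v \<gamma> \<gamma>' = t" by blast
      have ne: "up \<gamma> t \<noteq> up \<gamma>' t"
        using up_top[OF \<gamma>'(1) assms(1)] up_top[OF \<gamma>'(1) \<gamma>'(1)] t \<gamma>' by auto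
      have "{down \<gamma> t, up \<gamma> t, up \<gamma>' t} \<subseteq> ?C" using t \<gamma>' assms by auto
      moreover have "card {down \<gamma> t, up \<gamma> t, up \<gamma>' t} = 3" using ne upX \<gamma>' assms by auto
      ultimately have "3 \<le> card ?C"
        using card_mono[OF fin, of "{down \<gamma> t, up \<gamma> t, up \<gamma>' t}"] by linarith
      thus ?thesis unfolding val using \<gamma>' by (auto simp: crit_def)
    next
      case False
      hence "up \<gamma>' t = up \<gamma> t" if "\<gamma>' \<in> N" "t \<le> v \<gamma> \<gamma>'" for \<gamma>'
        using up_eq[of \<gamma>'] that by (metis le_less)
      moreover have "t \<le> v \<gamma> \<gamma>" by simp
      ultimately have "?C = {down \<gamma> t, up \<gamma> t}" using t assms(1) by blast
      thus ?thesis unfolding val using False t upX[OF assms(1)] by (auto simp: crit_def)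
    qed
  qed
  thus ?thesis using pt_in_X[OF assms] by (auto simp: vertices_def)
qed

end

section \<open>Edges and the planar structure of the contact tree\<close>

context contact_set begin

text \<open>The upper end of the edge that leaves height p towards \<gamma>. For finite p the set is
  non-empty because the leaf has critical height \<infinity>.\<close>

definition nxt :: "real puiseux \<Rightarrow> ereal \<Rightarrow> ereal" where
  "nxt \<gamma> p = Min {q \<in> crit \<gamma>. p < q}"

lemma
  assumes "\<gamma> \<in> N" "p < \<infinity>"
  shows nxt_in_crit: "nxt \<gamma> p \<in> crit \<gamma>" and less_nxt: "p < nxt \<gamma> p"
    and nxt_le: "q \<in> crit \<gamma> \<Longrightarrow> p < q \<Longrightarrow> nxt \<gamma> p \<le> q"
proof -
  have fin: "finite {q \<in> crit \<gamma>. p < q}" using finite_crit by simp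
  have "\<infinity> \<in> {q \<in> crit \<gamma>. p < q}" using infinity_in_crit assms by simp
  hence "{q \<in> crit \<gamma>. p < q} \<noteq> {}" by blast
  from Min_in[OF fin this] show "nxt \<gamma> p \<in> crit \<gamma>" "p < nxt \<gamma> p" by (simp_all add: nxt_def)
  show "q \<in> crit \<gamma> \<Longrightarrow> p < q \<Longrightarrow> nxt \<gamma> p \<le> q" using Min_le[OF fin, of q] by (simp add: nxt_def)
qed

text \<open>The two paths have the same vertices up to their contact, and the contact is itself a
  critical height above p.\<close>

lemma nxt_cong:
  assumes "\<gamma> \<in> N" "\<gamma>' \<in> N" "p < v \<gamma> \<gamma>'"
  shows "nxt \<gamma> p = nxt \<gamma>' p"
proof -
  have *: "nxt \<gamma>' p \<le> nxt \<gamma> p" if "\<gamma> \<in> N" "\<gamma>' \<in> N" "p < v \<gamma> \<gamma>'" for \<gamma> \<gamma>'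
  proof -
    have p: "p < \<infinity>" using that(3) by (rule less_le_trans) simp
    have "nxt \<gamma> p \<le> v \<gamma> \<gamma>'" using nxt_le[OF that(1) p v_in_crit] that by simp
    hence "nxt \<gamma> p \<in> crit \<gamma>'" using crit_mono nxt_in_crit[OF that(1) p] that by blast
    thus ?thesis using nxt_le[OF that(2) p] less_nxt[OF that(1) p] by blast
  qed
  show ?thesis using *[OF assms] *[of \<gamma>' \<gamma>] assms v_commute[of \<gamma> \<gamma>'] by (simp add: antisym)
qed

definition oarc :: "real puiseux \<Rightarrow> ereal \<Rightarrow> (real puiseux \<times> ereal) set set" where
  "oarc \<gamma> p = pt \<gamma> ` {p<..<nxt \<gamma> p}"

definition out :: "real puiseux \<Rightarrow> ereal \<Rightarrow> (real puiseux \<times> ereal) set set" where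
  "out \<gamma> p = arc \<gamma> p (nxt \<gamma> p)"

text \<open>No path branches off inside an edge: sharing one interior point forces sharing
  everything up to the upper vertex.\<close>

lemma pt_mem_oarc:
  assumes "\<gamma> \<in> N" "\<gamma>' \<in> N" "0 \<le> p" "p < \<infinity>" "0 \<le> s"
  shows "pt \<gamma>' s \<in> oarc \<gamma> p \<longleftrightarrow> p < s \<and> s < nxt \<gamma> p \<and> nxt \<gamma> p \<le> v \<gamma> \<gamma>'"
proof
  assume "pt \<gamma>' s \<in> oarc \<gamma> p"
  then obtain u where u: "p < u" "u < nxt \<gamma> p" "pt \<gamma>' s = pt \<gamma> u" by (auto simp: oarc_def)
  have "0 \<le> u" using u(1) assms by (meson less_imp_le order_trans)
  hence su: "s = u" "s \<le> v \<gamma>' \<gamma>" using u assms by (auto simp: pt_eq_iff)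
  hence "p < v \<gamma> \<gamma>'" using u v_commute[of \<gamma> \<gamma>'] by auto
  thus "p < s \<and> s < nxt \<gamma> p \<and> nxt \<gamma> p \<le> v \<gamma> \<gamma>'"
    using u su nxt_le[OF assms(1,4) v_in_crit[OF assms(2)]] by auto
next
  assume *: "p < s \<and> s < nxt \<gamma> p \<and> nxt \<gamma> p \<le> v \<gamma> \<gamma>'"
  hence "s \<le> v \<gamma>' \<gamma>" using v_commute[of \<gamma> \<gamma>'] by auto
  hence "pt \<gamma>' s = pt \<gamma> s" using assms by (simp add: pt_eq_iff)
  thus "pt \<gamma>' s \<in> oarc \<gamma> p" using * by (simp add: oarc_def)
qed

lemma not_vertexD:
  assumes "\<gamma> \<in> N" "0 \<le> s" "s \<notin> crit \<gamma>"
  obtains p where "p \<in> crit \<gamma>" "0 \<le> p" "p < \<infinity>" "p < s" "s < nxt \<gamma> p"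
proof -
  let ?p = "Max {c \<in> crit \<gamma>. c < s}"
  have fin: "finite {c \<in> crit \<gamma>. c < s}" using finite_crit by simp
  have "0 \<in> crit \<gamma>" by (simp add: crit_def)
  hence "0 \<in> {c \<in> crit \<gamma>. c < s}" using assms by (auto simp: le_less)
  hence ne: "{c \<in> crit \<gamma>. c < s} \<noteq> {}" by blast
  have p: "?p \<in> crit \<gamma>" "?p < s" using Max_in[OF fin ne] by auto
  have inf: "?p < \<infinity>" using p(2) by (rule less_le_trans) simp
  have "\<not> nxt \<gamma> ?p < s"
    using Max_ge[OF fin, of "nxt \<gamma> ?p"] nxt_in_crit[OF assms(1) inf] less_nxt[OF assms(1) inf] by auto
  moreover have "nxt \<gamma> ?p \<noteq> s" using nxt_in_crit[OF assms(1) inf] assms by auto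
  ultimately show ?thesis using that[of ?p] p inf crit_nonneg[OF assms(1) p(1)] by auto
qed

lemma oarc_subset:
  assumes "\<gamma> \<in> N" "0 \<le> p" "p < \<infinity>"
  shows "oarc \<gamma> p \<subseteq> topspace X - vertices X"
proof
  fix P assume "P \<in> oarc \<gamma> p"
  then obtain s where s: "P = pt \<gamma> s" "p < s" "s < nxt \<gamma> p" by (auto simp: oarc_def)
  have s0: "0 \<le> s" using s(2) assms by (meson less_imp_le order_trans)
  have "s \<notin> crit \<gamma>" using nxt_le[OF assms(1,3)] s by (meson not_le)
  thus "P \<in> topspace X - vertices X" using s s0 pt_in_X vertex_iff assms by auto
qed

text \<open>If two open arcs share a point, each lower end is critical for the other path as well.
  Since neither arc contains a critical height, the lower ends agree, and then so do the upper
  ends.\<close>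

lemma components_complement_vertices:
  "connected_components_of (subtopology X (topspace X - vertices X)) =
    {oarc \<gamma> p | \<gamma> p. \<gamma> \<in> N \<and> p \<in> crit \<gamma> \<and> p < \<infinity>}" (is "_ = ?C")
proof (rule connected_components_of_open_partition)
  let ?Y = "subtopology X (topspace X - vertices X)"
  show "\<Union>?C = topspace ?Y"
  proof (intro subset_antisym subsetI)
    fix P assume "P \<in> \<Union>?C"
    then obtain \<gamma> p where "\<gamma> \<in> N" "p \<in> crit \<gamma>" "p < \<infinity>" "P \<in> oarc \<gamma> p" by blast
    thus "P \<in> topspace ?Y" using oarc_subset[of \<gamma> p] crit_nonneg[of \<gamma> p] by auto
  next
    fix P assume P: "P \<in> topspace ?Y"
    then obtain \<gamma> s where s: "P = pt \<gamma> s" "\<gamma> \<in> N" "0 \<le> s" unfolding topspace_subtopology topspace_X by blast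
    hence "s \<notin> crit \<gamma>" using P vertex_iff by auto
    then obtain p where p: "p \<in> crit \<gamma>" "0 \<le> p" "p < \<infinity>" "p < s" "s < nxt \<gamma> p"
      using not_vertexD s by metis
    hence "P \<in> oarc \<gamma> p" using s by (simp add: oarc_def)
    thus "P \<in> \<Union>?C" using s p by blast
  qed
  fix C assume "C \<in> ?C"
  then obtain \<gamma> p where C: "C = oarc \<gamma> p" "\<gamma> \<in> N" "p \<in> crit \<gamma>" "p < \<infinity>" by blast
  note p0 = crit_nonneg[OF C(2,3)]
  have sub: "C \<subseteq> topspace X - vertices X" using oarc_subset C p0 by simp
  show "C \<noteq> {}"
    unfolding C(1) oarc_def using dense[OF less_nxt[OF C(2,4)]] by auto
  have "connectedin X C"
    unfolding C(1) oarc_def using p0 C(2)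
    by (intro connectedin_pt_image) (auto intro: less_imp_le le_less_trans)
  thus "connectedin ?Y C" using sub by (simp add: connectedin_subtopology)
  have "openin X C"
  proof (rule openin_XI)
    fix \<gamma>' assume "\<gamma>' \<in> N"
    thus "\<exists>V. open V \<and> (\<forall>t\<ge>0. pt \<gamma>' t \<in> C \<longleftrightarrow> t \<in> V)"
      using C p0 by (intro exI[of _ "if nxt \<gamma> p \<le> v \<gamma> \<gamma>' then {p<..<nxt \<gamma> p} else {}"])
        (auto simp: pt_mem_oarc)
  qed (use sub in auto)
  thus "openin ?Y C" using sub by (auto simp: openin_subtopology)
  fix C' assume "C' \<in> ?C" and int: "C \<inter> C' \<noteq> {}"
  then obtain \<gamma>' p' where C': "C' = oarc \<gamma>' p'" "\<gamma>' \<in> N" "p' \<in> crit \<gamma>'" "p' < \<infinity>" by blast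
  note p0' = crit_nonneg[OF C'(2,3)]
  obtain P where P: "P \<in> oarc \<gamma> p" "P \<in> oarc \<gamma>' p'" using int C C' by blast
  then obtain s where s: "P = pt \<gamma> s" "p < s" "s < nxt \<gamma> p" by (auto simp: oarc_def)
  have s0: "0 \<le> s" using s(2) p0 by (meson less_imp_le order_trans)
  have s': "p' < s" "s < nxt \<gamma>' p'" "nxt \<gamma>' p' \<le> v \<gamma>' \<gamma>"
    using P(2) unfolding s(1) using C' C p0' s0 by (auto simp: pt_mem_oarc)
  hence pv: "p < v \<gamma> \<gamma>'" "p' < v \<gamma>' \<gamma>" "s < v \<gamma>' \<gamma>" using s v_commute[of \<gamma> \<gamma>'] by auto
  have "p' \<in> crit \<gamma>" using crit_mono[OF C'(2) C(2) C'(3)] pv by auto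
  moreover have "p \<in> crit \<gamma>'" using crit_mono[OF C(2) C'(2) C(3)] pv by auto
  ultimately have "\<not> p < p'" "\<not> p' < p"
    using nxt_le[OF C(2,4), of p'] nxt_le[OF C'(2,4), of p] s s' by auto
  hence pp: "p = p'" by auto
  have nn: "nxt \<gamma> p = nxt \<gamma>' p'" using nxt_cong[OF C(2) C'(2) pv(1)] pp by simp
  show "C = C'" unfolding C(1) C'(1) oarc_def pp nn[unfolded pp]
  proof (rule image_cong)
    fix u assume u: "u \<in> {p'<..<nxt \<gamma>' p'}"
    have "0 \<le> u" "u \<le> v \<gamma> \<gamma>'" using u s' p0' v_commute[of \<gamma> \<gamma>'] by (auto intro: less_imp_le le_less_trans)
    thus "pt \<gamma> u = pt \<gamma>' u" using C C' by (simp add: pt_eq_iff)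
  qed simp
qed

lemma closedin_arc:
  assumes "\<gamma> \<in> N" "0 \<le> a"
  shows "closedin X (arc \<gamma> a b)"
  unfolding closedin_def
proof (intro conjI arc_subset_X assms openin_XI)
  fix \<gamma>' assume \<gamma>': "\<gamma>' \<in> N"
  have "open (- ({a..b} \<inter> {..v \<gamma> \<gamma>'}))" by (intro open_Compl closed_Int) auto
  moreover have "\<forall>t\<ge>0. pt \<gamma>' t \<in> topspace X - arc \<gamma> a b \<longleftrightarrow> t \<in> - ({a..b} \<inter> {..v \<gamma> \<gamma>'})"
    using \<gamma>' assms by (auto simp: pt_mem_arc pt_in_X)
  ultimately show "\<exists>V. open V \<and> (\<forall>t\<ge>0. pt \<gamma>' t \<in> topspace X - arc \<gamma> a b \<longleftrightarrow> t \<in> V)" by blast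
qed auto

lemma closure_oarc:
  assumes "\<gamma> \<in> N" "0 \<le> p" "p < \<infinity>"
  shows "X closure_of oarc \<gamma> p = out \<gamma> p"
proof (rule subset_antisym)
  have "oarc \<gamma> p \<subseteq> out \<gamma> p" unfolding oarc_def out_def arc_def by (intro image_mono) auto
  thus "X closure_of oarc \<gamma> p \<subseteq> out \<gamma> p"
    unfolding out_def by (intro closure_of_minimal closedin_arc assms)
  let ?I = "{p<..<nxt \<gamma> p}"
  have "{0..\<infinity>} \<inter> ?I = ?I" using assms(2) by (auto intro: less_imp_le le_less_trans)
  hence "(top_of_set {0..\<infinity>}) closure_of ?I = {0..\<infinity>} \<inter> closure ?I"
    by (simp add: closure_of_subtopology)
  also have "\<dots> = {p..nxt \<gamma> p}"
    using less_nxt[OF assms(1,3)] assms(2) by (auto simp: closure_greaterThanLessThan intro: order_trans)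
  finally show "out \<gamma> p \<subseteq> X closure_of oarc \<gamma> p"
    using continuous_map_image_closure_subset[OF continuous_map_pt[OF assms(1)], of ?I]
    by (simp add: out_def arc_def oarc_def)
qed

lemma edges_eq: "edges X = {out \<gamma> p | \<gamma> p. \<gamma> \<in> N \<and> p \<in> crit \<gamma> \<and> p < \<infinity>}"
proof (intro set_eqI iffI)
  fix e assume "e \<in> edges X"
  then obtain \<gamma> p where "\<gamma> \<in> N" "p \<in> crit \<gamma>" "p < \<infinity>" "e = X closure_of oarc \<gamma> p"
    unfolding edges_def components_complement_vertices by blast
  moreover from this have "e = out \<gamma> p" using closure_oarc[of \<gamma> p] crit_nonneg[of \<gamma> p] by simp
  ultimately show "e \<in> {out \<gamma> p | \<gamma> p. \<gamma> \<in> N \<and> p \<in> crit \<gamma> \<and> p < \<infinity>}" by blast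
next
  fix e assume "e \<in> {out \<gamma> p | \<gamma> p. \<gamma> \<in> N \<and> p \<in> crit \<gamma> \<and> p < \<infinity>}"
  then obtain \<gamma> p where e: "e = out \<gamma> p" "\<gamma> \<in> N" "p \<in> crit \<gamma>" "p < \<infinity>" by blast
  hence "e = X closure_of oarc \<gamma> p" using closure_oarc[of \<gamma> p] crit_nonneg[of \<gamma> p] by simp
  thus "e \<in> edges X" unfolding edges_def components_complement_vertices using e(2-4) by blast
qed

lemma outgoing_edges_eq:
  assumes \<gamma>: "\<gamma> \<in> N" "p \<in> crit \<gamma>" "p < \<infinity>"
  shows "outgoing_edges X rt (pt \<gamma> p) = (\<lambda>\<gamma>'. out \<gamma>' p) ` {\<gamma>'\<in>N. p \<le> v \<gamma> \<gamma>'}"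
proof -
  note p0 = crit_nonneg[OF \<gamma>(1,2)]
  show ?thesis
  proof (intro set_eqI iffI)
    fix e assume "e \<in> outgoing_edges X rt (pt \<gamma> p)"
    then obtain \<gamma>' p' Q where e: "e = out \<gamma>' p'" "\<gamma>' \<in> N" "p' \<in> crit \<gamma>'" "p' < \<infinity>" "e = segment X (pt \<gamma> p) Q"
      "\<not> e \<subseteq> segment X rt (pt \<gamma> p)"
      unfolding outgoing_edges_def edges_eq by blast
    note p0' = crit_nonneg[OF e(2,3)]
    have "pt \<gamma> p \<in> segment X (pt \<gamma> p) Q" by (auto simp: segment_def)
    hence "pt \<gamma> p \<in> arc \<gamma>' p' (nxt \<gamma>' p')" using e by (simp add: out_def)
    hence *: "p' \<le> p" "p \<le> nxt \<gamma>' p'" "p \<le> v \<gamma>' \<gamma>" using \<gamma> e p0 p0' by (auto simp: pt_mem_arc)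
    hence pc: "p \<in> crit \<gamma>'" using crit_mono[OF \<gamma>(1) e(2) \<gamma>(2)] v_commute[of \<gamma> \<gamma>'] by auto
    \<comment> \<open>The point lies on the edge and is a vertex. If it were not the lower end it
      would be the upper end, and the edge would lie on the path from the root.\<close>
    have "p' = p"
    proof (rule ccontr)
      assume "p' \<noteq> p"
      hence "p = nxt \<gamma>' p'" using nxt_le[OF e(2,4) pc] * by auto
      hence "e \<subseteq> arc \<gamma>' 0 p" using p0' by (auto simp: e(1) out_def arc_def)
      also have "arc \<gamma>' 0 p = segment X rt (pt \<gamma> p)"
        using segment_root[OF \<gamma>(1) p0] arc_cong[OF e(2) \<gamma>(1) order_refl *(3)] by simp
      finally show False using e(6) by blast
    qed
    thus "e \<in> (\<lambda>\<gamma>'. out \<gamma>' p) ` {\<gamma>'\<in>N. p \<le> v \<gamma> \<gamma>'}" using e * v_commute[of \<gamma> \<gamma>'] by auto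
  next
    fix e assume "e \<in> (\<lambda>\<gamma>'. out \<gamma>' p) ` {\<gamma>'\<in>N. p \<le> v \<gamma> \<gamma>'}"
    then obtain \<gamma>' where e: "e = out \<gamma>' p" "\<gamma>' \<in> N" "p \<le> v \<gamma> \<gamma>'" by blast
    have pc: "p \<in> crit \<gamma>'" using crit_mono[OF \<gamma>(1) e(2) \<gamma>(2) e(3)] .
    have P: "pt \<gamma> p = pt \<gamma>' p" using \<gamma> e p0 by (simp add: pt_eq_iff)
    note q = less_nxt[OF e(2) \<gamma>(3)]
    have q0: "0 \<le> nxt \<gamma>' p" using q p0 by auto
    have "e = segment X (pt \<gamma> p) (pt \<gamma>' (nxt \<gamma>' p))"
      unfolding e(1) P out_def using segment_eq_arc[OF e(2) p0] q by simp
    moreover have "\<not> e \<subseteq> segment X rt (pt \<gamma> p)"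
    proof
      assume "e \<subseteq> segment X rt (pt \<gamma> p)"
      hence "pt \<gamma>' (nxt \<gamma>' p) \<in> arc \<gamma>' 0 p"
        unfolding P segment_root[OF e(2) p0] e(1) out_def using q by (auto simp: arc_def)
      thus False using e(2) q q0 by (auto simp: pt_mem_arc)
    qed
    ultimately show "e \<in> outgoing_edges X rt (pt \<gamma> p)"
      unfolding outgoing_edges_def edges_eq using e pc \<gamma>(3) pt_in_X[OF e(2) q0] by blast
  qed
qed

text \<open>The inequality is strict because the edge must share points with the path to \<gamma>'
  beyond p; equality only means that the paths separate at this vertex.\<close>

lemma goes_towards_iff:
  assumes "\<gamma> \<in> N" "\<gamma>' \<in> N" "0 \<le> p" "p < \<infinity>"
  shows "goes_towards X (pt \<gamma>' p) (out \<gamma> p) (contact_leaf N \<gamma>') \<longleftrightarrow> p < v \<gamma> \<gamma>'"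
proof -
  have seg: "segment X (pt \<gamma>' p) (contact_leaf N \<gamma>') = arc \<gamma>' p \<infinity>"
    using segment_eq_arc[OF assms(2,3)] by (simp add: leaf_eq)
  note q = less_nxt[OF assms(1,4)]
  show ?thesis unfolding goes_towards_def seg out_def
  proof
    assume "arc \<gamma> p (nxt \<gamma> p) \<subseteq> arc \<gamma>' p \<infinity>"
    moreover have "pt \<gamma> (nxt \<gamma> p) \<in> arc \<gamma> p (nxt \<gamma> p)" using q by (auto simp: arc_def)
    ultimately have "pt \<gamma> (nxt \<gamma> p) \<in> arc \<gamma>' p \<infinity>" by blast
    moreover have "0 \<le> nxt \<gamma> p" using q assms by auto
    ultimately show "p < v \<gamma> \<gamma>'" using assms q v_commute[of \<gamma> \<gamma>'] by (auto simp: pt_mem_arc)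
  next
    assume *: "p < v \<gamma> \<gamma>'"
    hence "nxt \<gamma> p \<le> v \<gamma> \<gamma>'" using nxt_le[OF assms(1,4) v_in_crit[OF assms(2)]] by simp
    hence "arc \<gamma> p (nxt \<gamma> p) = arc \<gamma>' p (nxt \<gamma> p)" by (rule arc_cong[OF assms(1-3)])
    thus "arc \<gamma> p (nxt \<gamma> p) \<subseteq> arc \<gamma>' p \<infinity>" by (auto simp: arc_def)
  qed
qed

lemma out_eq_iff:
  assumes "\<gamma> \<in> N" "\<gamma>' \<in> N" "0 \<le> p" "p < \<infinity>"
  shows "out \<gamma> p = out \<gamma>' p \<longleftrightarrow> p < v \<gamma> \<gamma>'"
proof
  assume "out \<gamma> p = out \<gamma>' p"
  hence "goes_towards X (pt \<gamma>' p) (out \<gamma> p) (contact_leaf N \<gamma>') \<longleftrightarrow>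
    goes_towards X (pt \<gamma>' p) (out \<gamma>' p) (contact_leaf N \<gamma>')" by simp
  thus "p < v \<gamma> \<gamma>'" using assms by (simp add: goes_towards_iff less_top)
next
  assume *: "p < v \<gamma> \<gamma>'"
  hence "nxt \<gamma> p \<le> v \<gamma> \<gamma>'" using nxt_le[OF assms(1,4) v_in_crit[OF assms(2)]] by simp
  from arc_cong[OF assms(1-3) this] show "out \<gamma> p = out \<gamma>' p"
    using nxt_cong[OF assms(1,2) *] by (simp add: out_def)
qed

lemma leaf_in_leaves:
  assumes "\<gamma> \<in> N"
  shows "pt \<gamma> \<infinity> \<in> leaves X rt"
  unfolding leaves_def
proof (intro CollectI conjI ballI impI)
  show "pt \<gamma> \<infinity> \<in> topspace X" using assms by (simp add: pt_in_X)
  fix Q assume "Q \<in> topspace X" "tree_le X rt (pt \<gamma> \<infinity>) Q"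
  then obtain \<gamma>' s where Q: "Q = pt \<gamma>' s" "\<gamma>' \<in> N" "0 \<le> s" and le: "arc \<gamma> 0 \<infinity> \<subseteq> arc \<gamma>' 0 s"
    unfolding topspace_X tree_le_def using segment_root assms by auto
  have "pt \<gamma> \<infinity> \<in> arc \<gamma>' 0 s" using le by (auto simp: arc_def)
  hence "s = \<infinity>" "v \<gamma>' \<gamma> = \<infinity>" using Q assms by (auto simp: pt_mem_arc)
  thus "Q = pt \<gamma> \<infinity>" using Q assms v_commute[of \<gamma> \<gamma>'] by (simp add: pt_eq_iff)
qed

lemma internal_vertexE:
  assumes "P \<in> internal_vertices X rt"
  obtains \<gamma> p where "\<gamma> \<in> N" "p \<in> crit \<gamma>" "0 \<le> p" "p < \<infinity>" "P = pt \<gamma> p"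
proof -
  have P: "P \<in> vertices X" "P \<notin> leaves X rt" "P \<noteq> rt" using assms by (auto simp: internal_vertices_def)
  then obtain \<gamma> p where p: "P = pt \<gamma> p" "\<gamma> \<in> N" "0 \<le> p" by (auto simp: vertices_def topspace_X)
  have "p \<in> crit \<gamma>" using P(1) p vertex_iff by simp
  moreover have "p \<noteq> \<infinity>" using P(2) p leaf_in_leaves by auto
  ultimately show ?thesis using that p by auto
qed

lemma meet_internal:
  assumes "\<gamma> \<in> N" "\<gamma>' \<in> N" "\<gamma> \<noteq> \<gamma>'"
  shows "pt \<gamma> (v \<gamma> \<gamma>') \<in> internal_vertices X rt"
proof -
  have v: "0 < v \<gamma> \<gamma>'" "v \<gamma> \<gamma>' < \<infinity>" using valuation_pos[OF assms(1,2)] assms(3)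
    by (auto simp: valuation_eq_PInf_iff)
  have "pt \<gamma> (v \<gamma> \<gamma>') \<noteq> rt" using root_eq[OF assms(1)] assms v by (simp add: pt_eq_iff)
  moreover have "pt \<gamma> (v \<gamma> \<gamma>') \<in> vertices X" using vertex_iff v_in_crit assms v by simp
  moreover have "pt \<gamma> (v \<gamma> \<gamma>') \<notin> leaves X rt"
  proof
    assume "pt \<gamma> (v \<gamma> \<gamma>') \<in> leaves X rt"
    moreover have "tree_le X rt (pt \<gamma> (v \<gamma> \<gamma>')) (pt \<gamma> \<infinity>)"
      using assms v by (auto simp: tree_le_def segment_root arc_def)
    ultimately have "pt \<gamma> \<infinity> = pt \<gamma> (v \<gamma> \<gamma>')" using pt_in_X assms by (auto simp: leaves_def)
    thus False using assms v by (simp add: pt_eq_iff)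
  qed
  ultimately show ?thesis by (simp add: internal_vertices_def)
qed

lemma meet_eq_pt_iff:
  assumes "\<delta> \<in> N" "\<delta>' \<in> N" "\<gamma> \<in> N" "0 \<le> p"
  shows "tree_meet X rt (contact_leaf N \<delta>) (contact_leaf N \<delta>') = pt \<gamma> p \<longleftrightarrow> v \<delta> \<delta>' = p \<and> p \<le> v \<gamma> \<delta>"
  using assms valuation_pos[of \<delta> \<delta>'] v_commute[of \<gamma> \<delta>]
  by (auto simp: tree_meet_leaves pt_eq_iff)

text \<open>The definition compares the edges through some pair of leaves above them. By
  \<open>less_puiseux_cong\<close> the outcome is the same for all such pairs, so \<gamma>1 and
  \<gamma>2 may be taken.\<close>

lemma edge_less_iff:
  assumes \<gamma>: "\<gamma> \<in> N" "p \<in> crit \<gamma>" "p < \<infinity>" and \<gamma>12: "\<gamma>1 \<in> N" "\<gamma>2 \<in> N" "p \<le> v \<gamma> \<gamma>1" "p \<le> v \<gamma> \<gamma>2"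
  shows "edge_less (real_contact_tree N) (pt \<gamma> p) (out \<gamma>1 p) (out \<gamma>2 p) \<longleftrightarrow> v \<gamma>1 \<gamma>2 = p \<and> \<gamma>1 < \<gamma>2"
proof -
  note p0 = crit_nonneg[OF \<gamma>(1,2)]
  have P: "pt \<gamma> p = pt \<delta> p" if "\<delta> \<in> N" "p \<le> v \<gamma> \<delta>" for \<delta> using that \<gamma> p0 by (simp add: pt_eq_iff)
  have "edge_less (real_contact_tree N) (pt \<gamma> p) (out \<gamma>1 p) (out \<gamma>2 p) \<longleftrightarrow>
    (\<exists>\<delta>\<in>N. \<exists>\<delta>'\<in>N. \<delta> < \<delta>' \<and> v \<delta> \<delta>' = p \<and> p \<le> v \<gamma> \<delta> \<and>
       goes_towards X (pt \<gamma> p) (out \<gamma>1 p) (contact_leaf N \<delta>) \<and> goes_towards X (pt \<gamma> p) (out \<gamma>2 p) (contact_leaf N \<delta>'))"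
    unfolding real_contact_tree_def Let_def planar_tree.simps outgoing_edges_eq[OF \<gamma>]
    using \<gamma>12 \<gamma> p0 by (auto simp: meet_eq_pt_iff)
  also have "\<dots> \<longleftrightarrow> (\<exists>\<delta>\<in>N. \<exists>\<delta>'\<in>N. \<delta> < \<delta>' \<and> v \<delta> \<delta>' = p \<and> p \<le> v \<gamma> \<delta> \<and> p < v \<gamma>1 \<delta> \<and> p < v \<gamma>2 \<delta>')"
  proof (intro bex_cong refl conj_cong)
    fix \<delta> \<delta>' assume \<delta>: "\<delta> \<in> N" "\<delta>' \<in> N" "v \<delta> \<delta>' = p" "p \<le> v \<gamma> \<delta>"
    hence \<delta>2: "p \<le> v \<gamma> \<delta>'" using v_ultra[of p \<gamma> \<delta> \<delta>'] by simp
    show "goes_towards X (pt \<gamma> p) (out \<gamma>1 p) (contact_leaf N \<delta>) \<longleftrightarrow> p < v \<gamma>1 \<delta>"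
      unfolding P[OF \<delta>(1,4)] by (rule goes_towards_iff[OF \<gamma>12(1) \<delta>(1) p0 \<gamma>(3)])
    show "goes_towards X (pt \<gamma> p) (out \<gamma>2 p) (contact_leaf N \<delta>') \<longleftrightarrow> p < v \<gamma>2 \<delta>'"
      unfolding P[OF \<delta>(2) \<delta>2] by (rule goes_towards_iff[OF \<gamma>12(2) \<delta>(2) p0 \<gamma>(3)])
  qed
  also have "\<dots> \<longleftrightarrow> v \<gamma>1 \<gamma>2 = p \<and> \<gamma>1 < \<gamma>2"
  proof
    assume "\<exists>\<delta>\<in>N. \<exists>\<delta>'\<in>N. \<delta> < \<delta>' \<and> v \<delta> \<delta>' = p \<and> p \<le> v \<gamma> \<delta> \<and> p < v \<gamma>1 \<delta> \<and> p < v \<gamma>2 \<delta>'"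
    then obtain \<delta> \<delta>' where \<delta>: "\<delta> \<in> N" "\<delta>' \<in> N" "\<delta> < \<delta>'" "v \<delta> \<delta>' = p" "p < v \<gamma>1 \<delta>" "p < v \<gamma>2 \<delta>'" by blast
    have "p \<le> v \<gamma>1 \<gamma>2" using v_ultra[of p \<gamma>1 \<gamma> \<gamma>2] \<gamma>12 v_commute[of \<gamma>1 \<gamma>] by simp
    moreover have "\<not> p < v \<gamma>1 \<gamma>2"
      using v_ultra_less[of p \<delta> \<gamma>1 \<delta>'] v_ultra_less[of p \<gamma>1 \<gamma>2 \<delta>'] \<delta> v_commute[of \<gamma>1 \<delta>] by auto
    moreover have "\<gamma>1 < \<gamma>2 \<longleftrightarrow> \<delta> < \<delta>'"
      by (rule less_puiseux_cong) (use \<delta> v_commute[of \<gamma>1 \<delta>] v_commute[of \<gamma>2 \<delta>'] in auto)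
    ultimately show "v \<gamma>1 \<gamma>2 = p \<and> \<gamma>1 < \<gamma>2" using \<delta>(3) by auto
  next
    assume "v \<gamma>1 \<gamma>2 = p \<and> \<gamma>1 < \<gamma>2"
    thus "\<exists>\<delta>\<in>N. \<exists>\<delta>'\<in>N. \<delta> < \<delta>' \<and> v \<delta> \<delta>' = p \<and> p \<le> v \<gamma> \<delta> \<and> p < v \<gamma>1 \<delta> \<and> p < v \<gamma>2 \<delta>'"
      using \<gamma>12 \<gamma>(3) by (intro bexI[of _ \<gamma>1] bexI[of _ \<gamma>2]) auto
  qed
  finally show ?thesis .
qed

end

section \<open>Maps between contact trees\<close>

text \<open>The universal property of the gluing.\<close>

lemma (in contact_set) continuous_map_from_X:
  assumes "h ` topspace X \<subseteq> topspace Y"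
    and "\<And>\<gamma>. \<gamma> \<in> N \<Longrightarrow> continuous_map (top_of_set {0..\<infinity>}) Y (\<lambda>t. h (pt \<gamma> t))"
  shows "continuous_map X Y h"
  unfolding continuous_map_def
proof (intro conjI allI impI)
  show "h \<in> topspace X \<rightarrow> topspace Y" using assms(1) by auto
  fix U assume U: "openin Y U"
  show "openin X {x \<in> topspace X. h x \<in> U}"
    unfolding openin_X_iff
  proof (intro conjI ballI)
    fix \<gamma> assume \<gamma>: "\<gamma> \<in> N"
    have "{t \<in> {0..\<infinity>}. pt \<gamma> t \<in> {x \<in> topspace X. h x \<in> U}} = {t \<in> topspace (top_of_set {0..\<infinity>}). h (pt \<gamma> t) \<in> U}"
      using \<gamma> by (auto simp: pt_in_X)
    thus "openin (top_of_set {0..\<infinity>}) {t \<in> {0..\<infinity>}. pt \<gamma> t \<in> {x \<in> topspace X. h x \<in> U}}"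
      using openin_continuous_map_preimage[OF assms(2)[OF \<gamma>] U] by simp
  qed auto
qed

text \<open>A bijection of leaves together with a change of heights on each path.
  \<open>height_cong\<close> makes the changes agree where paths are glued and
  \<open>valuation_f\<close> sends branching heights to branching heights. The orders of the leaves
  are left free, since the integrated structure changes them.\<close>

locale contact_map = D: contact_set N + E: contact_set M for N M +
  fixes f :: "real puiseux \<Rightarrow> real puiseux" and \<phi> :: "real puiseux \<Rightarrow> ereal \<Rightarrow> ereal"
  assumes bij_f: "bij_betw f N M"
    and continuous_height: "\<And>\<gamma>. \<gamma> \<in> N \<Longrightarrow> continuous_on {0..} (\<phi> \<gamma>)"
    and height_less: "\<And>\<gamma> s t. \<gamma> \<in> N \<Longrightarrow> 0 \<le> s \<Longrightarrow> s < t \<Longrightarrow> \<phi> \<gamma> s < \<phi> \<gamma> t"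
    and height_0: "\<And>\<gamma>. \<gamma> \<in> N \<Longrightarrow> \<phi> \<gamma> 0 = 0"
    and height_inf: "\<And>\<gamma>. \<gamma> \<in> N \<Longrightarrow> \<phi> \<gamma> \<infinity> = \<infinity>"
    and height_cong: "\<And>\<gamma> \<gamma>' t. \<gamma> \<in> N \<Longrightarrow> \<gamma>' \<in> N \<Longrightarrow> 0 \<le> t \<Longrightarrow> t \<le> valuation (\<gamma> - \<gamma>') \<Longrightarrow> \<phi> \<gamma> t = \<phi> \<gamma>' t"
    and valuation_f: "\<And>\<gamma> \<gamma>'. \<gamma> \<in> N \<Longrightarrow> \<gamma>' \<in> N \<Longrightarrow> valuation (f \<gamma> - f \<gamma>') = \<phi> \<gamma> (valuation (\<gamma> - \<gamma>'))"
begin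

text \<open>A point is an equivalence class; taking its image elementwise avoids a choice of
  representative, and \<open>point_map_pt\<close> shows that the image is again a full
  class.\<close>

definition point_map :: "(real puiseux \<times> ereal) set \<Rightarrow> (real puiseux \<times> ereal) set" where
  "point_map P = (\<lambda>(\<gamma>, t). (f \<gamma>, \<phi> \<gamma> t)) ` P"

lemma f_in: "\<gamma> \<in> N \<Longrightarrow> f \<gamma> \<in> M" using bij_f by (auto simp: bij_betw_def)

lemma height_le_iff: "\<gamma> \<in> N \<Longrightarrow> 0 \<le> s \<Longrightarrow> 0 \<le> t \<Longrightarrow> \<phi> \<gamma> s \<le> \<phi> \<gamma> t \<longleftrightarrow> s \<le> t"
  by (metis height_less le_less linorder_not_less)

lemma height_less_iff: "\<gamma> \<in> N \<Longrightarrow> 0 \<le> s \<Longrightarrow> 0 \<le> t \<Longrightarrow> \<phi> \<gamma> s < \<phi> \<gamma> t \<longleftrightarrow> s < t"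
  by (metis height_le_iff not_le)

lemma height_eq_iff: "\<gamma> \<in> N \<Longrightarrow> 0 \<le> s \<Longrightarrow> 0 \<le> t \<Longrightarrow> \<phi> \<gamma> s = \<phi> \<gamma> t \<longleftrightarrow> s = t"
  by (metis height_le_iff antisym order_refl)

lemma height_nonneg: "\<gamma> \<in> N \<Longrightarrow> 0 \<le> t \<Longrightarrow> 0 \<le> \<phi> \<gamma> t"
  using height_le_iff[of \<gamma> 0 t] height_0 by simp

lemma height_image:
  assumes "\<gamma> \<in> N" "0 \<le> a" "a \<le> b"
  shows "\<phi> \<gamma> ` {a..b} = {\<phi> \<gamma> a..\<phi> \<gamma> b}"
proof (intro subset_antisym subsetI)
  fix y assume "y \<in> \<phi> \<gamma> ` {a..b}"
  thus "y \<in> {\<phi> \<gamma> a..\<phi> \<gamma> b}" using assms height_le_iff[OF assms(1)] by auto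
next
  fix y assume y: "y \<in> {\<phi> \<gamma> a..\<phi> \<gamma> b}"
  have "continuous_on {a..b} (\<phi> \<gamma>)"
    using assms(2) by (intro continuous_on_subset[OF continuous_height[OF assms(1)]]) auto
  thus "y \<in> \<phi> \<gamma> ` {a..b}" using IVT'[of "\<phi> \<gamma>" a y b] y assms(3) by auto
qed

lemma point_map_pt:
  assumes "\<gamma> \<in> N" "0 \<le> t"
  shows "point_map (D.pt \<gamma> t) = E.pt (f \<gamma>) (\<phi> \<gamma> t)"
proof -
  have *: "t \<le> valuation (\<gamma> - \<gamma>') \<longleftrightarrow> \<phi> \<gamma> t \<le> valuation (f \<gamma> - f \<gamma>')" if "\<gamma>' \<in> N" for \<gamma>'
    using that assms D.valuation_pos[OF assms(1) that] by (simp add: valuation_f height_le_iff)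
  have "D.pt \<gamma> t = (\<lambda>\<gamma>'. (\<gamma>', t)) ` {\<gamma>'\<in>N. t \<le> valuation (\<gamma> - \<gamma>')}"
    by (auto simp: D.pt_eq[OF assms])
  hence "point_map (D.pt \<gamma> t) = (\<lambda>\<gamma>'. (f \<gamma>', \<phi> \<gamma>' t)) ` {\<gamma>'\<in>N. t \<le> valuation (\<gamma> - \<gamma>')}"
    by (simp add: point_map_def image_image)
  also have "\<dots> = (\<lambda>\<gamma>'. (f \<gamma>', \<phi> \<gamma> t)) ` {\<gamma>'\<in>N. t \<le> valuation (\<gamma> - \<gamma>')}"
    by (rule image_cong) (use height_cong[OF assms(1) _ assms(2)] in auto)
  also have "\<dots> = (\<lambda>\<delta>. (\<delta>, \<phi> \<gamma> t)) ` f ` {\<gamma>'\<in>N. t \<le> valuation (\<gamma> - \<gamma>')}"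
    by (simp add: image_image)
  also have "f ` {\<gamma>'\<in>N. t \<le> valuation (\<gamma> - \<gamma>')} = {\<delta>\<in>M. \<phi> \<gamma> t \<le> valuation (f \<gamma> - \<delta>)}"
    using bij_f * by (auto simp: bij_betw_def)
  also have "(\<lambda>\<delta>. (\<delta>, \<phi> \<gamma> t)) ` \<dots> = E.pt (f \<gamma>) (\<phi> \<gamma> t)"
    by (auto simp: E.pt_eq[OF f_in[OF assms(1)] height_nonneg[OF assms]])
  finally show ?thesis .
qed

lemma continuous_map_point_map: "continuous_map D.X E.X point_map"
proof (rule D.continuous_map_from_X)
  show "point_map ` topspace D.X \<subseteq> topspace E.X"
    using f_in height_nonneg E.pt_in_X by (auto simp: D.topspace_X point_map_pt)
  fix \<gamma> assume \<gamma>: "\<gamma> \<in> N"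
  have "continuous_map (top_of_set {0..\<infinity>}) (top_of_set {0..\<infinity>}) (\<phi> \<gamma>)"
  proof (rule continuous_map_into_subtopology)
    have "{0..\<infinity>} = {0::ereal..}" by auto
    thus "continuous_map (top_of_set {0..\<infinity>}) euclidean (\<phi> \<gamma>)" using continuous_height[OF \<gamma>] by simp
  qed (use height_nonneg[OF \<gamma>] in auto)
  from continuous_map_compose[OF this E.continuous_map_pt[OF f_in[OF \<gamma>]]]
  show "continuous_map (top_of_set {0..\<infinity>}) E.X (\<lambda>t. point_map (D.pt \<gamma> t))"
    by (rule continuous_map_eq) (use \<gamma> in \<open>auto simp: point_map_pt\<close>)
qed

definition inv_f :: "real puiseux \<Rightarrow> real puiseux" where "inv_f = inv_into N f"

definition inv_height :: "real puiseux \<Rightarrow> ereal \<Rightarrow> ereal" where "inv_height \<delta> = inv_into {0..} (\<phi> (inv_f \<delta>))"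

lemma inv_f_f: "\<gamma> \<in> N \<Longrightarrow> inv_f (f \<gamma>) = \<gamma>" using bij_f by (simp add: inv_f_def bij_betw_def)

lemma f_inv_f: "\<delta> \<in> M \<Longrightarrow> f (inv_f \<delta>) = \<delta>" using bij_f by (simp add: inv_f_def bij_betw_inv_into_right)

lemma inv_f_in: "\<delta> \<in> M \<Longrightarrow> inv_f \<delta> \<in> N" using bij_f bij_betwE[OF bij_betw_inv_into[OF bij_f]] by (simp add: inv_f_def)

lemma inj_height: "\<gamma> \<in> N \<Longrightarrow> inj_on (\<phi> \<gamma>) {0..}"
  by (auto simp: inj_on_def height_eq_iff)

lemma height_surj: "\<gamma> \<in> N \<Longrightarrow> \<phi> \<gamma> ` {0..} = {0..}"
proof -
  have "{0..} = {0..\<infinity>::ereal}" by auto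
  thus "\<gamma> \<in> N \<Longrightarrow> \<phi> \<gamma> ` {0..} = {0..}" using height_image[of \<gamma> 0 \<infinity>] by (simp add: height_0 height_inf)
qed

lemma inv_height_height: "\<gamma> \<in> N \<Longrightarrow> 0 \<le> t \<Longrightarrow> inv_height (f \<gamma>) (\<phi> \<gamma> t) = t"
  using inj_height by (simp add: inv_height_def inv_f_f)

lemma height_inv_height: "\<delta> \<in> M \<Longrightarrow> 0 \<le> t \<Longrightarrow> \<phi> (inv_f \<delta>) (inv_height \<delta> t) = t"
  using height_surj[OF inv_f_in] by (simp add: inv_height_def f_inv_into_f)

lemma inv_height_nonneg: "\<delta> \<in> M \<Longrightarrow> 0 \<le> t \<Longrightarrow> 0 \<le> inv_height \<delta> t"
  using height_surj[OF inv_f_in] inv_into_into[of t "\<phi> (inv_f \<delta>)" "{0..}"] by (simp add: inv_height_def)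

text \<open>The inverse data satisfy the same conditions, so continuity of the inverse point map is
  an instance of continuity of the point map. Compactness of [0, \<infinity>] makes the inverse
  height change continuous.\<close>

lemma inverse_contact_map: "contact_map M N inv_f inv_height"
proof unfold_locales
  show "bij_betw inv_f M N" unfolding inv_f_def by (rule bij_betw_inv_into[OF bij_f])
  fix \<delta> assume \<delta>: "\<delta> \<in> M"
  note \<gamma> = inv_f_in[OF \<delta>]
  show "continuous_on {0..} (inv_height \<delta>)"
  proof -
    have "compact ({0..} :: ereal set)"
      using closed_Int_compact[of "{0..}" "UNIV :: ereal set"] by (simp add: compact_UNIV)
    from continuous_on_inv[OF continuous_height[OF \<gamma>] this, of "inv_height \<delta>"]
    show ?thesis using inv_height_height[OF \<gamma>] f_inv_f[OF \<delta>] height_surj[OF \<gamma>] by simp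
  qed
  show "inv_height \<delta> 0 = 0" using inv_height_height[OF \<gamma>, of 0] by (simp add: height_0[OF \<gamma>] f_inv_f[OF \<delta>])
  show "inv_height \<delta> \<infinity> = \<infinity>" using inv_height_height[OF \<gamma>, of \<infinity>] by (simp add: height_inf[OF \<gamma>] f_inv_f[OF \<delta>])
  show "inv_height \<delta> s < inv_height \<delta> t" if "0 \<le> s" "s < t" for s t
    using height_less_iff[OF \<gamma> inv_height_nonneg[OF \<delta>] inv_height_nonneg[OF \<delta>], of s t] that
    by (simp add: height_inv_height[OF \<delta>])
  fix \<delta>' assume \<delta>': "\<delta>' \<in> M"
  have v: "valuation (\<delta> - \<delta>') = \<phi> (inv_f \<delta>) (valuation (inv_f \<delta> - inv_f \<delta>'))"
    using valuation_f[OF \<gamma> inv_f_in[OF \<delta>']] by (simp add: f_inv_f \<delta> \<delta>')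
  have v0: "0 \<le> valuation (inv_f \<delta> - inv_f \<delta>')" using D.valuation_pos[OF \<gamma> inv_f_in[OF \<delta>']] by simp
  show "valuation (inv_f \<delta> - inv_f \<delta>') = inv_height \<delta> (valuation (\<delta> - \<delta>'))"
    using inv_height_height[OF \<gamma> v0] by (simp add: v f_inv_f[OF \<delta>])
  fix t assume t: "0 \<le> t" "t \<le> valuation (\<delta> - \<delta>')"
  have "inv_height \<delta> t \<le> valuation (inv_f \<delta> - inv_f \<delta>')"
    using t height_le_iff[OF \<gamma> inv_height_nonneg[OF \<delta> t(1)] v0] by (simp add: v[symmetric] height_inv_height[OF \<delta>])
  hence "\<phi> (inv_f \<delta>') (inv_height \<delta> t) = t"
    using height_cong[OF \<gamma> inv_f_in[OF \<delta>'] inv_height_nonneg[OF \<delta> t(1)]] height_inv_height[OF \<delta> t(1)] by simp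
  thus "inv_height \<delta> t = inv_height \<delta>' t"
    using inv_height_height[OF inv_f_in[OF \<delta>'] inv_height_nonneg[OF \<delta> t(1)]] by (simp add: f_inv_f[OF \<delta>'])
qed

lemma homeomorphic_map_point_map: "homeomorphic_map D.X E.X point_map"
proof -
  interpret I: contact_map M N inv_f inv_height by (rule inverse_contact_map)
  have "homeomorphic_maps D.X E.X point_map I.point_map"
    unfolding homeomorphic_maps_def
  proof (intro conjI ballI continuous_map_point_map I.continuous_map_point_map)
    fix P assume "P \<in> topspace D.X"
    then obtain \<gamma> t where "P = D.pt \<gamma> t" "\<gamma> \<in> N" "0 \<le> t" unfolding D.topspace_X by blast
    thus "I.point_map (point_map P) = P"
      by (simp add: point_map_pt I.point_map_pt f_in height_nonneg inv_f_f inv_height_height)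
  next
    fix P assume "P \<in> topspace E.X"
    then obtain \<delta> t where "P = E.pt \<delta> t" "\<delta> \<in> M" "0 \<le> t" unfolding E.topspace_X by blast
    thus "point_map (I.point_map P) = P"
      by (simp add: point_map_pt I.point_map_pt inv_f_in inv_height_nonneg f_inv_f height_inv_height)
  qed
  thus ?thesis by (auto simp: homeomorphic_map_maps)
qed

lemma point_map_root: "point_map D.rt = E.rt"
proof -
  have "point_map D.rt = f ` N \<times> {0}"
    using height_0 by (force simp: point_map_def contact_root_def)
  thus ?thesis using bij_f by (simp add: contact_root_def bij_betw_def)
qed

lemma crit_f: "\<gamma> \<in> N \<Longrightarrow> E.crit (f \<gamma>) = \<phi> \<gamma> ` D.crit \<gamma>"
  using bij_f by (auto simp: E.crit_def D.crit_def bij_betw_def height_0 valuation_f image_iff)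

lemma nxt_f:
  assumes "\<gamma> \<in> N" "0 \<le> p" "p < \<infinity>"
  shows "E.nxt (f \<gamma>) (\<phi> \<gamma> p) = \<phi> \<gamma> (D.nxt \<gamma> p)"
proof -
  have p: "\<phi> \<gamma> p < \<infinity>" using height_less[OF assms] by (simp add: height_inf[OF assms(1)])
  have 0: "0 \<le> q" if "q \<in> D.crit \<gamma>" for q using that D.crit_nonneg assms by blast
  note n = D.nxt_in_crit[OF assms(1,3)] D.less_nxt[OF assms(1,3)]
  show ?thesis
  proof (rule antisym)
    show "E.nxt (f \<gamma>) (\<phi> \<gamma> p) \<le> \<phi> \<gamma> (D.nxt \<gamma> p)"
      using n height_less[OF assms(1,2)] by (intro E.nxt_le f_in assms p) (auto simp: crit_f[OF assms(1)])
    obtain q where q: "q \<in> D.crit \<gamma>" "E.nxt (f \<gamma>) (\<phi> \<gamma> p) = \<phi> \<gamma> q"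
      using E.nxt_in_crit[OF f_in[OF assms(1)] p] crit_f[OF assms(1)] by auto
    have "\<phi> \<gamma> p < \<phi> \<gamma> q" using E.less_nxt[OF f_in[OF assms(1)] p] q by simp
    hence "p < q" using height_less_iff[OF assms(1,2) 0[OF q(1)]] by simp
    hence "D.nxt \<gamma> p \<le> q" using D.nxt_le[OF assms(1,3) q(1)] by simp
    thus "\<phi> \<gamma> (D.nxt \<gamma> p) \<le> E.nxt (f \<gamma>) (\<phi> \<gamma> p)" unfolding q(2)
      using height_le_iff[OF assms(1) 0[OF n(1)] 0[OF q(1)]] by simp
  qed
qed

lemma point_map_out:
  assumes "\<gamma> \<in> N" "0 \<le> p" "p < \<infinity>"
  shows "point_map ` D.out \<gamma> p = E.out (f \<gamma>) (\<phi> \<gamma> p)"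
proof -
  note n = D.less_nxt[OF assms(1,3)]
  have "point_map ` D.out \<gamma> p = (\<lambda>t. E.pt (f \<gamma>) (\<phi> \<gamma> t)) ` {p..D.nxt \<gamma> p}"
    unfolding D.out_def D.arc_def image_image
    by (rule image_cong) (use assms point_map_pt in auto)
  also have "\<dots> = E.pt (f \<gamma>) ` {\<phi> \<gamma> p..\<phi> \<gamma> (D.nxt \<gamma> p)}"
    using height_image[of \<gamma> p "D.nxt \<gamma> p"] assms n by (simp flip: image_image)
  finally show ?thesis by (simp add: E.out_def E.arc_def nxt_f[OF assms])
qed

text \<open>The height changes of \<gamma>, \<gamma>1 and \<gamma>2 agree at p, so the images are
  the corresponding edges of the target. Only the order of the image leaves can differ from the
  source.\<close>

lemma edge_less_point_map:
  assumes \<gamma>: "\<gamma> \<in> N" "p \<in> D.crit \<gamma>" "p < \<infinity>"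
    and \<gamma>12: "\<gamma>1 \<in> N" "\<gamma>2 \<in> N" "p \<le> valuation (\<gamma> - \<gamma>1)" "p \<le> valuation (\<gamma> - \<gamma>2)"
  shows "edge_less (real_contact_tree M) (point_map (D.pt \<gamma> p)) (point_map ` D.out \<gamma>1 p) (point_map ` D.out \<gamma>2 p) \<longleftrightarrow>
    valuation (\<gamma>1 - \<gamma>2) = p \<and> f \<gamma>1 < f \<gamma>2"
proof -
  note p0 = D.crit_nonneg[OF \<gamma>(1,2)]
  have c: "\<phi> \<gamma>1 p = \<phi> \<gamma> p" "\<phi> \<gamma>2 p = \<phi> \<gamma> p"
    using height_cong[OF \<gamma>(1) \<gamma>12(1) p0] height_cong[OF \<gamma>(1) \<gamma>12(2) p0] \<gamma>12 by auto
  have v0: "0 \<le> valuation (\<gamma> - \<gamma>1)" "0 \<le> valuation (\<gamma> - \<gamma>2)" "0 \<le> valuation (\<gamma>1 - \<gamma>2)"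
    using D.valuation_pos \<gamma>(1) \<gamma>12(1,2) by (simp_all add: less_imp_le)
  have "edge_less (real_contact_tree M) (point_map (D.pt \<gamma> p)) (point_map ` D.out \<gamma>1 p) (point_map ` D.out \<gamma>2 p) \<longleftrightarrow>
      edge_less (real_contact_tree M) (E.pt (f \<gamma>) (\<phi> \<gamma> p)) (E.out (f \<gamma>1) (\<phi> \<gamma> p)) (E.out (f \<gamma>2) (\<phi> \<gamma> p))"
    using \<gamma> \<gamma>12 p0 by (simp add: point_map_pt point_map_out c)
  also have "\<dots> \<longleftrightarrow> valuation (f \<gamma>1 - f \<gamma>2) = \<phi> \<gamma> p \<and> f \<gamma>1 < f \<gamma>2"
  proof (rule E.edge_less_iff)
    show "\<phi> \<gamma> p < \<infinity>" using height_less[OF \<gamma>(1) p0 \<gamma>(3)] by (simp add: height_inf[OF \<gamma>(1)])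
  qed (use \<gamma> \<gamma>12 p0 v0 in \<open>auto simp: f_in crit_f valuation_f height_le_iff\<close>)
  also have "valuation (f \<gamma>1 - f \<gamma>2) = \<phi> \<gamma> p \<longleftrightarrow> valuation (\<gamma>1 - \<gamma>2) = p"
    unfolding c(1)[symmetric] using \<gamma>12 v0 p0 by (simp add: valuation_f height_eq_iff)
  finally show ?thesis .
qed

text \<open>The underlying rooted trees are already matched, so T may carry any planar structure
  that becomes the order of the images under f.\<close>

lemma planar_isomorphicI:
  assumes T: "tree_space T = D.X" "tree_root T = D.rt"
    and less: "\<And>\<gamma> p \<gamma>1 \<gamma>2. D.pt \<gamma> p \<in> internal_vertices D.X D.rt \<Longrightarrow> \<gamma> \<in> N \<Longrightarrow> p \<in> D.crit \<gamma> \<Longrightarrow> p < \<infinity> \<Longrightarrow>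
      \<gamma>1 \<in> N \<Longrightarrow> \<gamma>2 \<in> N \<Longrightarrow> p \<le> valuation (\<gamma> - \<gamma>1) \<Longrightarrow> p \<le> valuation (\<gamma> - \<gamma>2) \<Longrightarrow>
      edge_less T (D.pt \<gamma> p) (D.out \<gamma>1 p) (D.out \<gamma>2 p) \<longleftrightarrow> valuation (\<gamma>1 - \<gamma>2) = p \<and> f \<gamma>1 < f \<gamma>2"
  shows "planar_isomorphic T (real_contact_tree M)"
  unfolding planar_isomorphic_def T
proof (intro exI[of _ point_map] conjI ballI)
  show "homeomorphic_map D.X (tree_space (real_contact_tree M)) point_map"
    "point_map D.rt = tree_root (real_contact_tree M)"
    using homeomorphic_map_point_map point_map_root by (simp_all add: real_contact_tree_def Let_def)
  fix P e e' assume P: "P \<in> internal_vertices D.X D.rt"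
    and e: "e \<in> outgoing_edges D.X D.rt P" "e' \<in> outgoing_edges D.X D.rt P"
  from P obtain \<gamma> p where p: "\<gamma> \<in> N" "p \<in> D.crit \<gamma>" "0 \<le> p" "p < \<infinity>" "P = D.pt \<gamma> p"
    by (rule D.internal_vertexE)
  obtain \<gamma>1 \<gamma>2 where "\<gamma>1 \<in> N" "\<gamma>2 \<in> N" "p \<le> valuation (\<gamma> - \<gamma>1)" "p \<le> valuation (\<gamma> - \<gamma>2)"
    "e = D.out \<gamma>1 p" "e' = D.out \<gamma>2 p"
    using e unfolding p(5) D.outgoing_edges_eq[OF p(1,2,4)] by blast
  thus "edge_less T P e e' \<longleftrightarrow> edge_less (real_contact_tree M) (point_map P) (point_map ` e) (point_map ` e')"
    using less[of \<gamma> p \<gamma>1 \<gamma>2] edge_less_point_map[of \<gamma> p \<gamma>1 \<gamma>2] P p by simp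
qed

end

section \<open>Positions of outgoing edges and discrete integrals\<close>

text \<open>Were a and b to separate earlier than a and c, then c - b would have the leading term of
  a - b, which is negative. It follows that the leaves above a point form an interval in the
  order.\<close>

lemma valuation_mono_between:
  fixes a b c :: "'a::linordered_idom puiseux"
  assumes "a \<le> b" "b \<le> c"
  shows "valuation (a - c) \<le> valuation (a - b)" "valuation (a - c) \<le> valuation (b - c)"
proof -
  show 1: "valuation (a - c) \<le> valuation (a - b)"
  proof (rule ccontr)
    assume "\<not> ?thesis"
    hence lt: "valuation (a - b) < valuation (c - a)" by (simp add: valuation_minus_commute[of c a])
    from initial_coeff_add_dominant(1)[OF lt] have "initial_coeff (c - b) = initial_coeff (a - b)" by simp
    moreover have "a \<noteq> b" using lt by auto
    hence "initial_coeff (a - b) < 0"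
      using assms(1) initial_coeff_uminus[of "b - a"] by (auto simp: less_eq_puiseux_def)
    ultimately show False using assms(2) initial_coeff_0_iff[of "0 :: 'a puiseux"] by (auto simp: less_eq_puiseux_def)
  qed
  show "valuation (a - c) \<le> valuation (b - c)"
    using valuation_ultrametric[of b a c] 1 valuation_minus_commute[of a b] by simp
qed

lemma initial_coeff_eq_coeff:
  assumes "valuation a = ereal (of_rat q)"
  shows "initial_coeff a = puiseux_coeff a q"
proof -
  have "a \<noteq> 0" using assms by auto
  hence "(LEAST q. puiseux_coeff a q \<noteq> 0) = q" using assms by (simp add: valuation_def)
  thus ?thesis by (simp add: initial_coeff_def)
qed

lemma puiseux_coeff_below_valuation:
  "ereal (of_rat q) < valuation a \<Longrightarrow> puiseux_coeff a q = 0"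
  using valuation_ge_iff[of "valuation a" a] by (metis not_le order_refl)

text \<open>Matches the counting in \<open>nth_outgoing_edge\<close>: ranks are taken with respect
  to an injective map m into a linear order, since the edge order is defined only through
  leaves.\<close>

lemma
  fixes m :: "'e \<Rightarrow> 'b::linorder"
  assumes fin: "finite E" and inj: "inj_on m E"
  defines "rk \<equiv> \<lambda>e. Suc (card {e' \<in> E. m e' < m e})"
  shows rank_less_iff: "e \<in> E \<Longrightarrow> e' \<in> E \<Longrightarrow> rk e < rk e' \<longleftrightarrow> m e < m e'"
    and bij_betw_rank: "bij_betw rk E {1..card E}"
proof -
  have less: "rk e < rk e'" if "e \<in> E" "e' \<in> E" "m e < m e'" for e e'
  proof -
    have "{e'' \<in> E. m e'' < m e} \<subset> {e'' \<in> E. m e'' < m e'}" using that by auto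
    thus ?thesis using fin by (simp add: rk_def psubset_card_mono)
  qed
  show iff: "rk e < rk e' \<longleftrightarrow> m e < m e'" if "e \<in> E" "e' \<in> E" for e e'
    using less[OF that] less[OF that(2,1)] by (cases "m e" "m e'" rule: linorder_cases) (auto simp: rk_def)
  have inj_rank: "inj_on rk E"
  proof (rule inj_onI)
    fix e e' assume "e \<in> E" "e' \<in> E" "rk e = rk e'"
    hence "m e = m e'" using iff[of e e'] iff[of e' e] by (metis less_irrefl linorder_less_linear)
    thus "e = e'" using inj \<open>e \<in> E\<close> \<open>e' \<in> E\<close> by (auto dest: inj_onD)
  qed
  have "rk ` E \<subseteq> {1..card E}"
  proof
    fix k assume "k \<in> rk ` E"
    then obtain e where e: "e \<in> E" "k = rk e" by blast
    have "{e' \<in> E. m e' < m e} \<subset> E" using e by auto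
    hence "card {e' \<in> E. m e' < m e} < card E" using fin by (rule psubset_card_mono[rotated])
    thus "k \<in> {1..card E}" using e by (auto simp: rk_def)
  qed
  moreover have "card (rk ` E) = card {1..card E}" using card_image[OF inj_rank] by simp
  ultimately have "rk ` E = {1..card E}" by (intro card_subset_eq) auto
  thus "bij_betw rk E {1..card E}" using inj_rank by (simp add: bij_betw_def)
qed

section \<open>Numbering of the outgoing edges at a vertex\<close>

context contact_set begin

definition above :: "real puiseux \<Rightarrow> ereal \<Rightarrow> real puiseux set" where
  "above \<gamma> p = {\<gamma>'\<in>N. p \<le> v \<gamma> \<gamma>'}"

text \<open>\<open>position \<gamma> p \<gamma>'\<close> is the index \<open>k\<close> such that the outgoing edge \<open>e\<^sub>k\<close> at \<open>P = pt \<gamma> p\<close> goes towards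
  the leaf \<open>\<gamma>'\<close>.\<close>

definition position :: "real puiseux \<Rightarrow> ereal \<Rightarrow> real puiseux \<Rightarrow> nat" where
  "position \<gamma> p \<gamma>' = Suc (card {e \<in> outgoing_edges X rt (pt \<gamma> p).
     edge_less (real_contact_tree N) (pt \<gamma> p) e (out \<gamma>' p)})"

lemma above_v: "\<gamma>1 \<in> above \<gamma> p \<Longrightarrow> \<gamma>2 \<in> above \<gamma> p \<Longrightarrow> p \<le> v \<gamma>1 \<gamma>2"
  using v_ultra[of p \<gamma>1 \<gamma> \<gamma>2] v_commute[of \<gamma>1 \<gamma>] by (simp add: above_def)

text \<open>Allows the consecutive roots between two leaves above P to be traversed without leaving
  the subtree above P.\<close>

lemma above_between:
  assumes "\<gamma>1 \<in> above \<gamma> p" "\<gamma>3 \<in> above \<gamma> p" "\<gamma>2 \<in> N" "\<gamma>1 \<le> \<gamma>2" "\<gamma>2 \<le> \<gamma>3"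
  shows "\<gamma>2 \<in> above \<gamma> p"
proof -
  have "p \<le> v \<gamma>1 \<gamma>2"
    using above_v[OF assms(1,2)] valuation_mono_between(1)[OF assms(4,5)] by (rule order_trans)
  thus ?thesis using assms v_ultra[of p \<gamma> \<gamma>1 \<gamma>2] by (simp add: above_def)
qed

context
  fixes \<gamma> p
  assumes \<gamma>: "\<gamma> \<in> N" "p \<in> crit \<gamma>" "p < \<infinity>"
begin

lemma outgoing_above: "outgoing_edges X rt (pt \<gamma> p) = (\<lambda>\<gamma>'. out \<gamma>' p) ` above \<gamma> p"
  unfolding above_def by (rule outgoing_edges_eq[OF \<gamma>])

lemma edge_less_above:
  "\<gamma>1 \<in> above \<gamma> p \<Longrightarrow> \<gamma>2 \<in> above \<gamma> p \<Longrightarrow>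
    edge_less (real_contact_tree N) (pt \<gamma> p) (out \<gamma>1 p) (out \<gamma>2 p) \<longleftrightarrow> v \<gamma>1 \<gamma>2 = p \<and> \<gamma>1 < \<gamma>2"
  by (rule edge_less_iff[OF \<gamma>]) (simp_all add: above_def)

lemma out_above_eq_iff:
  "\<gamma>1 \<in> above \<gamma> p \<Longrightarrow> \<gamma>2 \<in> above \<gamma> p \<Longrightarrow> out \<gamma>1 p = out \<gamma>2 p \<longleftrightarrow> p < v \<gamma>1 \<gamma>2"
  using out_eq_iff crit_nonneg[OF \<gamma>(1,2)] \<gamma>(3) by (simp add: above_def)

lemma v_above_cases: "\<gamma>1 \<in> above \<gamma> p \<Longrightarrow> \<gamma>2 \<in> above \<gamma> p \<Longrightarrow> v \<gamma>1 \<gamma>2 = p \<or> p < v \<gamma>1 \<gamma>2"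
  using above_v by (auto simp: le_less)

text \<open>A definite leaf above each outgoing edge. It makes the edge order the pullback of the
  linear order on series, so that ranks apply.\<close>

definition first_root :: "(real puiseux \<times> ereal) set set \<Rightarrow> real puiseux" where
  "first_root e = Min {\<delta> \<in> above \<gamma> p. out \<delta> p = e}"

lemma first_root:
  assumes "e \<in> outgoing_edges X rt (pt \<gamma> p)"
  shows "first_root e \<in> above \<gamma> p" "out (first_root e) p = e"
proof -
  have "finite {\<delta> \<in> above \<gamma> p. out \<delta> p = e}" using finite_N by (simp add: above_def)
  moreover have "{\<delta> \<in> above \<gamma> p. out \<delta> p = e} \<noteq> {}" using assms by (auto simp: outgoing_above)
  ultimately have "first_root e \<in> {\<delta> \<in> above \<gamma> p. out \<delta> p = e}" unfolding first_root_def by (rule Min_in)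
  thus "first_root e \<in> above \<gamma> p" "out (first_root e) p = e" by auto
qed

lemma edge_less_first_root:
  assumes "e \<in> outgoing_edges X rt (pt \<gamma> p)" "e' \<in> outgoing_edges X rt (pt \<gamma> p)"
  shows "edge_less (real_contact_tree N) (pt \<gamma> p) e e' \<longleftrightarrow> first_root e < first_root e'"
proof -
  note f = first_root[OF assms(1)] first_root[OF assms(2)]
  have "v (first_root e) (first_root e') = p" if "first_root e < first_root e'"
  proof -
    have "e \<noteq> e'" using that by auto
    thus ?thesis using out_above_eq_iff[OF f(1,3)] v_above_cases[OF f(1,3)] f(2,4) by auto
  qed
  thus ?thesis using edge_less_above[OF f(1,3)] f(2,4) by auto
qed

lemma finite_outgoing: "finite (outgoing_edges X rt (pt \<gamma> p))"
  using finite_N by (simp add: outgoing_above above_def)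

lemma inj_first_root: "inj_on first_root (outgoing_edges X rt (pt \<gamma> p))"
  by (rule inj_onI) (metis first_root(2))

lemma position_eq_rank:
  assumes "e \<in> outgoing_edges X rt (pt \<gamma> p)"
  shows "Suc (card {e' \<in> outgoing_edges X rt (pt \<gamma> p). edge_less (real_contact_tree N) (pt \<gamma> p) e' e}) =
    Suc (card {e' \<in> outgoing_edges X rt (pt \<gamma> p). first_root e' < first_root e})"
  using edge_less_first_root[OF _ assms] by (metis (no_types, lifting) mem_Collect_eq)

lemma out_in_outgoing: "\<gamma>1 \<in> above \<gamma> p \<Longrightarrow> out \<gamma>1 p \<in> outgoing_edges X rt (pt \<gamma> p)"
  by (simp add: outgoing_above)

lemma position_less_iff:
  assumes "\<gamma>1 \<in> above \<gamma> p" "\<gamma>2 \<in> above \<gamma> p"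
  shows "position \<gamma> p \<gamma>1 < position \<gamma> p \<gamma>2 \<longleftrightarrow> v \<gamma>1 \<gamma>2 = p \<and> \<gamma>1 < \<gamma>2"
  unfolding position_def position_eq_rank[OF out_in_outgoing[OF assms(1)]] position_eq_rank[OF out_in_outgoing[OF assms(2)]]
  using rank_less_iff[OF finite_outgoing inj_first_root out_in_outgoing[OF assms(1)] out_in_outgoing[OF assms(2)]]
    edge_less_first_root[OF out_in_outgoing[OF assms(1)] out_in_outgoing[OF assms(2)]] edge_less_above[OF assms]
  by simp

lemma position_eq_iff:
  assumes "\<gamma>1 \<in> above \<gamma> p" "\<gamma>2 \<in> above \<gamma> p"
  shows "position \<gamma> p \<gamma>1 = position \<gamma> p \<gamma>2 \<longleftrightarrow> p < v \<gamma>1 \<gamma>2"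
proof
  assume "p < v \<gamma>1 \<gamma>2"
  hence "out \<gamma>1 p = out \<gamma>2 p" using out_above_eq_iff[OF assms] by simp
  thus "position \<gamma> p \<gamma>1 = position \<gamma> p \<gamma>2" by (simp add: position_def)
next
  assume eq: "position \<gamma> p \<gamma>1 = position \<gamma> p \<gamma>2"
  show "p < v \<gamma>1 \<gamma>2"
  proof (rule ccontr)
    assume "\<not> ?thesis"
    hence v: "v \<gamma>1 \<gamma>2 = p" "v \<gamma>2 \<gamma>1 = p" using v_above_cases[OF assms] v_commute[of \<gamma>1 \<gamma>2] by auto
    hence "\<gamma>1 \<noteq> \<gamma>2" using \<gamma>(3) by auto
    thus False using eq v position_less_iff[OF assms] position_less_iff[OF assms(2,1)]
      by (cases \<gamma>1 \<gamma>2 rule: linorder_cases) auto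
  qed
qed

lemma nth_outgoing_edge_rank:
  "\<exists>!e. e \<in> outgoing_edges X rt (pt \<gamma> p) \<and>
     Suc (card {e' \<in> outgoing_edges X rt (pt \<gamma> p). edge_less (real_contact_tree N) (pt \<gamma> p) e' e}) = k"
  if "k \<in> {1..card (outgoing_edges X rt (pt \<gamma> p))}"
  using bij_betw_rank[OF finite_outgoing inj_first_root] that position_eq_rank
  unfolding bij_betw_def inj_on_def by (smt (verit) image_iff)

lemma position_range:
  assumes "\<gamma>1 \<in> above \<gamma> p"
  shows "position \<gamma> p \<gamma>1 \<in> {1..card (outgoing_edges X rt (pt \<gamma> p))}"
  using bij_betw_apply[OF bij_betw_rank[OF finite_outgoing inj_first_root] out_in_outgoing[OF assms]]
    position_eq_rank[OF out_in_outgoing[OF assms]] by (simp add: position_def)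

lemma nth_outgoing_edge_position:
  assumes "\<gamma>1 \<in> above \<gamma> p"
  shows "nth_outgoing_edge (real_contact_tree N) (pt \<gamma> p) (position \<gamma> p \<gamma>1) = out \<gamma>1 p"
proof -
  have T: "tree_space (real_contact_tree N) = X" "tree_root (real_contact_tree N) = rt"
    by (simp_all add: real_contact_tree_def Let_def)
  show ?thesis unfolding nth_outgoing_edge_def Let_def T
    by (rule the1_equality[OF nth_outgoing_edge_rank[OF position_range[OF assms]]])
      (simp add: position_def out_in_outgoing assms)
qed

lemma position_surj:
  assumes "k \<in> {1..card (outgoing_edges X rt (pt \<gamma> p))}"
  shows "\<exists>\<gamma>1\<in>above \<gamma> p. position \<gamma> p \<gamma>1 = k"
proof -
  obtain e where e: "e \<in> outgoing_edges X rt (pt \<gamma> p)"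
    "Suc (card {e' \<in> outgoing_edges X rt (pt \<gamma> p). edge_less (real_contact_tree N) (pt \<gamma> p) e' e}) = k"
    using nth_outgoing_edge_rank[OF assms] by blast
  thus ?thesis by (auto simp: outgoing_above position_def)
qed

text \<open>An edge preceding that of \<gamma>2 goes to some leaf below \<gamma>2, hence to one that
  is at most \<gamma>1; so it is the edge of \<gamma>1 or precedes it.\<close>

lemma position_Suc:
  assumes a: "\<gamma>1 \<in> above \<gamma> p" "\<gamma>2 \<in> above \<gamma> p" and less: "\<gamma>1 < \<gamma>2" "v \<gamma>1 \<gamma>2 = p"
    and cons: "\<And>\<delta>. \<delta> \<in> N \<Longrightarrow> \<delta> \<le> \<gamma>1 \<or> \<gamma>2 \<le> \<delta>"
  shows "position \<gamma> p \<gamma>2 = Suc (position \<gamma> p \<gamma>1)"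
proof -
  let ?E = "outgoing_edges X rt (pt \<gamma> p)" and ?less = "edge_less (real_contact_tree N) (pt \<gamma> p)"
  have "{e \<in> ?E. ?less e (out \<gamma>2 p)} = insert (out \<gamma>1 p) {e \<in> ?E. ?less e (out \<gamma>1 p)}"
  proof (intro set_eqI iffI)
    fix e assume e: "e \<in> {e \<in> ?E. ?less e (out \<gamma>2 p)}"
    then obtain \<delta> where \<delta>: "\<delta> \<in> above \<gamma> p" "e = out \<delta> p" by (auto simp: outgoing_above)
    have "v \<delta> \<gamma>2 = p" "\<delta> < \<gamma>2" using e \<delta> edge_less_above[OF \<delta>(1) a(2)] by auto
    hence "\<delta> \<le> \<gamma>1" using cons[of \<delta>] \<delta> by (auto simp: above_def)
    thus "e \<in> insert (out \<gamma>1 p) {e \<in> ?E. ?less e (out \<gamma>1 p)}"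
      using e \<delta> v_above_cases[OF \<delta>(1) a(1)] out_above_eq_iff[OF \<delta>(1) a(1)] edge_less_above[OF \<delta>(1) a(1)]
      by (cases "\<delta> = \<gamma>1") auto
  next
    fix e assume e: "e \<in> insert (out \<gamma>1 p) {e \<in> ?E. ?less e (out \<gamma>1 p)}"
    show "e \<in> {e \<in> ?E. ?less e (out \<gamma>2 p)}"
    proof (cases "e = out \<gamma>1 p")
      case True
      thus ?thesis using out_in_outgoing[OF a(1)] edge_less_above[OF a] less by simp
    next
      case False
      then obtain \<delta> where \<delta>: "\<delta> \<in> above \<gamma> p" "e = out \<delta> p" using e by (auto simp: outgoing_above)
      have l: "v \<delta> \<gamma>1 = p" "\<delta> < \<gamma>1" using e False \<delta> edge_less_above[OF \<delta>(1) a(1)] by auto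
      have "v \<delta> \<gamma>2 \<le> p" using valuation_mono_between(1)[of \<delta> \<gamma>1 \<gamma>2] l less by simp
      hence "v \<delta> \<gamma>2 = p" using v_above_cases[OF \<delta>(1) a(2)] by auto
      thus ?thesis using \<delta> out_in_outgoing[OF \<delta>(1)] edge_less_above[OF \<delta>(1) a(2)] l less by auto
    qed
  qed
  moreover have "out \<gamma>1 p \<notin> {e \<in> ?E. ?less e (out \<gamma>1 p)}" using edge_less_above[OF a(1) a(1)] by simp
  moreover have "finite {e \<in> ?E. ?less e (out \<gamma>1 p)}" using finite_outgoing by simp
  ultimately show ?thesis by (simp add: position_def)
qed

end

end

section \<open>Increments of the primitive along consecutive leaves\<close>

locale ordered_contact_set = contact_set +
  fixes n :: nat and \<xi> :: "nat \<Rightarrow> real puiseux"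
  assumes N_eq: "N = \<xi> ` {1..n}" and mono_\<xi>: "strict_mono_on {1..n} \<xi>"
begin

lemma \<xi>_less_iff: "i \<in> {1..n} \<Longrightarrow> j \<in> {1..n} \<Longrightarrow> \<xi> i < \<xi> j \<longleftrightarrow> i < j"
  using mono_\<xi> by (simp add: strict_mono_on_less)

lemma \<xi>_le_iff: "i \<in> {1..n} \<Longrightarrow> j \<in> {1..n} \<Longrightarrow> \<xi> i \<le> \<xi> j \<longleftrightarrow> i \<le> j"
  using mono_\<xi> by (simp add: strict_mono_on_less_eq)

lemma \<xi>_consecutive:
  assumes "1 \<le> r" "r < n" "\<delta> \<in> N"
  shows "\<delta> \<le> \<xi> r \<or> \<xi> (Suc r) \<le> \<delta>"
proof -
  obtain i where "i \<in> {1..n}" "\<delta> = \<xi> i" using assms unfolding N_eq by blast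
  thus ?thesis using assms \<xi>_le_iff[of i r] \<xi>_le_iff[of "Suc r" i] by auto
qed

context
  fixes \<gamma> p
  assumes \<gamma>: "\<gamma> \<in> N" "p \<in> crit \<gamma>" "p < \<infinity>"
begin

text \<open>Identifies the description operator in \<open>gap_index\<close>. Uniqueness holds
  because leaves on one outgoing edge are consecutive at P: no gap of height p lies between
  them.\<close>

lemma gap_index_position:
  assumes r: "1 \<le> r" "r < n" and a: "\<xi> r \<in> above \<gamma> p" "\<xi> (Suc r) \<in> above \<gamma> p" and v: "v (\<xi> r) (\<xi> (Suc r)) = p"
  shows "gap_index n \<xi> (pt \<gamma> p) (position \<gamma> p (\<xi> r)) = r"
proof -
  note p0 = crit_nonneg[OF \<gamma>(1,2)]
  have T: "tree_space (real_contact_tree N) = X" "tree_root (real_contact_tree N) = rt"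
    by (simp_all add: real_contact_tree_def Let_def)
  have in_N: "\<xi> s \<in> N" "\<xi> (Suc s) \<in> N" if "1 \<le> s" "s < n" for s using that by (auto simp: N_eq)
  have less: "\<xi> s < \<xi> (Suc s)" if "1 \<le> s" "s < n" for s using that \<xi>_less_iff[of s "Suc s"] by auto
  have suc: "Suc (position \<gamma> p (\<xi> r)) = position \<gamma> p (\<xi> (Suc r))"
    using position_Suc[OF \<gamma> a less[OF r] v \<xi>_consecutive[OF r]] by simp
  have goes: "goes_towards X (pt \<gamma> p) (out \<delta> p) (contact_leaf N \<mu>) \<longleftrightarrow> p < v \<delta> \<mu>"
    if "\<delta> \<in> above \<gamma> p" "\<mu> \<in> above \<gamma> p" for \<delta> \<mu>
  proof -
    have "pt \<gamma> p = pt \<mu> p" using that \<gamma> p0 by (simp add: pt_eq_iff above_def)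
    thus ?thesis using goes_towards_iff[of \<delta> \<mu> p] that p0 \<gamma>(3) by (simp add: above_def)
  qed
  have meet: "tree_meet X rt (contact_leaf N (\<xi> s)) (contact_leaf N (\<xi> (Suc s))) = pt \<gamma> p \<longleftrightarrow>
      v (\<xi> s) (\<xi> (Suc s)) = p \<and> \<xi> s \<in> above \<gamma> p" if "1 \<le> s" "s < n" for s
    using meet_eq_pt_iff[OF in_N[OF that] \<gamma>(1) p0] in_N[OF that] by (auto simp: above_def)
  show ?thesis
    unfolding gap_index_def Let_def N_eq[symmetric] T suc nth_outgoing_edge_position[OF \<gamma> a(1)] nth_outgoing_edge_position[OF \<gamma> a(2)]
  proof (rule the_equality)
    show "1 \<le> r \<and> r < n \<and> tree_meet X rt (contact_leaf N (\<xi> r)) (contact_leaf N (\<xi> (Suc r))) = pt \<gamma> p \<and>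
      goes_towards X (pt \<gamma> p) (out (\<xi> r) p) (contact_leaf N (\<xi> r)) \<and>
      goes_towards X (pt \<gamma> p) (out (\<xi> (Suc r)) p) (contact_leaf N (\<xi> (Suc r)))"
      using r a v meet[OF r] goes \<gamma>(3) by simp
  next
    fix s assume s: "1 \<le> s \<and> s < n \<and> tree_meet X rt (contact_leaf N (\<xi> s)) (contact_leaf N (\<xi> (Suc s))) = pt \<gamma> p \<and>
      goes_towards X (pt \<gamma> p) (out (\<xi> r) p) (contact_leaf N (\<xi> s)) \<and>
      goes_towards X (pt \<gamma> p) (out (\<xi> (Suc r)) p) (contact_leaf N (\<xi> (Suc s)))"
    hence sn: "1 \<le> s" "s < n" by auto
    hence m: "v (\<xi> s) (\<xi> (Suc s)) = p" "\<xi> s \<in> above \<gamma> p" using s meet by auto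
    hence "\<xi> (Suc s) \<in> above \<gamma> p"
      using in_N[OF sn] v_ultra[of p \<gamma> "\<xi> s" "\<xi> (Suc s)"] by (auto simp: above_def)
    hence g: "p < v (\<xi> r) (\<xi> s)" "p < v (\<xi> (Suc r)) (\<xi> (Suc s))" using s goes a m by auto
    \<comment> \<open>The contact of \<xi> i with \<xi> j is at most its contact with the next leaf,
      which is p; so the two leaves cannot lie on the same outgoing edge.\<close>
    have *: False if "1 \<le> i" "i < j" "j < n" "v (\<xi> i) (\<xi> (Suc i)) = p" "p < v (\<xi> i) (\<xi> j)" for i j
    proof -
      have "\<xi> i \<le> \<xi> (Suc i)" "\<xi> (Suc i) \<le> \<xi> j" using that \<xi>_le_iff by auto
      from valuation_mono_between(1)[OF this] show False using that by auto
    qed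
    show "s = r"
    proof (cases s r rule: linorder_cases)
      case less
      thus ?thesis using *[of s r] g(1) v_commute[of "\<xi> r" "\<xi> s"] m r sn by auto
    next
      case greater
      thus ?thesis using *[of r s] g(1) v r sn by auto
    qed
  qed
qed

text \<open>The two sides of a gap \<open>\<xi>\<^sub>r, \<xi>\<^sub>r\<^sub>+\<^sub>1\<close> with \<open>\<xi>\<^sub>r \<and> \<xi>\<^sub>r\<^sub>+\<^sub>1\<close> strictly above \<open>P\<close> lie on the same outgoing
  edge at \<open>P\<close>, so both cases fit one telescoping formula.\<close>

lemma discrete_integral_step:
  fixes F :: "real fps fps"
  assumes r: "1 \<le> r" "r < n" and a: "\<xi> r \<in> above \<gamma> p" "\<xi> (Suc r) \<in> above \<gamma> p"
  shows "discrete_integral F n \<xi> (pt \<gamma> p) (position \<gamma> p (\<xi> (Suc r)) - 1) =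
    discrete_integral F n \<xi> (pt \<gamma> p) (position \<gamma> p (\<xi> r) - 1) +
    (if v (\<xi> r) (\<xi> (Suc r)) = p then step_coeff F \<xi> r else 0)"
proof (cases "v (\<xi> r) (\<xi> (Suc r)) = p")
  case True
  have less: "\<xi> r < \<xi> (Suc r)" using r \<xi>_less_iff[of r "Suc r"] by auto
  \<comment> \<open>Positions start at 1 while the integral is taken at position minus 1; writing
    the position as a successor removes the truncated subtraction.\<close>
  obtain k where k: "position \<gamma> p (\<xi> r) = Suc k" by (auto simp: position_def)
  have "position \<gamma> p (\<xi> (Suc r)) = Suc (Suc k)"
    using position_Suc[OF \<gamma> a less True \<xi>_consecutive[OF r]] k by simp
  thus ?thesis using gap_index_position[OF r a True] True by (simp add: discrete_integral_def k)
next
  case False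
  hence "p < v (\<xi> r) (\<xi> (Suc r))" using v_above_cases[OF \<gamma> a] by simp
  hence "position \<gamma> p (\<xi> (Suc r)) = position \<gamma> p (\<xi> r)" using position_eq_iff[OF \<gamma> a] by simp
  thus ?thesis using False by simp
qed

context
  fixes F :: "real fps fps" and q :: rat
  assumes steps: "\<And>r. 1 \<le> r \<Longrightarrow> r < n \<Longrightarrow> \<xi> r \<in> above \<gamma> p \<Longrightarrow> \<xi> (Suc r) \<in> above \<gamma> p \<Longrightarrow>
    (v (\<xi> r) (\<xi> (Suc r)) = p \<longrightarrow> valuation (subst_puiseux F (\<xi> (Suc r)) - subst_puiseux F (\<xi> r)) = ereal (of_rat q)) \<and>
    (p < v (\<xi> r) (\<xi> (Suc r)) \<longrightarrow> ereal (of_rat q) < valuation (subst_puiseux F (\<xi> (Suc r)) - subst_puiseux F (\<xi> r)))"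
begin

text \<open>Unlike the initial coefficient, the coefficient at a fixed exponent q is additive, so
  the increments telescope. Gaps of height p contribute their step coefficient, higher gaps
  contribute 0 at q.\<close>

lemma coeff_increment:
  assumes "i \<le> j" "1 \<le> i" "j \<le> n" "\<xi> i \<in> above \<gamma> p" "\<xi> j \<in> above \<gamma> p"
  shows "puiseux_coeff (subst_puiseux F (\<xi> j) - subst_puiseux F (\<xi> i)) q =
      discrete_integral F n \<xi> (pt \<gamma> p) (position \<gamma> p (\<xi> j) - 1) -
      discrete_integral F n \<xi> (pt \<gamma> p) (position \<gamma> p (\<xi> i) - 1) \<and>
    ereal (of_rat q) \<le> valuation (subst_puiseux F (\<xi> j) - subst_puiseux F (\<xi> i))"
  using assms
proof (induction j rule: nat_induct_at_least)
  case base
  thus ?case by (simp add: zero_puiseux.rep_eq)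
next
  case (Suc j)
  let ?\<delta> = "\<lambda>r. subst_puiseux F (\<xi> r)"
  have j: "1 \<le> j" "j < n" using Suc by auto
  have "\<xi> i \<le> \<xi> j" "\<xi> j \<le> \<xi> (Suc j)" using Suc j \<xi>_le_iff by auto
  hence aj: "\<xi> j \<in> above \<gamma> p" using above_between[of "\<xi> i" \<gamma> p "\<xi> (Suc j)" "\<xi> j"] Suc.prems j by (auto simp: N_eq)
  have IH: "puiseux_coeff (?\<delta> j - ?\<delta> i) q =
      discrete_integral F n \<xi> (pt \<gamma> p) (position \<gamma> p (\<xi> j) - 1) -
      discrete_integral F n \<xi> (pt \<gamma> p) (position \<gamma> p (\<xi> i) - 1)"
    "ereal (of_rat q) \<le> valuation (?\<delta> j - ?\<delta> i)" using Suc aj j by auto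
  note st = steps[OF j aj Suc.prems(4)]
  have step: "puiseux_coeff (?\<delta> (Suc j) - ?\<delta> j) q = (if v (\<xi> j) (\<xi> (Suc j)) = p then step_coeff F \<xi> j else 0)"
  proof (cases "v (\<xi> j) (\<xi> (Suc j)) = p")
    case True
    thus ?thesis using st initial_coeff_eq_coeff[of "?\<delta> (Suc j) - ?\<delta> j" q] by (simp add: step_coeff_def)
  next
    case False
    hence "p < v (\<xi> j) (\<xi> (Suc j))" using v_above_cases[OF \<gamma> aj Suc.prems(4)] by simp
    thus ?thesis using st False puiseux_coeff_below_valuation by simp
  qed
  have "ereal (of_rat q) \<le> valuation (?\<delta> (Suc j) - ?\<delta> j)"
    using st v_above_cases[OF \<gamma> aj Suc.prems(4)] by auto
  hence "ereal (of_rat q) \<le> valuation (?\<delta> (Suc j) - ?\<delta> i)" using IH(2) by (rule v_ultra)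
  moreover have "puiseux_coeff (?\<delta> (Suc j) - ?\<delta> i) q =
      puiseux_coeff (?\<delta> (Suc j) - ?\<delta> j) q + puiseux_coeff (?\<delta> j - ?\<delta> i) q"
    by (simp add: minus_puiseux.rep_eq)
  ultimately show ?case using step IH(1) discrete_integral_step[OF j aj Suc.prems(4), of F] by simp
qed

text \<open>The leaves lie on different outgoing edges, so injectivity makes the coefficient at q
  non-zero. With the lower bound from telescoping, q is then exactly the valuation.\<close>

lemma increment_sign:
  assumes inj: "inj_on (discrete_integral F n \<xi> (pt \<gamma> p)) {..<card (outgoing_edges X rt (pt \<gamma> p))}"
    and ij: "i < j" "1 \<le> i" "j \<le> n" "\<xi> i \<in> above \<gamma> p" "\<xi> j \<in> above \<gamma> p" "v (\<xi> i) (\<xi> j) = p"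
  shows "valuation (subst_puiseux F (\<xi> j) - subst_puiseux F (\<xi> i)) = ereal (of_rat q)"
    and "initial_coeff (subst_puiseux F (\<xi> j) - subst_puiseux F (\<xi> i)) =
      discrete_integral F n \<xi> (pt \<gamma> p) (position \<gamma> p (\<xi> j) - 1) -
      discrete_integral F n \<xi> (pt \<gamma> p) (position \<gamma> p (\<xi> i) - 1)"
proof -
  let ?D = "subst_puiseux F (\<xi> j) - subst_puiseux F (\<xi> i)" and ?I = "discrete_integral F n \<xi> (pt \<gamma> p)"
  note c = coeff_increment[OF less_imp_le[OF ij(1)] ij(2-5)]
  \<comment> \<open>Positions lie in 1, ..., p for p outgoing edges; subtracting 1 puts them into
    the range 0, ..., p - 1 on which injectivity is assumed.\<close>
  have pos: "position \<gamma> p (\<xi> i) \<in> {1..card (outgoing_edges X rt (pt \<gamma> p))}"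
    "position \<gamma> p (\<xi> j) \<in> {1..card (outgoing_edges X rt (pt \<gamma> p))}"
    using position_range[OF \<gamma>] ij by auto
  have "position \<gamma> p (\<xi> i) \<noteq> position \<gamma> p (\<xi> j)" using position_eq_iff[OF \<gamma> ij(4,5)] ij(6) by simp
  hence "?I (position \<gamma> p (\<xi> j) - 1) \<noteq> ?I (position \<gamma> p (\<xi> i) - 1)"
    using inj_onD[OF inj, of "position \<gamma> p (\<xi> j) - 1" "position \<gamma> p (\<xi> i) - 1"] pos by fastforce
  hence "puiseux_coeff ?D q \<noteq> 0" using c by simp
  hence "valuation ?D \<le> ereal (of_rat q)" using valuation_ge_iff[of "valuation ?D" ?D] by blast
  thus v: "valuation ?D = ereal (of_rat q)" using c by simp
  show "initial_coeff ?D = ?I (position \<gamma> p (\<xi> j) - 1) - ?I (position \<gamma> p (\<xi> i) - 1)"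
    using initial_coeff_eq_coeff[OF v] c by simp
qed

end

end

end

section \<open>The integrated contact tree\<close>

lemma complex_puiseux_diff: "complex_puiseux (a - b) = complex_puiseux a - complex_puiseux b"
  by (rule puiseux_eqI) (simp add: complex_puiseux.rep_eq minus_puiseux.rep_eq)

lemma valuation_complex_puiseux [simp]: "valuation (complex_puiseux a) = valuation a"
proof -
  have "t \<le> valuation (complex_puiseux a) \<longleftrightarrow> t \<le> valuation a" for t
    unfolding valuation_ge_iff by (simp add: complex_puiseux.rep_eq)
  from this[of "valuation a"] this[of "valuation (complex_puiseux a)"] show ?thesis by simp
qed

text \<open>The function \<open>V\<^sub>a\<close> of the introduction.\<close>

definition contact_height :: "complex puiseux multiset \<Rightarrow> real puiseux \<Rightarrow> ereal \<Rightarrow> ereal" where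
  "contact_height \<Gamma> a t = t + (\<Sum>\<gamma>\<in>#\<Gamma>. min t (valuation (complex_puiseux a - \<gamma>)))"

lemma sum_min_nonneg:
  fixes w :: "'b \<Rightarrow> ereal"
  assumes "\<And>\<gamma>. 0 \<le> w \<gamma>" "0 \<le> t"
  shows "0 \<le> (\<Sum>\<gamma>\<in>#\<Gamma>. min t (w \<gamma>))"
  using assms by (induction \<Gamma>) auto

lemma contact_height_0: "contact_height \<Gamma> a 0 = 0"
proof -
  have "min 0 (valuation (complex_puiseux a - \<gamma>)) = 0" for \<gamma>
    using valuation_nonneg[of "complex_puiseux a - \<gamma>"] by (simp add: min_def)
  thus ?thesis by (simp add: contact_height_def)
qed

lemma contact_height_inf: "contact_height \<Gamma> a \<infinity> = \<infinity>"
  using sum_min_nonneg[of "\<lambda>\<gamma>. valuation (complex_puiseux a - \<gamma>)" \<infinity> \<Gamma>] valuation_nonneg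
  by (auto simp: contact_height_def)

text \<open>The summand t increases strictly and the rest is non-decreasing. The sum at s is finite,
  which keeps the inequality strict in the extended reals.\<close>

lemma contact_height_less:
  assumes "0 \<le> s" "s < t"
  shows "contact_height \<Gamma> a s < contact_height \<Gamma> a t"
proof -
  let ?S = "\<lambda>t. \<Sum>\<gamma>\<in>#\<Gamma>. min t (valuation (complex_puiseux a - \<gamma>))"
  have "\<bar>s\<bar> \<noteq> \<infinity>" using assms by auto
  then obtain s' where s': "s = ereal s'" by auto
  have "?S s \<noteq> \<infinity>"
    unfolding s' by (induction \<Gamma>) (auto simp: min_def)
  moreover have "0 \<le> ?S s" using assms valuation_nonneg by (intro sum_min_nonneg) auto
  ultimately obtain S where S: "?S s = ereal S" by (cases "?S s") auto
  have "?S s \<le> ?S t" using assms(2) by (induction \<Gamma>) (auto intro!: add_mono min.mono)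
  hence "t + ereal S \<le> t + ?S t" unfolding S by (rule add_left_mono)
  moreover have "s + ereal S < t + ereal S" using assms(2) s' by (cases t) auto
  ultimately show ?thesis unfolding contact_height_def S by (rule less_le_trans[rotated])
qed

text \<open>Addition of extended reals is continuous away from -\<infinity>, and here all summands
  are non-negative.\<close>

lemma continuous_contact_height: "continuous_on {0..} (contact_height \<Gamma> a)"
  unfolding continuous_on_def
proof
  fix t :: ereal assume t: "t \<in> {0..}"
  let ?w = "\<lambda>\<gamma>. valuation (complex_puiseux a - \<gamma>)"
  have id: "((\<lambda>x. x) \<longlongrightarrow> t) (at t within {0..})" by (rule tendsto_ident_at)
  have ninf: "0 \<le> (\<Sum>\<gamma>\<in>#\<Gamma>. min t (?w \<gamma>))" for \<Gamma> using t valuation_nonneg by (intro sum_min_nonneg) auto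
  have "((\<lambda>t. \<Sum>\<gamma>\<in>#\<Gamma>. min t (?w \<gamma>)) \<longlongrightarrow> (\<Sum>\<gamma>\<in>#\<Gamma>. min t (?w \<gamma>))) (at t within {0..})"
  proof (induction \<Gamma>)
    case (add \<gamma> \<Gamma>)
    have "min t (?w \<gamma>) \<noteq> -\<infinity>" using t valuation_nonneg[of "complex_puiseux a - \<gamma>"] by (auto simp: min_def)
    moreover have "(\<Sum>\<gamma>\<in>#\<Gamma>. min t (?w \<gamma>)) \<noteq> -\<infinity>" using ninf[of \<Gamma>] by auto
    ultimately have "((\<lambda>t. min t (?w \<gamma>) + (\<Sum>\<gamma>\<in>#\<Gamma>. min t (?w \<gamma>))) \<longlongrightarrow>
        min t (?w \<gamma>) + (\<Sum>\<gamma>\<in>#\<Gamma>. min t (?w \<gamma>))) (at t within {0..})"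
      using add id by (intro tendsto_add_ereal_nonneg tendsto_min tendsto_const)
    thus ?case by simp
  qed simp
  moreover have "t \<noteq> -\<infinity>" using t by auto
  moreover have "(\<Sum>\<gamma>\<in>#\<Gamma>. min t (?w \<gamma>)) \<noteq> -\<infinity>" using ninf[of \<Gamma>] by auto
  ultimately show "(contact_height \<Gamma> a \<longlongrightarrow> contact_height \<Gamma> a t) (at t within {0..})"
    unfolding contact_height_def using id by (intro tendsto_add_ereal_nonneg)
qed

text \<open>If a and b agree up to t, their contacts with any \<gamma> can differ only above t,
  where the minimum with t hides the difference.\<close>

lemma contact_height_cong:
  assumes "t \<le> valuation (a - b)"
  shows "contact_height \<Gamma> a t = contact_height \<Gamma> b t"
proof -
  have "min t (valuation (complex_puiseux a - \<gamma>)) \<le> min t (valuation (complex_puiseux b - \<gamma>))"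
    if "t \<le> valuation (complex_puiseux b - complex_puiseux a)" for a b \<gamma>
    using that valuation_ultrametric[of "complex_puiseux b" "complex_puiseux a" \<gamma>]
    by (auto intro: order_trans[rotated] min.mono)
  moreover have "valuation (complex_puiseux a - complex_puiseux b) = valuation (a - b)"
    "valuation (complex_puiseux b - complex_puiseux a) = valuation (a - b)"
    by (simp_all flip: complex_puiseux_diff add: valuation_minus_commute)
  ultimately have "min t (valuation (complex_puiseux a - \<gamma>)) = min t (valuation (complex_puiseux b - \<gamma>))" for \<gamma>
    using assms by (intro antisym) auto
  thus ?thesis by (simp add: contact_height_def)
qed

text \<open>Provides the rational exponent at which a coefficient of the increment can be read
  off.\<close>

lemma contact_height_rational:
  assumes "t = ereal (of_rat q)"
  shows "\<exists>q'. contact_height \<Gamma> a t = ereal (of_rat q')"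
proof -
  have "\<exists>q'. min t (valuation b) = ereal (of_rat q')" for b :: "complex puiseux"
    using assms by (auto simp: valuation_def min_def)
  then obtain m where m: "\<And>b :: complex puiseux. min t (valuation b) = ereal (of_rat (m b))" by metis
  have "(\<Sum>\<gamma>\<in>#\<Gamma>. min t (valuation (complex_puiseux a - \<gamma>))) = ereal (of_rat (\<Sum>\<gamma>\<in>#\<Gamma>. m (complex_puiseux a - \<gamma>)))"
    by (induction \<Gamma>) (auto simp: m of_rat_add)
  hence "contact_height \<Gamma> a t = ereal (of_rat (q + (\<Sum>\<gamma>\<in>#\<Gamma>. m (complex_puiseux a - \<gamma>))))"
    using assms by (simp add: contact_height_def of_rat_add)
  thus ?thesis by blast
qed

section \<open>Contacts and order of the roots of the apparent contour\<close>

locale puiseux_roots = ordered_contact_set +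
  fixes f F :: "real fps fps" and \<Gamma> :: "complex puiseux multiset"
  assumes f: "f \<in> convergent_fps2" and F: "F \<in> convergent_fps2" "fps_deriv F = f"
    and \<Gamma>: "newton_puiseux_roots f \<Gamma>" and N_roots: "N = {\<xi>. complex_puiseux \<xi> \<in># \<Gamma>}"
    and injective: "\<And>P. P \<in> internal_vertices X rt \<Longrightarrow>
      inj_on (discrete_integral F n \<xi> P) {..<card (outgoing_edges X rt P)}"
begin

abbreviation \<delta> where "\<delta> a \<equiv> subst_puiseux F a"

lemma valuation_step:
  assumes "1 \<le> r" "r < n"
  shows "valuation (\<delta> (\<xi> (Suc r)) - \<delta> (\<xi> r)) = contact_height \<Gamma> (\<xi> r) (v (\<xi> r) (\<xi> (Suc r)))"
proof -
  have "\<xi> r \<in> N" "\<xi> (Suc r) \<in> N" using assms by (auto simp: N_eq)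
  hence "complex_puiseux (\<xi> r) \<in># \<Gamma>" "complex_puiseux (\<xi> (Suc r)) \<in># \<Gamma>" by (auto simp: N_roots)
  moreover have "\<xi> r < \<xi> (Suc r)" using assms \<xi>_less_iff[of r "Suc r"] by auto
  moreover have "\<eta> \<le> \<xi> r \<or> \<xi> (Suc r) \<le> \<eta>" if "complex_puiseux \<eta> \<in># \<Gamma>" for \<eta>
    using \<xi>_consecutive[OF assms] that by (auto simp: N_roots)
  ultimately show ?thesis
    using valuation_primitive_increment[OF \<Gamma> f F, of "\<xi> r" "\<xi> (Suc r)"]
    by (simp add: contact_height_def v_commute[of "\<xi> (Suc r)"])
qed

text \<open>Both roots lie above the point at height p, so their height functions agree with that of
  \<gamma> there. Strict monotonicity then separates the gaps at the vertex from the higher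
  ones.\<close>

lemma step_valuations:
  assumes \<gamma>: "\<gamma> \<in> N" "p \<in> crit \<gamma>" and q: "contact_height \<Gamma> \<gamma> p = ereal (of_rat q)"
    and r: "1 \<le> r" "r < n" "\<xi> r \<in> above \<gamma> p" "\<xi> (Suc r) \<in> above \<gamma> p"
  shows "(v (\<xi> r) (\<xi> (Suc r)) = p \<longrightarrow> valuation (\<delta> (\<xi> (Suc r)) - \<delta> (\<xi> r)) = ereal (of_rat q)) \<and>
    (p < v (\<xi> r) (\<xi> (Suc r)) \<longrightarrow> ereal (of_rat q) < valuation (\<delta> (\<xi> (Suc r)) - \<delta> (\<xi> r)))"
proof -
  have "contact_height \<Gamma> (\<xi> r) p = ereal (of_rat q)"
    unfolding q[symmetric] using r(3) by (intro contact_height_cong) (simp add: above_def v_commute[of "\<xi> r"])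
  thus ?thesis unfolding valuation_step[OF r(1,2)]
    using contact_height_less[OF crit_nonneg[OF \<gamma>], of "v (\<xi> r) (\<xi> (Suc r))" \<Gamma> "\<xi> r"] by auto
qed

lemma increment:
  assumes int: "pt \<gamma> p \<in> internal_vertices X rt" and \<gamma>: "\<gamma> \<in> N" "p \<in> crit \<gamma>" "p < \<infinity>"
    and ij: "1 \<le> i" "i < j" "j \<le> n" "\<xi> i \<in> above \<gamma> p" "\<xi> j \<in> above \<gamma> p" "v (\<xi> i) (\<xi> j) = p"
  shows "valuation (\<delta> (\<xi> j) - \<delta> (\<xi> i)) = contact_height \<Gamma> \<gamma> p"
    and "initial_coeff (\<delta> (\<xi> j) - \<delta> (\<xi> i)) =
      discrete_integral F n \<xi> (pt \<gamma> p) (position \<gamma> p (\<xi> j) - 1) -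
      discrete_integral F n \<xi> (pt \<gamma> p) (position \<gamma> p (\<xi> i) - 1)"
proof -
  \<comment> \<open>As the valuation of a non-zero series, p is rational.\<close>
  have "\<xi> i - \<xi> j \<noteq> 0" using ij(6) \<gamma>(3) by auto
  then obtain q0 where "p = ereal (of_rat q0)" using ij(6) by (auto simp: valuation_def)
  then obtain q where q: "contact_height \<Gamma> \<gamma> p = ereal (of_rat q)" using contact_height_rational by blast
  note * = increment_sign[OF \<gamma> step_valuations[OF \<gamma>(1,2) q] injective[OF int] ij(2,1,3-6)]
  show "valuation (\<delta> (\<xi> j) - \<delta> (\<xi> i)) = contact_height \<Gamma> \<gamma> p" unfolding q by (rule *(1))
  show "initial_coeff (\<delta> (\<xi> j) - \<delta> (\<xi> i)) =
      discrete_integral F n \<xi> (pt \<gamma> p) (position \<gamma> p (\<xi> j) - 1) -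
      discrete_integral F n \<xi> (pt \<gamma> p) (position \<gamma> p (\<xi> i) - 1)" by (rule *(2))
qed

text \<open>For two distinct roots, not necessarily consecutive, the increment formula is applied at
  the vertex where their paths separate.\<close>

lemma valuation_\<delta>:
  assumes "a \<in> N" "b \<in> N"
  shows "valuation (\<delta> a - \<delta> b) = contact_height \<Gamma> a (v a b)"
proof -
  have *: "valuation (\<delta> (\<xi> j) - \<delta> (\<xi> i)) = contact_height \<Gamma> (\<xi> i) (v (\<xi> i) (\<xi> j))"
    if ij: "1 \<le> i" "i < j" "j \<le> n" for i j
  proof -
    have N: "\<xi> i \<in> N" "\<xi> j \<in> N" using ij by (auto simp: N_eq)
    have ne: "\<xi> i \<noteq> \<xi> j" using \<xi>_less_iff[of i j] ij by auto
    hence fin: "v (\<xi> i) (\<xi> j) < \<infinity>" by (simp add: valuation_eq_PInf_iff less_top)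
    show ?thesis
      using increment(1)[OF meet_internal[OF N ne] N(1) v_in_crit[OF N(2)] fin ij] N by (simp add: above_def)
  qed
  obtain i j where ij: "a = \<xi> i" "b = \<xi> j" "i \<in> {1..n}" "j \<in> {1..n}" using assms unfolding N_eq by blast
  show ?thesis
  proof (cases i j rule: linorder_cases)
    case less
    thus ?thesis using *[of i j] ij by (simp add: valuation_minus_commute[of "\<delta> (\<xi> i)"])
  next
    case equal
    thus ?thesis using ij by (simp add: contact_height_inf)
  next
    case greater
    thus ?thesis using *[of j i] ij contact_height_cong[of "v a b" a b \<Gamma>] by (simp add: v_commute[of "\<xi> i"])
  qed
qed

sublocale contact_map N "\<delta> ` N" \<delta> "contact_height \<Gamma>"
proof unfold_locales
  have pos: "0 < valuation (\<delta> a - \<delta> b)" if "a \<in> N" "b \<in> N" for a b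
    using contact_height_less[of 0 "v a b" \<Gamma> a] valuation_pos[OF that]
    by (simp add: valuation_\<delta>[OF that] contact_height_0)
  show "finite (\<delta> ` N)" using finite_N by simp
  show "0 < valuation (a - b)" if "a \<in> \<delta> ` N" "b \<in> \<delta> ` N" for a b using that pos by auto
  show "bij_betw \<delta> N (\<delta> ` N)"
  proof (rule inj_on_imp_bij_betw, rule inj_onI)
    fix a b assume ab: "a \<in> N" "b \<in> N" "\<delta> a = \<delta> b"
    \<comment> \<open>Distinctness of the images comes from heights: by strict monotonicity the
      height function reaches \<infinity> only at \<infinity>, that is, for a = b.\<close>
    have "contact_height \<Gamma> a (v a b) = \<infinity>" using valuation_\<delta>[OF ab(1,2)] ab(3) by simp
    hence "\<not> v a b < \<infinity>"
      using contact_height_less[of "v a b" \<infinity> \<Gamma> a] valuation_nonneg[of "a - b"] by (auto simp: contact_height_inf)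
    thus "a = b" by (simp add: valuation_eq_PInf_iff flip: less_top)
  qed
qed (auto intro: continuous_contact_height contact_height_less contact_height_cong
    simp: contact_height_0 contact_height_inf valuation_\<delta>)

text \<open>Positions are the inverse of the numbering by \<open>nth_outgoing_edge\<close>, so the
  indices k and l in the definition are determined by the two edges.\<close>

lemma integrated_edge_less_iff:
  assumes \<gamma>: "\<gamma> \<in> N" "p \<in> crit \<gamma>" "p < \<infinity>" and a: "\<gamma>1 \<in> above \<gamma> p" "\<gamma>2 \<in> above \<gamma> p"
  shows "edge_less (integrated_contact_tree F n \<xi>) (pt \<gamma> p) (out \<gamma>1 p) (out \<gamma>2 p) \<longleftrightarrow>
    discrete_integral F n \<xi> (pt \<gamma> p) (position \<gamma> p \<gamma>1 - 1) < discrete_integral F n \<xi> (pt \<gamma> p) (position \<gamma> p \<gamma>2 - 1)"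
proof -
  let ?K = "{1..card (outgoing_edges X rt (pt \<gamma> p))}" and ?I = "discrete_integral F n \<xi> (pt \<gamma> p)"
  let ?nth = "nth_outgoing_edge (real_contact_tree N) (pt \<gamma> p)"
  have T: "tree_space (real_contact_tree N) = X" "tree_root (real_contact_tree N) = rt"
    by (simp_all add: real_contact_tree_def Let_def)
  have nth: "k = position \<gamma> p \<mu>" if k: "k \<in> ?K" "out \<mu> p = ?nth k" and \<mu>: "\<mu> \<in> above \<gamma> p" for k \<mu>
  proof -
    obtain \<nu> where \<nu>: "\<nu> \<in> above \<gamma> p" "position \<gamma> p \<nu> = k" using position_surj[OF \<gamma> k(1)] by blast
    hence "out \<mu> p = out \<nu> p" using nth_outgoing_edge_position[OF \<gamma> \<nu>(1)] k(2) by simp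
    thus ?thesis using out_above_eq_iff[OF \<gamma> \<mu> \<nu>(1)] position_eq_iff[OF \<gamma> \<mu> \<nu>(1)] \<nu>(2) by simp
  qed
  have "edge_less (integrated_contact_tree F n \<xi>) (pt \<gamma> p) (out \<gamma>1 p) (out \<gamma>2 p) \<longleftrightarrow>
    (\<exists>k\<in>?K. \<exists>l\<in>?K. out \<gamma>1 p = ?nth k \<and> out \<gamma>2 p = ?nth l \<and> ?I (k - 1) < ?I (l - 1))"
    unfolding integrated_contact_tree_def Let_def N_eq[symmetric] T by simp
  also have "\<dots> \<longleftrightarrow> ?I (position \<gamma> p \<gamma>1 - 1) < ?I (position \<gamma> p \<gamma>2 - 1)"
  proof
    assume "\<exists>k\<in>?K. \<exists>l\<in>?K. out \<gamma>1 p = ?nth k \<and> out \<gamma>2 p = ?nth l \<and> ?I (k - 1) < ?I (l - 1)"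
    thus "?I (position \<gamma> p \<gamma>1 - 1) < ?I (position \<gamma> p \<gamma>2 - 1)" using nth a by blast
  next
    assume "?I (position \<gamma> p \<gamma>1 - 1) < ?I (position \<gamma> p \<gamma>2 - 1)"
    thus "\<exists>k\<in>?K. \<exists>l\<in>?K. out \<gamma>1 p = ?nth k \<and> out \<gamma>2 p = ?nth l \<and> ?I (k - 1) < ?I (l - 1)"
      using position_range[OF \<gamma> a(1)] position_range[OF \<gamma> a(2)] nth_outgoing_edge_position[OF \<gamma> a(1)]
        nth_outgoing_edge_position[OF \<gamma> a(2)]
      by (intro bexI[of _ "position \<gamma> p \<gamma>1"] bexI[of _ "position \<gamma> p \<gamma>2"] conjI) auto
  qed
  finally show ?thesis .
qed

lemma planar_isomorphic_contact_trees:
  "planar_isomorphic (integrated_contact_tree F n \<xi>) (real_contact_tree (\<delta> ` N))"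
proof (rule planar_isomorphicI)
  show "tree_space (integrated_contact_tree F n \<xi>) = X" "tree_root (integrated_contact_tree F n \<xi>) = rt"
    unfolding integrated_contact_tree_def Let_def N_eq[symmetric] by (simp_all add: real_contact_tree_def Let_def)
  fix \<gamma> p \<gamma>1 \<gamma>2
  assume int: "pt \<gamma> p \<in> internal_vertices X rt" and \<gamma>: "\<gamma> \<in> N" "p \<in> crit \<gamma>" "p < \<infinity>"
    and \<gamma>12: "\<gamma>1 \<in> N" "\<gamma>2 \<in> N" "p \<le> v \<gamma> \<gamma>1" "p \<le> v \<gamma> \<gamma>2"
  have a: "\<gamma>1 \<in> above \<gamma> p" "\<gamma>2 \<in> above \<gamma> p" using \<gamma>12 by (auto simp: above_def)
  let ?I = "discrete_integral F n \<xi> (pt \<gamma> p)"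
  obtain i j where ij: "\<gamma>1 = \<xi> i" "\<gamma>2 = \<xi> j" "i \<in> {1..n}" "j \<in> {1..n}" using \<gamma>12(1,2) unfolding N_eq by blast
  have "?I (position \<gamma> p \<gamma>1 - 1) < ?I (position \<gamma> p \<gamma>2 - 1) \<longleftrightarrow> v \<gamma>1 \<gamma>2 = p \<and> \<delta> \<gamma>1 < \<delta> \<gamma>2"
  proof (cases "v \<gamma>1 \<gamma>2 = p")
    case False
    \<comment> \<open>Both leaves lie on the same outgoing edge, and neither side of the equivalence
      holds.\<close>
    hence "position \<gamma> p \<gamma>1 = position \<gamma> p \<gamma>2" using position_eq_iff[OF \<gamma> a] v_above_cases[OF \<gamma> a] by simp
    thus ?thesis using False by simp
  next
    case True
    have "i \<noteq> j" using True ij \<gamma>(3) by auto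
    hence "initial_coeff (\<delta> \<gamma>2 - \<delta> \<gamma>1) = ?I (position \<gamma> p \<gamma>2 - 1) - ?I (position \<gamma> p \<gamma>1 - 1)"
    proof (cases i j rule: linorder_cases)
      case less
      thus ?thesis using increment(2)[OF int \<gamma>, of i j] ij a True by simp
    next
      case greater
      \<comment> \<open>The integrated order may reverse the order of the roots; the increment is
        taken from the smaller root and its sign is changed.\<close>
      have "v \<gamma>2 \<gamma>1 = p" using True by (subst v_commute)
      hence "initial_coeff (\<delta> \<gamma>1 - \<delta> \<gamma>2) = ?I (position \<gamma> p \<gamma>1 - 1) - ?I (position \<gamma> p \<gamma>2 - 1)"
        using increment(2)[OF int \<gamma>, of j i] greater ij a by simp
      thus ?thesis using initial_coeff_uminus[of "\<delta> \<gamma>1 - \<delta> \<gamma>2"] by simp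
    qed simp
    thus ?thesis using True by (simp add: less_puiseux_def)
  qed
  thus "edge_less (integrated_contact_tree F n \<xi>) (pt \<gamma> p) (out \<gamma>1 p) (out \<gamma>2 p) \<longleftrightarrow>
      v \<gamma>1 \<gamma>2 = p \<and> \<delta> \<gamma>1 < \<delta> \<gamma>2"
    using integrated_edge_less_iff[OF \<gamma> a] by simp
qed

end

theorem theoremB:
  fixes f F :: "real fps fps" and n :: nat and \<xi> :: "nat \<Rightarrow> real puiseux"
  assumes "right_reduced f"
    and "primitive f F"
    and "strict_mono_on {1..n} \<xi>" and "\<xi> ` {1..n} = real_roots f"
    and "injectivity_condition F n \<xi>"
  shows "planar_isomorphic (integrated_contact_tree F n \<xi>)
      (real_contact_tree ((\<lambda>i. subst_puiseux F (\<xi> i)) ` {1..n})) \<and>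
    (\<exists>r>0. \<forall>a b. - r \<le> a \<and> a < 0 \<and> 0 < b \<and> b \<le> r \<longrightarrow>
       (\<exists>\<epsilon>\<^sub>0>0. \<forall>\<epsilon>. 0 < \<epsilon> \<and> \<epsilon> \<le> \<epsilon>\<^sub>0 \<longrightarrow>
          real_roots_of_curve (apparent_contour f F \<epsilon> {a..b}) =
            (\<lambda>i. subst_puiseux F (\<xi> i)) ` {1..n}))"
proof
  obtain \<Gamma> where \<Gamma>: "newton_puiseux_roots f \<Gamma>" and f: "f \<in> convergent_fps2"
    using assms(1) by (auto simp: right_reduced_def)
  have F: "F \<in> convergent_fps2" "fps_deriv F = f" using assms(2) by (auto simp: primitive_def)
  have roots: "\<xi> ` {1..n} = {\<xi>. complex_puiseux \<xi> \<in># \<Gamma>}" using assms(4) real_roots_eq[OF \<Gamma> f] by simp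
  have image: "(\<lambda>i. subst_puiseux F (\<xi> i)) ` {1..n} = subst_puiseux F ` \<xi> ` {1..n}" by (simp add: image_image)
  interpret puiseux_roots "\<xi> ` {1..n}" n \<xi> f F \<Gamma>
  proof unfold_locales
    show "finite (\<xi> ` {1..n})" by simp
    fix a b assume "a \<in> \<xi> ` {1..n}" "b \<in> \<xi> ` {1..n}"
    hence "puiseux_coeff (a - b) 0 = 0"
      unfolding roots using newton_puiseux_real_rootD(2)[OF \<Gamma>] by (simp add: minus_puiseux.rep_eq)
    thus "0 < valuation (a - b)" by (simp add: valuation_pos_iff)
  next
    fix P assume "P \<in> internal_vertices (contact_space (\<xi> ` {1..n})) (contact_root (\<xi> ` {1..n}))"
    thus "inj_on (discrete_integral F n \<xi> P)
        {..<card (outgoing_edges (contact_space (\<xi> ` {1..n})) (contact_root (\<xi> ` {1..n})) P)}"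
      using assms(5) unfolding injectivity_condition_def Let_def by blast
  qed (use assms(3) f F \<Gamma> roots in simp_all)
  show "planar_isomorphic (integrated_contact_tree F n \<xi>)
      (real_contact_tree ((\<lambda>i. subst_puiseux F (\<xi> i)) ` {1..n}))"
    unfolding image by (rule planar_isomorphic_contact_trees)
  obtain r where r: "r > 0" "\<And>a b \<epsilon>. - r \<le> a \<and> a < 0 \<and> 0 < b \<and> b \<le> r \<and> 0 < \<epsilon> \<Longrightarrow>
      real_roots_of_curve (apparent_contour f F \<epsilon> {a..b}) = subst_puiseux F ` real_roots f"
    using real_roots_of_apparent_contour[OF \<Gamma> f F(1)] by blast
  show "\<exists>r>0. \<forall>a b. - r \<le> a \<and> a < 0 \<and> 0 < b \<and> b \<le> r \<longrightarrow>
       (\<exists>\<epsilon>\<^sub>0>0. \<forall>\<epsilon>. 0 < \<epsilon> \<and> \<epsilon> \<le> \<epsilon>\<^sub>0 \<longrightarrow>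
          real_roots_of_curve (apparent_contour f F \<epsilon> {a..b}) =
            (\<lambda>i. subst_puiseux F (\<xi> i)) ` {1..n})"
    unfolding image assms(4)
    \<comment> \<open>The value 1 for \<open>\<epsilon>\<^sub>0\<close> is arbitrary: the roots of
      the curve depend only on its germ at x = 0.\<close>
    by (intro exI[of _ r] conjI r(1) allI impI exI[of _ 1]) (use r(2) in auto)
qed

end
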